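(* Let $d\ge1$, $0<\alpha<1$, $\beta>0$, $\alpha\le\gamma\le1$, and for $t>0$ let $K_t=\mathcal{F}^{-1}[E_\alpha(i^{-\gamma}t^\alpha|\xi|^\beta)]$ be the fundamental solution of $i^\gamma\partial_t^\alpha u=(-\Delta)^{\beta/2}u$ on $\mathbb{R}^d$. Let $N\in2^{\mathbb{Z}}$. In the estimates below the implicit constants are independent of $N$, $t>0$ and $f\in L^1(\mathbb{R}^d)$. If $\alpha=\gamma\in(0,1)$ and $\alpha\ne\beta$, then $$\|P_NK_t*f\|_{L^\infty(\mathbb{R}^d)}\lesssim N^d\left(\frac1{1+t^\alpha N^\beta}+\frac1{1+t^{\frac d2}N^{\frac{d\beta}{2\alpha}}}\right)\|f\|_{L^1}.$$ If $\alpha<\gamma\le1$, then $$\|P_NK_t*f\|_{L^\infty(\mathbb{R}^d)}\lesssim\frac{N^d}{1+t^\alpha N^\beta}\|f\|_{L^1}.$$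
   Context: The Fourier transform is $\widehat f(\xi)=\int f(x)e^{-ix\cdot\xi}\,dx$, $\mathcal{F}^{-1}[f](x)=(2\pi)^{-d}\int f(\xi)e^{ix\cdot\xi}\,d\xi$, extended to tempered distributions. $i^\alpha:=e^{i\pi\alpha/2}$. The Mittag-Leffler function is $E_\alpha(z)=\sum_{k\ge0}\frac{z^k}{\Gamma(\alpha k+1)}$. $\partial_t^\alpha$ is the Caputo derivative $\partial_t^\alpha u(t)=\frac1{\Gamma(1-\alpha)}\int_0^t\frac{\partial_tu(\tau)}{(t-\tau)^\alpha}\,d\tau$. Let $\psi\in C_c^\infty(\mathbb{R}^d)$ be a radial smooth bump function supported in $B(0,2)$ and equal to $1$ on $B(0,1)$; set $\zeta(\xi)=\psi(\xi)-\psi(2\xi)$, $\zeta_N(\xi)=\zeta(\xi/N)$ and $P_Nf=\mathcal{F}^{-1}[\zeta_N\widehat f]$. *)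

theory Defs
  imports "HOL-Analysis.Analysis" "HOL-Probability.Essential_Supremum"
begin

text \<open>Iterated partial derivatives along a list of (basis) directions. A function all of whose
  iterated partial derivatives are Frechet differentiable everywhere is exactly a
  \<open>C\<^sup>\<infinity>\<close> function.\<close>

primrec partials ::
  "'a::euclidean_space list \<Rightarrow> ('a \<Rightarrow> 'b::real_normed_vector) \<Rightarrow> 'a \<Rightarrow> 'b" where
  "partials [] f = f"
| "partials (b # bs) f = (\<lambda>x. frechet_derivative (partials bs f) (at x) b)"

definition smooth :: "('a::euclidean_space \<Rightarrow> 'b::real_normed_vector) \<Rightarrow> bool" where
  "smooth f \<longleftrightarrow> (\<forall>bs. set bs \<subseteq> Basis \<longrightarrow> (\<forall>x. partials bs f differentiable (at x)))"

definition schwartz :: "('a::euclidean_space \<Rightarrow> complex) set" where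
  "schwartz = {\<phi>. smooth \<phi> \<and>
     (\<forall>bs (k::nat). set bs \<subseteq> Basis \<longrightarrow>
        bounded (range (\<lambda>x. norm x ^ k *\<^sub>R partials bs \<phi> x)))}"

definition fourier :: "('a::euclidean_space \<Rightarrow> complex) \<Rightarrow> 'a \<Rightarrow> complex" where
  "fourier f \<xi> = (LINT x|lborel. f x * exp (- \<i> * of_real (x \<bullet> \<xi>)))"

definition inv_fourier :: "('a::euclidean_space \<Rightarrow> complex) \<Rightarrow> 'a \<Rightarrow> complex" where
  "inv_fourier f x =
     (LINT \<xi>|lborel. f \<xi> * exp (\<i> * of_real (x \<bullet> \<xi>))) / of_real ((2 * pi) ^ DIM('a))"

text \<open>Distributions are functionals that are only ever meant to be evaluated at Schwartz
  functions; outside \<^const>\<open>schwartz\<close> their values are irrelevant. The operations on them are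
  the usual ones, by transposition.\<close>

type_synonym 'a distribution = "('a \<Rightarrow> complex) \<Rightarrow> complex"

definition dist_of_fun :: "('a::euclidean_space \<Rightarrow> complex) \<Rightarrow> 'a distribution" where
  "dist_of_fun g \<phi> = (LINT x|lborel. g x * \<phi> x)"

definition fourier_dist :: "'a::euclidean_space distribution \<Rightarrow> 'a distribution" where
  "fourier_dist T \<phi> = T (fourier \<phi>)"

definition inv_fourier_dist :: "'a::euclidean_space distribution \<Rightarrow> 'a distribution" where
  "inv_fourier_dist T \<phi> = T (inv_fourier \<phi>)"

definition mult_dist ::
  "('a::euclidean_space \<Rightarrow> complex) \<Rightarrow> 'a distribution \<Rightarrow> 'a distribution" where
  "mult_dist h T \<phi> = T (\<lambda>x. h x * \<phi> x)"

text \<open>The distribution \<open>T\<close> is (given by) the function \<open>k\<close>. Integrability against all Schwartz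
  functions makes \<open>k\<close> locally integrable, so \<open>k\<close> is determined by \<open>T\<close> almost everywhere.\<close>

definition represents :: "('a::euclidean_space \<Rightarrow> complex) \<Rightarrow> 'a distribution \<Rightarrow> bool" where
  "represents k T \<longleftrightarrow> k \<in> borel_measurable lborel \<and>
     (\<forall>\<phi>\<in>schwartz. integrable lborel (\<lambda>x. k x * \<phi> x) \<and> T \<phi> = dist_of_fun k \<phi>)"

definition convolution ::
  "('a::euclidean_space \<Rightarrow> complex) \<Rightarrow> ('a \<Rightarrow> complex) \<Rightarrow> 'a \<Rightarrow> complex" where
  "convolution k f x = (LINT y|lborel. k (x - y) * f y)"

definition Linf_norm :: "('a::euclidean_space \<Rightarrow> complex) \<Rightarrow> ennreal" where
  "Linf_norm g = esssup lborel (\<lambda>x. ennreal (norm (g x)))"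

definition L1_norm :: "('a::euclidean_space \<Rightarrow> complex) \<Rightarrow> real" where
  "L1_norm f = (LINT x|lborel. norm (f x))"

definition dyadic :: "real set" where
  "dyadic = range (\<lambda>n::int. 2 powi n)"

text \<open>The support lies in the closed ball of radius 2; this is the weaker of the two readings of
  ``supported in \<open>B(0,2)\<close>''. By continuity, \<open>\<psi> = 1\<close> on the closed unit ball as well.\<close>

definition radial_bump :: "('a::euclidean_space \<Rightarrow> real) \<Rightarrow> bool" where
  "radial_bump \<psi> \<longleftrightarrow> smooth \<psi> \<and> (\<forall>x y. norm x = norm y \<longrightarrow> \<psi> x = \<psi> y) \<and>
     closure {x. \<psi> x \<noteq> 0} \<subseteq> cball 0 2 \<and> (\<forall>x\<in>ball 0 1. \<psi> x = 1)"

definition zeta :: "('a::euclidean_space \<Rightarrow> real) \<Rightarrow> 'a \<Rightarrow> real" where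
  "zeta \<psi> \<xi> = \<psi> \<xi> - \<psi> (2 *\<^sub>R \<xi>)"

definition LP ::
  "('a::euclidean_space \<Rightarrow> real) \<Rightarrow> real \<Rightarrow> 'a distribution \<Rightarrow> 'a distribution" where
  "LP \<psi> N T =
     inv_fourier_dist (mult_dist (\<lambda>\<xi>. of_real (zeta \<psi> (\<xi> /\<^sub>R N))) (fourier_dist T))"

definition mittag_leffler :: "real \<Rightarrow> complex \<Rightarrow> complex" where
  "mittag_leffler \<alpha> z = (\<Sum>k. z ^ k / of_real (Gamma (\<alpha> * real k + 1)))"

definition ipow :: "real \<Rightarrow> complex" where
  "ipow a = exp (\<i> * of_real (pi * a / 2))"

definition fundamental_solution ::
  "real \<Rightarrow> real \<Rightarrow> real \<Rightarrow> real \<Rightarrow> 'a::euclidean_space distribution" where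
  "fundamental_solution \<alpha> \<beta> \<gamma> t = inv_fourier_dist (dist_of_fun
     (\<lambda>\<xi>. mittag_leffler \<alpha> (ipow (- \<gamma>) * of_real (t powr \<alpha> * norm \<xi> powr \<beta>))))"

end

theory Submission
  imports Defs "HOL-Complex_Analysis.Complex_Analysis"
begin

text \<open>
  After rescaling to \<open>N = 1\<close> and with \<open>s = t\<^sup>\<alpha> N\<^sup>\<beta>\<close>, both estimates are bounds, uniform in \<open>y\<close>, for the
  integral of \<open>\<zeta>(\<eta>) E\<^sub>\<alpha>(i\<^sup>-\<^sup>\<gamma> s |\<eta>|\<^sup>\<beta>) e\<^sup>i\<^sup>y\<^sup>\<eta>\<close>.

  The function \<open>t \<mapsto> E\<^sub>\<alpha>(\<omega> t\<^sup>\<alpha>)\<close> has the Laplace transform \<open>s\<^sup>\<alpha>\<^sup>-\<^sup>1 / (s\<^sup>\<alpha> - \<omega>)\<close>. For \<open>\<omega> = i\<^sup>-\<^sup>\<gamma>\<close> with \<open>\<gamma> > \<alpha>\<close>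
  it is holomorphic in a sector slightly larger than the right half plane, and shifting the
  inversion contour gives \<open>E\<^sub>\<alpha>(\<omega> \<rho>) = O(1 / (1 + \<rho>))\<close>. For \<open>\<gamma> = \<alpha>\<close> there is in addition a pole at \<open>-i\<close>,
  which contributes \<open>\<alpha>\<^sup>-\<^sup>1 exp (- i \<rho>\<^sup>1\<^sup>/\<^sup>\<alpha>)\<close>. The resulting oscillatory integral with phase
  \<open>y \<bullet> \<eta> - \<sigma> |\<eta>|\<^sup>b\<close>, where \<open>b = \<beta> / \<alpha> \<noteq> 1\<close> and \<open>\<sigma> = s\<^sup>1\<^sup>/\<^sup>\<alpha>\<close>, is \<open>O(\<sigma>\<^sup>-\<^sup>d\<^sup>/\<^sup>2)\<close>: its square is an integral
  over the difference of two copies of the variable, and \<open>\<eta> \<mapsto> |\<eta>|\<^sup>b\<^sup>-\<^sup>2 \<eta>\<close> is expanding on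
  annuli, so that one can integrate by parts for every nonzero difference.
\<close>

section \<open>Integration over Euclidean space\<close>

text \<open>The obstacle is uniformity in the dual variable \<open>y\<close>: the stationary point
  of the phase depends on \<open>y\<close>, and a direct expansion would have to follow it while it
  crosses or leaves the annulus. In the squared integral \<open>y\<close> survives only as a
  unimodular factor, so a single family of phases, indexed by the difference \<open>h\<close>,
  serves all \<open>y\<close>. That family has to stay under control as \<open>h\<close> tends to 0,
  which is why the calculus of smooth functions carries a parameter and treats difference quotients.
  The Hessian of \<open>|\<eta>|^b\<close> has the radial eigenvalue
  \<open>b (b - 1) |\<eta>|^(b - 2)\<close>; nondegeneracy fails exactly at \<open>b = 1\<close>,
  that is, at \<alpha> = \<beta>. A distribution is here a bare functional without topology, so the
  passage from the localised distribution to a kernel cannot be made by density. It rests on Fourier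
  inversion as a pointwise identity between absolutely convergent integrals, and the same inversion
  in dimension one yields the Laplace inversion formula.\<close>

lemma
  fixes f :: "'a::euclidean_space \<Rightarrow> 'b::{banach, second_countable_topology}"
  assumes [measurable]: "f \<in> borel_measurable borel" and "c \<noteq> 0"
  shows integrable_lborel_affine: "integrable lborel (\<lambda>x. f (t + c *\<^sub>R x)) \<longleftrightarrow> integrable lborel f"
    and integral_lborel_affine:
      "integral\<^sup>L lborel f = \<bar>c\<bar> ^ DIM('a) *\<^sub>R (LINT x|lborel. f (t + c *\<^sub>R x))"
proof -
  have "integrable lborel f \<longleftrightarrow>
      integrable (density (distr lborel borel (\<lambda>x. t + c *\<^sub>R x)) (\<lambda>_. \<bar>c\<bar> ^ DIM('a))) f"
    using lborel_affine[OF \<open>c \<noteq> 0\<close>, of t] by simp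
  also have "\<dots> \<longleftrightarrow> integrable lborel (\<lambda>x. f (t + c *\<^sub>R x))"
    using \<open>c \<noteq> 0\<close> integrable_scaleR_right[of "inverse (\<bar>c\<bar> ^ DIM('a))" lborel
        "\<lambda>x. \<bar>c\<bar> ^ DIM('a) *\<^sub>R f (t + c *\<^sub>R x)"]
    by (auto simp: integrable_density integrable_distr_eq)
  finally show "integrable lborel (\<lambda>x. f (t + c *\<^sub>R x)) \<longleftrightarrow> integrable lborel f" by simp
  have "integral\<^sup>L lborel f =
      integral\<^sup>L (density (distr lborel borel (\<lambda>x. t + c *\<^sub>R x)) (\<lambda>_. \<bar>c\<bar> ^ DIM('a))) f"
    using lborel_affine[OF \<open>c \<noteq> 0\<close>, of t] by simp
  also have "\<dots> = \<bar>c\<bar> ^ DIM('a) *\<^sub>R (LINT x|lborel. f (t + c *\<^sub>R x))"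
    by (simp add: integral_density integral_distr)
  finally show "integral\<^sup>L lborel f = \<bar>c\<bar> ^ DIM('a) *\<^sub>R (LINT x|lborel. f (t + c *\<^sub>R x))" .
qed

text \<open>Lebesgue measure is the image of the product measure indexed by \<open>Basis\<close>
  under the coordinate map, so both claims are Fubini for finite products.\<close>

lemma
  fixes f :: "'a::euclidean_space \<Rightarrow> real \<Rightarrow> 'b::{real_normed_field, banach, second_countable_topology}"
  assumes "\<And>b. b \<in> Basis \<Longrightarrow> integrable lborel (f b)"
  shows integrable_lborel_prod: "integrable lborel (\<lambda>x. \<Prod>b\<in>Basis. f b (x \<bullet> b))"
    and integral_lborel_prod:
      "(LINT x|lborel. (\<Prod>b\<in>Basis. f b (x \<bullet> b))) = (\<Prod>b\<in>Basis. integral\<^sup>L lborel (f b))"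
proof -
  interpret product_sigma_finite "\<lambda>_::'a. lborel :: real measure" by standard
  have [measurable]: "f b \<in> borel_measurable borel" if "b \<in> Basis" for b
    using assms[OF that] by auto
  have [simp]: "(\<Sum>b'\<in>Basis. g b' *\<^sub>R b') \<bullet> b = g b" if "b \<in> Basis" for g and b :: 'a
    using that by (simp add: inner_sum_left inner_Basis if_distrib cong: if_cong)
  have m: "(\<lambda>x. \<Prod>b\<in>Basis. f b (x \<bullet> b)) \<in> borel_measurable borel" by measurable
  have m2: "(\<lambda>g. \<Sum>b\<in>Basis. g b *\<^sub>R b) \<in> (\<Pi>\<^sub>M b\<in>Basis. lborel) \<rightarrow>\<^sub>M (borel::'a measure)"
    by measurable
  have eq: "(\<lambda>g. \<Prod>b\<in>Basis. f b ((\<Sum>b'\<in>Basis. g b' *\<^sub>R b') \<bullet> b)) = (\<lambda>g. \<Prod>b\<in>Basis. f b (g b))"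
    by (intro ext prod.cong) simp_all
  show "integrable lborel (\<lambda>x. \<Prod>b\<in>Basis. f b (x \<bullet> b))"
    by (subst lborel_eq, unfold integrable_distr_eq[OF m2 m] eq, rule product_integrable_prod)
       (use assms in auto)
  show "(LINT x|lborel. (\<Prod>b\<in>Basis. f b (x \<bullet> b))) = (\<Prod>b\<in>Basis. integral\<^sup>L lborel (f b))"
    by (subst (1) lborel_eq, unfold integral_distr[OF m2 m] eq, rule product_integral_prod)
       (use assms in auto)
qed

section \<open>Explicit integrals on the line and an integrable product weight\<close>

lemma has_bochner_integral_half_lines:
  fixes g :: "real \<Rightarrow> 'b::{banach, second_countable_topology}"
  assumes "has_bochner_integral lborel (\<lambda>t. indicator {0..} t *\<^sub>R g t) I"
    and "has_bochner_integral lborel (\<lambda>t. indicator {0..} t *\<^sub>R g (- t)) J"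
    and [measurable]: "g \<in> borel_measurable borel"
  shows "has_bochner_integral lborel g (I + J)"
proof -
  have "has_bochner_integral lborel (\<lambda>t. indicator {0..} (-t) *\<^sub>R g t) J"
    using lborel_has_bochner_integral_real_affine_iff[of "-1" "\<lambda>t. indicator {0..} t *\<^sub>R g (- t)" J 0]
      assms(2) by simp
  from has_bochner_integral_add[OF assms(1) this]
  show ?thesis
  proof (rule has_bochner_integral_cong_AE[THEN iffD1, rotated -1])
    \<comment> \<open>Both closed half lines contain 0, where the sum counts \<open>g\<close> twice;
      a single point is a null set.\<close>
    show "AE x in lborel. indicat_real {0..} x *\<^sub>R g x + indicat_real {0..} (- x) *\<^sub>R g x = g x"
      using AE_lborel_singleton[of 0] by eventually_elim (auto simp: indicator_def)
  qed auto
qed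

lemma has_bochner_integral_exp_half_line:
  fixes s :: complex
  assumes "Re s > 0"
  shows "has_bochner_integral lborel (\<lambda>t. indicator {0..} t *\<^sub>R exp (- s * of_real t)) (1 / s)"
proof -
  have s: "s \<noteq> 0" using assms by auto
  have "((\<lambda>x. - exp (- Re s * x) / Re s) \<longlongrightarrow> - 0 / Re s) at_top"
    using assms by real_asymp
  then have e: "(\<integral>\<^sup>+x. ennreal (exp (- Re s * x)) * indicator {0..} x \<partial>lborel)
      = ennreal (0 - (- exp (- Re s * 0) / Re s))"
    using assms by (intro nn_integral_FTC_atLeast) (auto intro!: derivative_eq_intros)
  have dom: "integrable lborel (\<lambda>t. indicator {0..} t *\<^sub>R exp (- Re s * t))"
  proof (rule integrableI_nonneg)
    have "(\<integral>\<^sup>+ t. ennreal (indicat_real {0..} t *\<^sub>R exp (- Re s * t)) \<partial>lborel)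
      = (\<integral>\<^sup>+x. ennreal (exp (- Re s * x)) * indicator {0..} x \<partial>lborel)"
      by (intro nn_integral_cong) (auto simp: indicator_def)
    then show "(\<integral>\<^sup>+ t. ennreal (indicat_real {0..} t *\<^sub>R exp (- Re s * t)) \<partial>lborel) < \<infinity>"
      using e by simp
  qed auto
  have int: "integrable lborel (\<lambda>t. indicator {0..} t *\<^sub>R exp (- s * of_real t))"
    by (rule Bochner_Integration.integrable_bound[OF dom]) (auto simp: indicator_def)
  \<comment> \<open>The antiderivative evaluates the complex integral only on bounded intervals. The
    modulus, integrated above by the fundamental theorem for nonnegative functions, is the majorant
    for the limit.\<close>
  have lim1: "(\<lambda>n. LINT t|lborel. indicator {0..real n} t *\<^sub>R exp (- s * of_real t)) \<longlonglongrightarrow>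
      (LINT t|lborel. indicator {0..} t *\<^sub>R exp (- s * of_real t))"
  proof (rule integral_dominated_convergence[OF _ _ dom])
    show "AE t in lborel. (\<lambda>n. indicat_real {0..real n} t *\<^sub>R exp (- s * of_real t))
      \<longlonglongrightarrow> indicat_real {0..} t *\<^sub>R exp (- s * of_real t)"
    proof (rule AE_I2)
      fix t :: real
      have "eventually (\<lambda>n. real n \<ge> t) sequentially" by real_asymp
      then show "(\<lambda>n. indicat_real {0..real n} t *\<^sub>R exp (- s * of_real t))
          \<longlonglongrightarrow> indicat_real {0..} t *\<^sub>R exp (- s * of_real t)"
        by (intro tendsto_eventually) (auto elim!: eventually_mono simp: indicator_def)
    qed
  qed (auto simp: indicator_def)
  have FTC: "(LINT t|lborel. indicator {0..real n} t *\<^sub>R exp (- s * of_real t))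
      = - exp (- s * of_real (real n)) / s - (- exp (- s * of_real 0) / s)" for n
  proof (rule integral_FTC_Icc)
    fix x :: real
    have "((\<lambda>z. - exp (- s * z) / s) has_field_derivative exp (- s * of_real x)) (at (of_real x))"
      using s by (auto intro!: derivative_eq_intros)
    then show "((\<lambda>t. - exp (- s * of_real t) / s) has_vector_derivative exp (- s * of_real x))
        (at x within {0..real n})"
      by (rule has_vector_derivative_real_field)
  qed (auto intro!: continuous_intros)
  have "(\<lambda>n. - exp (- s * of_real (real n)) / s - (- exp (- s * of_real 0) / s))
     \<longlonglongrightarrow> - 0 / s - (- exp (- s * of_real 0) / s)"
  proof (intro tendsto_divide tendsto_minus tendsto_const s tendsto_diff)
    show "(\<lambda>n. exp (- s * of_real (real n))) \<longlonglongrightarrow> 0"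
    proof (rule tendsto_norm_zero_cancel)
      show "(\<lambda>x. norm (exp (- s * of_real (real x)))) \<longlonglongrightarrow> 0"
        using assms by simp real_asymp
    qed
  qed
  from LIMSEQ_unique[OF lim1[unfolded FTC] this]
  have "(LINT t|lborel. indicator {0..} t *\<^sub>R exp (- s * of_real t)) = 1 / s"
    by simp
  then show ?thesis using int by (simp add: has_bochner_integral_iff)
qed

lemma has_bochner_integral_inverse_square:
  "has_bochner_integral lborel (\<lambda>x::real. 1 / (1 + x\<^sup>2)) pi"
proof -
  have e: "(\<integral>\<^sup>+x. ennreal (1 / (1 + x\<^sup>2)) * indicator {0..} x \<partial>lborel) = ennreal (pi / 2 - arctan 0)"
    by (intro nn_integral_FTC_atLeast)
       (auto intro!: derivative_eq_intros tendsto_arctan_at_top simp: add_nonneg_eq_0_iff field_simps)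
  have h: "has_bochner_integral lborel (\<lambda>x::real. indicator {0..} x *\<^sub>R (1 / (1 + x\<^sup>2))) (pi / 2)"
  proof (rule has_bochner_integral_nn_integral)
    have "(\<integral>\<^sup>+x. ennreal (indicator {0..} x *\<^sub>R (1 / (1 + x\<^sup>2))) \<partial>lborel) =
       (\<integral>\<^sup>+x. ennreal (1 / (1 + x\<^sup>2)) * indicator {0..} x \<partial>lborel)"
      by (intro nn_integral_cong) (auto simp: indicator_def)
    then show "(\<integral>\<^sup>+x. ennreal (indicator {0..} x *\<^sub>R (1 / (1 + x\<^sup>2))) \<partial>lborel) = ennreal (pi / 2)"
      using e by simp
  qed auto
  have "has_bochner_integral lborel (\<lambda>x::real. 1 / (1 + x\<^sup>2)) (pi / 2 + pi / 2)"
    by (rule has_bochner_integral_half_lines) (use h in simp_all)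
  then show ?thesis by simp
qed

text \<open>The half lines contribute \<open>1 / (\<epsilon> - i x)\<close> and
  \<open>1 / (\<epsilon> + i x)\<close>; their sum is \<open>2 pi\<close> times the Poisson kernel
  of width \<epsilon>.\<close>

lemma has_bochner_integral_exp_abs:
  fixes x \<epsilon> :: real
  assumes "\<epsilon> > 0"
  shows "has_bochner_integral lborel (\<lambda>t. exp (- of_real (\<epsilon> * \<bar>t\<bar>) + \<i> * of_real (x * t)))
     (complex_of_real (2 * \<epsilon> / (\<epsilon>\<^sup>2 + x\<^sup>2)))"
proof -
  let ?g = "\<lambda>t. exp (- of_real (\<epsilon> * \<bar>t\<bar>) + \<i> * complex_of_real (x * t))"
  define s where "s = Complex \<epsilon> (- x)"
  define s' where "s' = Complex \<epsilon> x"
  have 1: "indicator {0..} t *\<^sub>R exp (- s * of_real t) = indicator {0..} t *\<^sub>R ?g t"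
    "indicator {0..} t *\<^sub>R exp (- s' * of_real t) = indicator {0..} t *\<^sub>R ?g (- t)" for t
    by (auto simp: indicator_def s_def s'_def Complex_eq algebra_simps)
  have "1 / s + 1 / s' = complex_of_real (2 * \<epsilon> / (\<epsilon>\<^sup>2 + x\<^sup>2))"
    using assms
    by (auto simp: s_def s'_def complex_eq_iff Re_divide Im_divide power2_eq_square add_nonneg_eq_0_iff)
  moreover have "has_bochner_integral lborel ?g (1 / s + 1 / s')"
    using has_bochner_integral_exp_half_line[of s] has_bochner_integral_exp_half_line[of s'] assms
    unfolding 1 by (intro has_bochner_integral_half_lines) (auto simp: s_def s'_def)
  ultimately show ?thesis by simp
qed

text \<open>Up to the factor \<open>pi ^ DIM('a)\<close> a product of Poisson kernels of width 1. It
  has two roles: the approximate identity of Fourier inversion, and the integrable majorant wherever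
  polynomial decay is to be turned into integrability.\<close>

definition cauchy_weight :: "'a::euclidean_space \<Rightarrow> real" where
  "cauchy_weight x = (\<Prod>b\<in>Basis. 1 / (1 + (x \<bullet> b)\<^sup>2))"

lemma cauchy_weight_nonneg: "0 \<le> cauchy_weight x"
  by (auto simp: cauchy_weight_def intro!: prod_nonneg)

lemma has_bochner_integral_cauchy_weight:
  "has_bochner_integral lborel (cauchy_weight :: 'a::euclidean_space \<Rightarrow> real) (pi ^ DIM('a))"
  unfolding has_bochner_integral_iff cauchy_weight_def
  using integrable_lborel_prod[of "\<lambda>_::'a. \<lambda>x::real. 1 / (1 + x\<^sup>2)"]
    integral_lborel_prod[of "\<lambda>_::'a. \<lambda>x::real. 1 / (1 + x\<^sup>2)"] has_bochner_integral_inverse_square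
  by (simp add: has_bochner_integral_iff)

lemma borel_measurable_cauchy_weight [measurable]: "cauchy_weight \<in> borel_measurable borel"
  unfolding cauchy_weight_def by measurable

lemma cauchy_weight_ge:
  fixes x :: "'a::euclidean_space"
  shows "1 \<le> (1 + (norm x)\<^sup>2) ^ DIM('a) * cauchy_weight x"
proof -
  have "(\<Prod>b\<in>Basis. (1 + (x \<bullet> b)\<^sup>2)) \<le> (\<Prod>b\<in>(Basis::'a set). 1 + (norm x)\<^sup>2)"
  proof (intro prod_mono conjI add_left_mono)
    fix b :: 'a assume "b \<in> Basis"
    then have "\<bar>x \<bullet> b\<bar> \<le> norm x" by (rule Basis_le_norm)
    then show "(x \<bullet> b)\<^sup>2 \<le> (norm x)\<^sup>2" by (metis abs_norm_cancel abs_le_square_iff)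
  qed auto
  moreover have "(\<Prod>b\<in>Basis. (1 + (x \<bullet> b)\<^sup>2)) > 0"
    by (intro prod_pos) (auto simp: add_pos_nonneg)
  moreover have "cauchy_weight x = 1 / (\<Prod>b\<in>Basis. (1 + (x \<bullet> b)\<^sup>2))"
    by (simp add: cauchy_weight_def prod_dividef)
  ultimately show ?thesis by (simp add: field_simps)
qed

text \<open>The product weight decays no faster than \<open>|x|^(-2d)\<close>, the rate along the
  diagonal, so a bound on \<open>|x|^(2d) y\<close> suffices; hence the exponent
  \<open>2 * DIM('a)\<close> in all later decay estimates. The factor \<open>2 ^ DIM('a)\<close>
  comes from \<open>1 + |x|^2 \<le> 2 max 1 (|x|^2)\<close>.\<close>

lemma decay_le_cauchy_weight:
  fixes x :: "'a::euclidean_space" and y C :: real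
  assumes "y \<le> C" and "norm x ^ (2 * DIM('a)) * y \<le> C" and "0 \<le> C"
  shows "y \<le> 2 ^ DIM('a) * C * cauchy_weight x"
proof (cases "y \<le> 0")
  case True
  then show ?thesis using assms(3) cauchy_weight_nonneg[of x] by (meson dual_order.trans mult_nonneg_nonneg zero_le_numeral zero_le_power)
next
  case False
  have "(1 + (norm x)\<^sup>2) ^ DIM('a) \<le> (2 * max 1 ((norm x)\<^sup>2)) ^ DIM('a)"
    by (intro power_mono) auto
  also have "\<dots> = 2 ^ DIM('a) * (max 1 ((norm x)\<^sup>2)) ^ DIM('a)" by (simp add: power_mult_distrib)
  finally have "(1 + (norm x)\<^sup>2) ^ DIM('a) * y \<le> 2 ^ DIM('a) * ((max 1 ((norm x)\<^sup>2)) ^ DIM('a) * y)"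
    using False by (simp add: mult.assoc mult_right_mono)
  also have "(max 1 ((norm x)\<^sup>2)) ^ DIM('a) * y \<le> C"
    using assms by (simp add: max_def power_mult)
  finally have *: "(1 + (norm x)\<^sup>2) ^ DIM('a) * y \<le> 2 ^ DIM('a) * C" by simp
  have "y \<le> ((1 + (norm x)\<^sup>2) ^ DIM('a) * cauchy_weight x) * y"
    using cauchy_weight_ge[of x] False by (simp add: mult_le_cancel_right1)
  also have "\<dots> = ((1 + (norm x)\<^sup>2) ^ DIM('a) * y) * cauchy_weight x" by simp
  also have "\<dots> \<le> (2 ^ DIM('a) * C) * cauchy_weight x"
    using * cauchy_weight_nonneg by (rule mult_right_mono)
  finally show ?thesis .
qed

lemma integrable_lborel_pair_bound:
  fixes h :: "'a::euclidean_space \<times> 'b::euclidean_space \<Rightarrow> 'c::{banach, second_countable_topology}"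
  assumes "h \<in> borel_measurable (lborel \<Otimes>\<^sub>M lborel)"
    and "integrable lborel f" "integrable lborel g"
    and "\<And>x y. norm (h (x, y)) \<le> norm (f x :: complex) * norm (g y :: complex)"
  shows "integrable (lborel \<Otimes>\<^sub>M lborel) h"
proof (rule Bochner_Integration.integrable_bound)
  have [measurable]: "f \<in> borel_measurable borel" "g \<in> borel_measurable borel" using assms by auto
  show "integrable (lborel \<Otimes>\<^sub>M lborel) (\<lambda>(x, y). f x * g y)"
    using assms
    by (intro lborel_pair.Fubini_integrable) (auto simp: norm_mult)
  show "AE x in lborel \<Otimes>\<^sub>M lborel. norm (h x) \<le> norm (case x of (x, y) \<Rightarrow> f x * g y)"
    using assms(4) by (auto simp: norm_mult)
qed (use assms in auto)

lemma norm_exp_i_real [simp]: "norm (exp (\<i> * complex_of_real r)) = 1"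
  "norm (exp (- (\<i> * complex_of_real r))) = 1"
  by simp_all

section \<open>Fourier inversion\<close>

lemma borel_measurable_fourier:
  assumes [measurable]: "f \<in> borel_measurable borel"
  shows "fourier f \<in> borel_measurable borel"
  unfolding fourier_def by measurable

lemma borel_measurable_inv_fourier:
  assumes [measurable]: "f \<in> borel_measurable borel"
  shows "inv_fourier f \<in> borel_measurable borel"
  unfolding inv_fourier_def by measurable

lemma integrable_mult_exp_i_iff:
  assumes [measurable]: "g \<in> borel_measurable lborel"
  shows "integrable lborel (\<lambda>x. f x * exp (\<i> * complex_of_real (g x))) \<longleftrightarrow> integrable lborel (f :: 'a::euclidean_space \<Rightarrow> complex)"
proof
  assume f: "integrable lborel f"
  then have [measurable]: "f \<in> borel_measurable borel" by auto
  from f show "integrable lborel (\<lambda>x. f x * exp (\<i> * complex_of_real (g x)))"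
    by (rule Bochner_Integration.integrable_bound) (auto simp: norm_mult)
next
  assume f: "integrable lborel (\<lambda>x. f x * exp (\<i> * complex_of_real (g x)))"
  have eq: "f = (\<lambda>x. f x * exp (\<i> * complex_of_real (g x)) * exp (- (\<i> * complex_of_real (g x))))"
    by (simp add: exp_minus field_simps)
  have [measurable]: "(\<lambda>x. f x * exp (\<i> * complex_of_real (g x))) \<in> borel_measurable borel"
    using f by auto
  have "integrable lborel (\<lambda>x. f x * exp (\<i> * complex_of_real (g x)) * exp (- (\<i> * complex_of_real (g x))))"
    by (rule Bochner_Integration.integrable_bound[OF f]) (auto simp: norm_mult)
  then show "integrable lborel f" using eq by simp
qed

lemma integrable_mult_exp_i:
  assumes "integrable lborel (f :: 'a::euclidean_space \<Rightarrow> complex)" "g \<in> borel_measurable lborel"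
  shows "integrable lborel (\<lambda>x. f x * exp (\<i> * complex_of_real (g x)))"
    "integrable lborel (\<lambda>x. f x * exp (- \<i> * complex_of_real (g x)))"
  using assms integrable_mult_exp_i_iff[of g f] integrable_mult_exp_i_iff[of "\<lambda>x. - g x" f] by auto

lemma has_bochner_integral_exp_l1:
  fixes x :: "'a::euclidean_space"
  assumes "\<epsilon> > 0"
  shows "has_bochner_integral lborel
    (\<lambda>\<xi>. complex_of_real (exp (- \<epsilon> * (\<Sum>b\<in>Basis. \<bar>\<xi> \<bullet> b\<bar>))) * exp (\<i> * complex_of_real (x \<bullet> \<xi>)))
    (of_real (\<Prod>b\<in>Basis. 2 * \<epsilon> / (\<epsilon>\<^sup>2 + (x \<bullet> b)\<^sup>2)))"
proof -
  define f :: "'a \<Rightarrow> real \<Rightarrow> complex" where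
    "f b t = exp (- of_real (\<epsilon> * \<bar>t\<bar>) + \<i> * of_real ((x \<bullet> b) * t))" for b t
  have f: "has_bochner_integral lborel (f b) (of_real (2 * \<epsilon> / (\<epsilon>\<^sup>2 + (x \<bullet> b)\<^sup>2)))" for b
    unfolding f_def using has_bochner_integral_exp_abs[OF assms] .
  have "(\<Prod>b\<in>Basis. f b (\<xi> \<bullet> b)) =
      of_real (exp (- \<epsilon> * (\<Sum>b\<in>Basis. \<bar>\<xi> \<bullet> b\<bar>))) * exp (\<i> * complex_of_real (x \<bullet> \<xi>))" for \<xi>
    unfolding f_def exp_sum[OF finite_Basis, symmetric] sum.distrib
    by (simp add: euclidean_inner[of x \<xi>] sum_distrib_left sum_negf mult_exp_exp exp_of_real[symmetric] del: exp_of_real)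
  moreover have "has_bochner_integral lborel (\<lambda>\<xi>. \<Prod>b\<in>Basis. f b (\<xi> \<bullet> b))
      (\<Prod>b\<in>Basis. of_real (2 * \<epsilon> / (\<epsilon>\<^sup>2 + (x \<bullet> b)\<^sup>2)))"
    using integrable_lborel_prod[of f] integral_lborel_prod[of f] f
    by (simp add: has_bochner_integral_iff)
  ultimately show ?thesis by simp
qed

text \<open>Abel summation with the factor \<open>exp (- \<epsilon> |\<xi>|\<^sub>1)\<close>, whose transform is a product of
  one-dimensional Poisson kernels, that is, a rescaled \<^const>\<open>cauchy_weight\<close>.\<close>

lemma fourier_inversion:
  fixes f :: "'a::euclidean_space \<Rightarrow> complex"
  assumes f: "integrable lborel f" and cont: "continuous_on UNIV f"
    and bdd: "\<And>x. norm (f x) \<le> B" and F: "integrable lborel (fourier f)"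
  shows "inv_fourier (fourier f) x = f x"
proof -
  have [measurable]: "f \<in> borel_measurable borel" using f by auto
  have [measurable]: "fourier f \<in> borel_measurable borel" using F by auto
  define E where "E \<epsilon> \<xi> = complex_of_real (exp (- \<epsilon> * (\<Sum>b\<in>Basis. \<bar>(\<xi>::'a) \<bullet> b\<bar>)))" for \<epsilon> \<xi>
  have [measurable]: "E \<epsilon> \<in> borel_measurable borel" for \<epsilon> unfolding E_def by measurable
  have E1: "norm (E \<epsilon> \<xi>) \<le> 1" if "\<epsilon> > 0" for \<epsilon> \<xi>
    using that by (auto simp: E_def sum_nonneg)
  define \<epsilon> where "\<epsilon> n = 1 / real (Suc n)" for n
  have \<epsilon>: "\<epsilon> n > 0" for n by (auto simp: \<epsilon>_def)
  have \<epsilon>0: "\<epsilon> \<longlonglongrightarrow> 0" unfolding \<epsilon>_def by real_asymp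
  \<comment> \<open>Fubini turns the damped inversion integral into an integral of \<open>f\<close>
    against Poisson kernels of width \<open>e\<close> centred at \<open>x\<close>. The substitution
    \<open>y = x + e u\<close> replaces them by the fixed weight, and \<open>(2 / e) ^ d\<close>
    times the Jacobian \<open>e ^ d\<close> leaves \<open>2 ^ d\<close>.\<close>
  have key: "(LINT \<xi>|lborel. fourier f \<xi> * exp (\<i> * of_real (x \<bullet> \<xi>)) * E e \<xi>) =
      of_real (2 ^ DIM('a)) * (LINT u|lborel. f (x + e *\<^sub>R u) * of_real (cauchy_weight u))" if "e > 0" for e
  proof -
    let ?h = "\<lambda>\<xi> y. f y * exp (- \<i> * of_real (y \<bullet> \<xi>)) * exp (\<i> * of_real (x \<bullet> \<xi>)) * E e \<xi>"
    have Eint: "integrable lborel (E e)"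
      using has_bochner_integral_exp_l1[OF that, of "0::'a"]
      by (simp add: E_def[abs_def] has_bochner_integral_iff)
    have inner: "(LINT \<xi>|lborel. ?h \<xi> y) =
       f y * of_real (\<Prod>b\<in>Basis. 2 * e / (e\<^sup>2 + ((x - y) \<bullet> b)\<^sup>2))" for y
    proof -
      have "?h \<xi> y = f y * (E e \<xi> * exp (\<i> * of_real ((x - y) \<bullet> \<xi>)))" for \<xi>
        by (simp add: inner_diff_left right_diff_distrib exp_diff exp_minus field_simps)
      then have "(LINT \<xi>|lborel. ?h \<xi> y) =
          (LINT \<xi>|lborel. f y * (E e \<xi> * exp (\<i> * of_real ((x - y) \<bullet> \<xi>))))"
        by (rule Bochner_Integration.integral_cong[OF refl])
      also have "\<dots> = f y * (LINT \<xi>|lborel. E e \<xi> * exp (\<i> * of_real ((x - y) \<bullet> \<xi>)))"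
        by simp
      finally show ?thesis
        using has_bochner_integral_exp_l1[OF that, of "x - y"]
        unfolding E_def has_bochner_integral_iff by simp
    qed
    have scaled: "(\<Prod>b\<in>Basis. 2 * e / (e\<^sup>2 + ((x - (x + e *\<^sub>R u)) \<bullet> b)\<^sup>2)) =
        (2 / e) ^ DIM('a) * cauchy_weight u" for u
    proof -
      have "2 * e / (e\<^sup>2 + ((x - (x + e *\<^sub>R u)) \<bullet> b)\<^sup>2) = 2 / e * (1 / (1 + (u \<bullet> b)\<^sup>2))" for b
      proof -
        have "e\<^sup>2 + ((x - (x + e *\<^sub>R u)) \<bullet> b)\<^sup>2 = e * (e * (1 + (u \<bullet> b)\<^sup>2))"
          by (simp add: power2_eq_square algebra_simps)
        then show ?thesis using that by simp
      qed
      then show ?thesis unfolding cauchy_weight_def prod.distrib by (simp only: prod.distrib prod_constant)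
    qed
    have "(LINT \<xi>|lborel. fourier f \<xi> * exp (\<i> * of_real (x \<bullet> \<xi>)) * E e \<xi>)
        = (LINT \<xi>|lborel. (LINT y|lborel. ?h \<xi> y))"
      unfolding fourier_def by simp
    also have "\<dots> = (LINT y|lborel. (LINT \<xi>|lborel. ?h \<xi> y))"
    proof (rule lborel_pair.Fubini_integral[symmetric])
      show "integrable (lborel \<Otimes>\<^sub>M lborel) (\<lambda>(\<xi>, y). ?h \<xi> y)"
        by (rule integrable_lborel_pair_bound[OF _ Eint f]) (auto simp: norm_mult)
    qed
    also have "\<dots> = (LINT y|lborel. f y * of_real (\<Prod>b\<in>Basis. 2 * e / (e\<^sup>2 + ((x - y) \<bullet> b)\<^sup>2)))"
      unfolding inner ..
    also have "(LINT y|lborel. f y * of_real (\<Prod>b\<in>Basis. 2 * e / (e\<^sup>2 + ((x - y) \<bullet> b)\<^sup>2))) =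
        \<bar>e\<bar> ^ DIM('a) *\<^sub>R (LINT u|lborel. f (x + e *\<^sub>R u) *
           of_real (\<Prod>b\<in>Basis. 2 * e / (e\<^sup>2 + ((x - (x + e *\<^sub>R u)) \<bullet> b)\<^sup>2)))"
      by (rule integral_lborel_affine) (use that in auto)
    also have "\<dots> = \<bar>e\<bar> ^ DIM('a) *\<^sub>R (LINT u|lborel. f (x + e *\<^sub>R u) *
           of_real ((2 / e) ^ DIM('a) * cauchy_weight u))"
      unfolding scaled ..
    also have "\<dots> = of_real (2 ^ DIM('a)) * (LINT u|lborel. f (x + e *\<^sub>R u) * of_real (cauchy_weight u))"
    proof -
      have "(LINT u|lborel. f (x + e *\<^sub>R u) * of_real ((2 / e) ^ DIM('a) * cauchy_weight u)) =
        (LINT u|lborel. of_real ((2 / e) ^ DIM('a)) * (f (x + e *\<^sub>R u) * of_real (cauchy_weight u)))"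
        by (intro Bochner_Integration.integral_cong) auto
      then show ?thesis using that by (simp add: scaleR_conv_of_real power_divide)
    qed
    finally show ?thesis .
  qed
  have lim1: "(\<lambda>n. LINT \<xi>|lborel. fourier f \<xi> * exp (\<i> * of_real (x \<bullet> \<xi>)) * E (\<epsilon> n) \<xi>)
      \<longlonglongrightarrow> (LINT \<xi>|lborel. fourier f \<xi> * exp (\<i> * of_real (x \<bullet> \<xi>)))"
  proof (rule integral_dominated_convergence)
    show "integrable lborel (\<lambda>\<xi>. norm (fourier f \<xi>))" using F by simp
    have "(\<lambda>n. E (\<epsilon> n) \<xi>) \<longlonglongrightarrow> of_real (exp (- 0 * (\<Sum>b\<in>Basis. \<bar>\<xi> \<bullet> b\<bar>)))" for \<xi>
      unfolding E_def by (intro tendsto_intros \<epsilon>0)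
    from tendsto_mult[OF tendsto_const this]
    show "AE \<xi> in lborel. (\<lambda>n. fourier f \<xi> * exp (\<i> * of_real (x \<bullet> \<xi>)) * E (\<epsilon> n) \<xi>)
         \<longlonglongrightarrow> fourier f \<xi> * exp (\<i> * of_real (x \<bullet> \<xi>))"
      by auto
    show "AE \<xi> in lborel. norm (fourier f \<xi> * exp (\<i> * of_real (x \<bullet> \<xi>)) * E (\<epsilon> n) \<xi>)
        \<le> norm (fourier f \<xi>)" for n
      using E1[OF \<epsilon>] by (auto simp: norm_mult mult_left_le)
  qed measurable
  have lim2: "(\<lambda>n. LINT u|lborel. f (x + \<epsilon> n *\<^sub>R u) * of_real (cauchy_weight u))
      \<longlonglongrightarrow> (LINT u|lborel. f x * of_real (cauchy_weight (u::'a)))"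
  proof (rule integral_dominated_convergence)
    show "integrable lborel (\<lambda>u::'a. B * cauchy_weight u)"
      using has_bochner_integral_cauchy_weight by (auto simp: has_bochner_integral_iff)
    have "(\<lambda>n. f (x + \<epsilon> n *\<^sub>R u)) \<longlonglongrightarrow> f (x + 0 *\<^sub>R u)" for u
      by (rule continuous_on_tendsto_compose[OF cont]) (auto intro!: tendsto_eq_intros \<epsilon>0)
    from tendsto_mult[OF this tendsto_const]
    show "AE u in lborel. (\<lambda>n. f (x + \<epsilon> n *\<^sub>R u) * of_real (cauchy_weight u))
         \<longlonglongrightarrow> f x * of_real (cauchy_weight u)"
      by auto
    show "AE u in lborel. norm (f (x + \<epsilon> n *\<^sub>R u) * of_real (cauchy_weight u)) \<le> B * cauchy_weight u" for n
      by (auto simp: norm_mult abs_of_nonneg[OF cauchy_weight_nonneg]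
          intro!: mult_right_mono cauchy_weight_nonneg bdd)
  qed measurable
  \<comment> \<open>The mass \<open>pi ^ d\<close> of the weight and the factor \<open>2 ^ d\<close>
    of the rescaling combine to the normalisation \<open>(2 pi) ^ d\<close> of the inverse
    transform.\<close>
  have "(LINT u|lborel. f x * of_real (cauchy_weight (u::'a))) = f x * of_real (pi ^ DIM('a))"
    using has_bochner_integral_integral_eq[OF has_bochner_integral_cauchy_weight[where 'a='a]] by simp
  from tendsto_mult[OF tendsto_const lim2[unfolded this], of "of_real (2 ^ DIM('a))"]
  have "(\<lambda>n. LINT \<xi>|lborel. fourier f \<xi> * exp (\<i> * of_real (x \<bullet> \<xi>)) * E (\<epsilon> n) \<xi>)
      \<longlonglongrightarrow> of_real (2 ^ DIM('a)) * (f x * of_real (pi ^ DIM('a)))"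
    by (simp only: key[OF \<epsilon>])
  from LIMSEQ_unique[OF lim1 this]
  have "(LINT \<xi>|lborel. fourier f \<xi> * exp (\<i> * of_real (x \<bullet> \<xi>))) = f x * of_real ((2 * pi) ^ DIM('a))"
    by (simp add: power_mult_distrib)
  then show ?thesis by (simp add: inv_fourier_def)
qed

text \<open>The Fourier transform of \<open>h \<cdot> inv_fourier \<phi>\<close> is, up to a constant, the convolution of
  \<open>fourier h\<close> with \<open>\<phi>\<close>; hence no smoothness of \<open>\<phi>\<close> is needed to invert it.\<close>

lemma inv_fourier_fourier_mult:
  fixes h \<phi> :: "'a::euclidean_space \<Rightarrow> complex"
  assumes h: "integrable lborel h" and cont: "continuous_on UNIV h"
    and bdd: "\<And>x. norm (h x) \<le> B" and F: "integrable lborel (fourier h)"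
    and \<phi>: "integrable lborel \<phi>"
  shows "inv_fourier (fourier (\<lambda>x. h x * inv_fourier \<phi> x)) x = h x * inv_fourier \<phi> x"
proof -
  have [measurable]: "h \<in> borel_measurable borel" "\<phi> \<in> borel_measurable borel" using h \<phi> by auto
  have [measurable]: "fourier h \<in> borel_measurable borel" using F by auto
  define c where "c = complex_of_real ((2 * pi) ^ DIM('a))"
  have c: "c \<noteq> 0" by (simp add: c_def)
  have 1: "fourier (\<lambda>x. h x * inv_fourier \<phi> x) \<xi> = (LINT y|lborel. \<phi> y * fourier h (\<xi> - y)) / c" for \<xi>
  proof -
    let ?g = "\<lambda>x y. h x * (\<phi> y * exp (\<i> * of_real (x \<bullet> y))) * exp (- \<i> * of_real (x \<bullet> \<xi>))"
    have inner: "(LINT x|lborel. ?g x y) = \<phi> y * fourier h (\<xi> - y)" for y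
    proof -
      have "exp (\<i> * of_real (x \<bullet> y)) * exp (- \<i> * of_real (x \<bullet> \<xi>)) =
          exp (- \<i> * of_real (x \<bullet> (\<xi> - y)))" for x
        unfolding mult_exp_exp by (simp add: inner_diff_right right_diff_distrib)
      then have "?g x y = \<phi> y * (h x * exp (- \<i> * of_real (x \<bullet> (\<xi> - y))))" for x
        by (simp add: mult_ac)
      then have "(LINT x|lborel. ?g x y) =
          (LINT x|lborel. \<phi> y * (h x * exp (- \<i> * of_real (x \<bullet> (\<xi> - y)))))"
        by (rule Bochner_Integration.integral_cong[OF refl])
      then show ?thesis by (simp add: fourier_def)
    qed
    have "(LINT x|lborel. h x * (LINT y|lborel. \<phi> y * exp (\<i> * of_real (x \<bullet> y))) * exp (- \<i> * of_real (x \<bullet> \<xi>)))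
      = (LINT x|lborel. (LINT y|lborel. ?g x y))"
      by simp
    also have "\<dots> = (LINT y|lborel. (LINT x|lborel. ?g x y))"
    proof (rule lborel_pair.Fubini_integral[symmetric])
      show "integrable (lborel \<Otimes>\<^sub>M lborel) (\<lambda>(x, y). ?g x y)"
        by (rule integrable_lborel_pair_bound[OF _ h \<phi>]) (auto simp: norm_mult)
    qed
    also have "\<dots> = (LINT y|lborel. \<phi> y * fourier h (\<xi> - y))"
      unfolding inner ..
    finally show ?thesis
      apply (subst fourier_def)
      apply (unfold inv_fourier_def c_def)
      apply simp
      done
  qed
  let ?k = "\<lambda>\<xi> y. \<phi> y * fourier h (\<xi> - y) * exp (\<i> * of_real (x \<bullet> \<xi>))"
  have 2: "(LINT \<xi>|lborel. fourier h \<xi> * exp (\<i> * of_real (x \<bullet> \<xi>))) = h x * c"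
    using fourier_inversion[OF h cont bdd F, of x] by (simp add: inv_fourier_def c_def field_simps)
  have transl: "integrable lborel (\<lambda>\<xi>. fourier h (\<xi> - y))" for y
    using integrable_lborel_affine[of "fourier h" 1 "-y"] F by simp
  have normtransl: "(LINT \<xi>|lborel. norm (fourier h (\<xi> - y))) = (LINT \<xi>|lborel. norm (fourier h \<xi>))" for y
    using integral_lborel_affine[of "\<lambda>\<xi>. norm (fourier h \<xi>)" 1 "-y"] by simp
  \<comment> \<open>The shift of the frequency by \<open>y\<close> splits off
    \<open>exp (i x y)\<close> and leaves the inversion integral of \<open>h\<close> alone; the
    remaining integral over \<open>y\<close> rebuilds \<open>inv_fourier \<phi> x\<close>.\<close>
  have inner: "(LINT \<xi>|lborel. ?k \<xi> y) = \<phi> y * exp (\<i> * of_real (x \<bullet> y)) * (h x * c)" for y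
  proof -
    have "(LINT \<xi>|lborel. ?k \<xi> y) = (LINT \<xi>|lborel. ?k (y + \<xi>) y)"
      using integral_lborel_affine[of "\<lambda>\<xi>. ?k \<xi> y" 1 y] by simp
    also have "\<dots> = (LINT \<xi>|lborel. \<phi> y * exp (\<i> * of_real (x \<bullet> y)) * (fourier h \<xi> * exp (\<i> * of_real (x \<bullet> \<xi>))))"
      by (intro Bochner_Integration.integral_cong) (auto simp: inner_add_right ring_distribs exp_add)
    also have "\<dots> = \<phi> y * exp (\<i> * of_real (x \<bullet> y)) * (h x * c)"
      using 2 by simp
    finally show ?thesis .
  qed
  have "(LINT \<xi>|lborel. (LINT y|lborel. \<phi> y * fourier h (\<xi> - y)) * exp (\<i> * of_real (x \<bullet> \<xi>)))
      = (LINT \<xi>|lborel. (LINT y|lborel. ?k \<xi> y))"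
    by simp
  also have "\<dots> = (LINT y|lborel. (LINT \<xi>|lborel. ?k \<xi> y))"
  proof -
    have "integrable (lborel \<Otimes>\<^sub>M lborel) (\<lambda>(y, \<xi>). ?k \<xi> y)"
    proof (rule lborel_pair.Fubini_integrable)
      show "integrable lborel (\<lambda>y. LINT \<xi>|lborel. norm (case (y, \<xi>) of (y, \<xi>) \<Rightarrow> ?k \<xi> y))"
        using \<phi> by (simp add: norm_mult normtransl)
      show "AE y in lborel. integrable lborel (\<lambda>\<xi>. case (y, \<xi>) of (y, \<xi>) \<Rightarrow> ?k \<xi> y)"
        using transl by (auto intro!: integrable_mult_exp_i)
    qed measurable
    from lborel_pair.Fubini_integral[OF this] show ?thesis .
  qed
  also have "\<dots> = (LINT y|lborel. \<phi> y * exp (\<i> * of_real (x \<bullet> y)) * (h x * c))"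
    unfolding inner ..
  also have "(LINT y|lborel. \<phi> y * exp (\<i> * of_real (x \<bullet> y)) * (h x * c)) = inv_fourier \<phi> x * c * (h x * c)"
    using c by (simp add: inv_fourier_def c_def)
  finally show ?thesis
    using c unfolding inv_fourier_def[of "fourier _"] 1 c_def[symmetric] by (simp add: field_simps)
qed

section \<open>Families of smooth functions with uniform bounds\<close>

text \<open>\<open>symb I n F\<close>: each \<open>F i\<close>, \<open>i \<in> I\<close>, is \<open>n\<close> times differentiable, and its derivatives of order at
  most \<open>n\<close> are bounded on bounded sets, uniformly in \<open>i\<close>.\<close>

definition loc_bounded :: "'i set \<Rightarrow> ('i \<Rightarrow> 'a::real_normed_vector \<Rightarrow> 'b::real_normed_vector) \<Rightarrow> bool" where
  "loc_bounded I F \<longleftrightarrow> (\<forall>R. \<exists>C. \<forall>i\<in>I. \<forall>x. norm x \<le> R \<longrightarrow> norm (F i x) \<le> C)"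

abbreviation partial :: "'a \<Rightarrow> ('i \<Rightarrow> 'a \<Rightarrow> 'b) \<Rightarrow> 'i \<Rightarrow> 'a::euclidean_space \<Rightarrow> 'b::real_normed_vector" where
  "partial b F \<equiv> (\<lambda>i x. frechet_derivative (F i) (at x) b)"

primrec symb :: "'i set \<Rightarrow> nat \<Rightarrow> ('i \<Rightarrow> 'a::euclidean_space \<Rightarrow> 'b::real_normed_vector) \<Rightarrow> bool" where
  "symb I 0 F \<longleftrightarrow> loc_bounded I F \<and> (\<forall>i\<in>I. continuous_on UNIV (F i))"
| "symb I (Suc n) F \<longleftrightarrow> loc_bounded I F \<and> (\<forall>i\<in>I. \<forall>x. F i differentiable (at x)) \<and>
     (\<forall>b\<in>Basis. symb I n (partial b F))"

lemma symb_loc_bounded: "symb I n F \<Longrightarrow> loc_bounded I F"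
  by (cases n) auto

lemma loc_bounded_cong: "(\<And>i. i \<in> I \<Longrightarrow> F i = G i) \<Longrightarrow> loc_bounded I F = loc_bounded I G"
  by (simp add: loc_bounded_def)

lemma symb_cong: "(\<And>i. i \<in> I \<Longrightarrow> F i = G i) \<Longrightarrow> symb I n F = symb I n G"
proof (induction n arbitrary: F G)
  case 0
  then show ?case using loc_bounded_cong[of I F G] by simp
next
  case (Suc n)
  have "symb I n (partial b F) = symb I n (partial b G)" for b
    by (rule Suc.IH) (simp add: Suc.prems)
  then show ?case using loc_bounded_cong[of I F G] Suc.prems by simp
qed

lemma symb_SucD: "symb I (Suc n) F \<Longrightarrow> symb I n F"
proof (induction n arbitrary: F)
  case 0
  then show ?case
    by (auto intro!: continuous_at_imp_continuous_on differentiable_imp_continuous_within)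
next
  case (Suc n)
  then show ?case by (metis symb.simps(2))
qed

lemma symb_SucI:
  assumes "loc_bounded I F" "\<And>i x. i \<in> I \<Longrightarrow> (F i has_derivative F' i x) (at x)"
    "\<And>b. b \<in> Basis \<Longrightarrow> symb I n (\<lambda>i x. F' i x b)"
  shows "symb I (Suc n) F"
proof -
  have "F' i x = frechet_derivative (F i) (at x)" if "i \<in> I" for i x
    using frechet_derivative_at[OF assms(2)[OF that]] .
  then have "symb I n (partial b F) = symb I n (\<lambda>i x. F' i x b)" for b
    by (intro symb_cong) auto
  then show ?thesis using assms by (auto simp: differentiable_def)
qed

lemma symb_has_derivative:
  "symb I (Suc n) F \<Longrightarrow> i \<in> I \<Longrightarrow> (F i has_derivative frechet_derivative (F i) (at x)) (at x)"
  by (simp add: frechet_derivative_works[symmetric])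

lemma symb_continuous: "symb I n F \<Longrightarrow> i \<in> I \<Longrightarrow> continuous_on UNIV (F i)"
proof (induction n)
  case (Suc n)
  from Suc.IH[OF symb_SucD[OF Suc.prems(1)] Suc.prems(2)] show ?case .
qed simp

lemma loc_bounded_add:
  assumes "loc_bounded I F" "loc_bounded I G"
  shows "loc_bounded I (\<lambda>i x. F i x + G i x)"
  unfolding loc_bounded_def
proof
  fix R
  obtain C D where "\<forall>i\<in>I. \<forall>x. norm x \<le> R \<longrightarrow> norm (F i x) \<le> C"
    "\<forall>i\<in>I. \<forall>x. norm x \<le> R \<longrightarrow> norm (G i x) \<le> D"
    using assms unfolding loc_bounded_def by meson
  then show "\<exists>C. \<forall>i\<in>I. \<forall>x. norm x \<le> R \<longrightarrow> norm (F i x + G i x) \<le> C"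
    by (intro exI[of _ "C + D"]) (auto intro!: norm_triangle_mono)
qed

lemma loc_bounded_mult:
  fixes F G :: "'i \<Rightarrow> 'a::real_normed_vector \<Rightarrow> 'b::real_normed_algebra"
  assumes "loc_bounded I F" "loc_bounded I G"
  shows "loc_bounded I (\<lambda>i x. F i x * G i x)"
  unfolding loc_bounded_def
proof
  fix R
  obtain C D where *: "\<forall>i\<in>I. \<forall>x. norm x \<le> R \<longrightarrow> norm (F i x) \<le> C"
    "\<forall>i\<in>I. \<forall>x. norm x \<le> R \<longrightarrow> norm (G i x) \<le> D"
    using assms unfolding loc_bounded_def by meson
  have "norm (F i x * G i x) \<le> C * D" if "i \<in> I" "norm x \<le> R" for i x
  proof -
    have "norm (F i x) \<le> C" "norm (G i x) \<le> D" using * that by auto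
    then have "norm (F i x) * norm (G i x) \<le> C * D"
      by (intro mult_mono) (auto intro: order_trans[OF norm_ge_zero])
    then show ?thesis by (rule order_trans[OF norm_mult_ineq])
  qed
  then show "\<exists>C. \<forall>i\<in>I. \<forall>x. norm x \<le> R \<longrightarrow> norm (F i x * G i x) \<le> C" by auto
qed

lemma symb_const: "symb I n (\<lambda>i x. c)"
proof (induction n arbitrary: c)
  case (Suc n)
  show ?case
    by (rule symb_SucI[where F' = "\<lambda>i x h. 0"]) (auto simp: loc_bounded_def intro: Suc)
qed (auto simp: loc_bounded_def)

lemma symb_add:
  "symb I n F \<Longrightarrow> symb I n G \<Longrightarrow> symb I n (\<lambda>i x. F i x + G i x)"
proof (induction n arbitrary: F G)
  case (Suc n)
  show ?case
    by (rule symb_SucI)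
       (use Suc in \<open>auto intro!: loc_bounded_add derivative_eq_intros symb_has_derivative[OF Suc.prems(1)]
          symb_has_derivative[OF Suc.prems(2)]\<close>)
qed (auto intro: loc_bounded_add continuous_intros)

lemma symb_bounded_linear:
  fixes F :: "'i \<Rightarrow> 'a::euclidean_space \<Rightarrow> 'b::real_normed_vector"
    and L :: "'b \<Rightarrow> 'c::real_normed_vector"
  assumes "bounded_linear L"
  shows "symb I n F \<Longrightarrow> symb I n (\<lambda>i x. L (F i x))"
proof -
  interpret bounded_linear L by fact
  have lb: "loc_bounded I (\<lambda>i x. L (F i x))" if F: "loc_bounded I F" for F :: "'i \<Rightarrow> 'a \<Rightarrow> 'b"
    unfolding loc_bounded_def
  proof
    fix R
    obtain C where C: "\<forall>i\<in>I. \<forall>x. norm x \<le> R \<longrightarrow> norm (F i x) \<le> C"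
      using F unfolding loc_bounded_def by meson
    obtain B where B: "\<And>x. norm (L x) \<le> norm x * B" "B > 0" using pos_bounded by auto
    have "norm (L (F i x)) \<le> C * B" if "i \<in> I" "norm x \<le> R" for i x
      using C B that by (meson mult_right_mono order_less_imp_le order_trans)
    then show "\<exists>C. \<forall>i\<in>I. \<forall>x. norm x \<le> R \<longrightarrow> norm (L (F i x)) \<le> C" by blast
  qed
  show "symb I n F \<Longrightarrow> symb I n (\<lambda>i x. L (F i x))"
  proof (induction n arbitrary: F)
    case 0
    then show ?case by (auto intro!: lb continuous_on)
  next
    case (Suc n)
    show ?case
      by (rule symb_SucI[where F' = "\<lambda>i x h. L (frechet_derivative (F i) (at x) h)"])
         (use Suc in \<open>auto intro!: lb has_derivative symb_has_derivative[OF Suc.prems]\<close>)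
  qed
qed

lemma symb_of_real:
  "symb I n F \<Longrightarrow> symb I n (\<lambda>i x. of_real (F i x) :: 'b::real_normed_algebra_1)"
  by (rule symb_bounded_linear[OF bounded_linear_of_real])

lemma symb_mult:
  fixes F G :: "'i \<Rightarrow> 'a::euclidean_space \<Rightarrow> 'b::real_normed_algebra"
  shows "symb I n F \<Longrightarrow> symb I n G \<Longrightarrow> symb I n (\<lambda>i x. F i x * G i x)"
proof (induction n arbitrary: F G)
  case (Suc n)
  show ?case
    by (rule symb_SucI[where F' = "\<lambda>i x h. F i x * frechet_derivative (G i) (at x) h +
            frechet_derivative (F i) (at x) h * G i x"])
       (use Suc Suc.prems[THEN symb_SucD] in \<open>auto intro!: symb_add Suc.IH loc_bounded_mult
          has_derivative_mult symb_has_derivative[OF Suc.prems(1)]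
          symb_has_derivative[OF Suc.prems(2)]\<close>)
qed (auto intro: loc_bounded_mult continuous_intros)

lemma symb_diff:
  fixes F G :: "'i \<Rightarrow> 'a::euclidean_space \<Rightarrow> 'b::real_normed_vector"
  assumes "symb I n F" "symb I n G"
  shows "symb I n (\<lambda>i x. F i x - G i x)"
  using symb_add[OF assms(1) symb_bounded_linear[OF bounded_linear_minus[OF bounded_linear_ident] assms(2)]]
  by simp

lemma symb_sum:
  "(\<And>k. k \<in> A \<Longrightarrow> symb I n (F k)) \<Longrightarrow> symb I n (\<lambda>i x. \<Sum>k\<in>A. F k i x)"
  by (induction A rule: infinite_finite_induct) (auto intro: symb_const symb_add)

lemma symb_power2:
  fixes F :: "'i \<Rightarrow> 'a::euclidean_space \<Rightarrow> 'b::real_normed_field"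
  shows "symb I n F \<Longrightarrow> symb I n (\<lambda>i x. (F i x)\<^sup>2)"
  by (simp add: power2_eq_square symb_mult)

lemma symb_inner:
  fixes v :: "'i \<Rightarrow> 'a::euclidean_space"
  assumes "\<And>i. i \<in> I \<Longrightarrow> norm (v i) \<le> B"
  shows "symb I n (\<lambda>i x. x \<bullet> v i)"
proof -
  have lb: "loc_bounded I (\<lambda>i x. x \<bullet> v i)"
    unfolding loc_bounded_def
  proof
    fix R
    have "norm (x \<bullet> v i) \<le> R * B" if "i \<in> I" "norm x \<le> R" for i and x :: 'a
    proof -
      have "norm (x \<bullet> v i) \<le> norm x * norm (v i)" by (simp add: Cauchy_Schwarz_ineq2)
      also have "\<dots> \<le> R * B" using assms that by (intro mult_mono) (auto intro: order_trans[OF norm_ge_zero])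
      finally show ?thesis .
    qed
    then show "\<exists>C. \<forall>i\<in>I. \<forall>x::'a. norm x \<le> R \<longrightarrow> norm (x \<bullet> v i) \<le> C" by blast
  qed
  have lb2: "loc_bounded I (\<lambda>i (x::'a). b \<bullet> v i)" if "b \<in> Basis" for b
    unfolding loc_bounded_def
  proof (intro allI exI ballI impI)
    fix R i and x :: 'a assume "i \<in> I"
    then have "norm (v i) \<le> B" by (rule assms)
    moreover have "norm (b \<bullet> v i) \<le> norm b * norm (v i)" by (simp add: Cauchy_Schwarz_ineq2)
    ultimately show "norm (b \<bullet> v i) \<le> B" using that by simp
  qed
  have c: "symb I n (\<lambda>i (x::'a). b \<bullet> v i)" if "b \<in> Basis" for n b
  proof (cases n)
    case (Suc m)
    then show ?thesis
      by (auto intro!: symb_SucI[where F' = "\<lambda>i x h. 0"] lb2 that symb_const)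
  qed (auto intro!: lb2 that)
  show ?thesis
  proof (cases n)
    case (Suc m)
    show ?thesis unfolding Suc
      by (rule symb_SucI[where F' = "\<lambda>i x h. h \<bullet> v i"]) (auto intro!: lb c derivative_eq_intros)
  qed (auto intro!: lb continuous_intros)
qed

text \<open>Each differentiation lowers the exponent by one, so negative powers arise even from
  positive \<open>r\<close>. The lower bound \<open>c\<close>, uniform in \<open>i\<close> and
  \<open>x\<close>, keeps them bounded, and the induction runs over all exponents at once.\<close>

lemma symb_powr:
  fixes F :: "'i \<Rightarrow> 'a::euclidean_space \<Rightarrow> real"
  assumes "c > 0" and ge: "\<And>i x. i \<in> I \<Longrightarrow> c \<le> F i x"
  shows "symb I n F \<Longrightarrow> symb I n (\<lambda>i x. F i x powr r)"
proof -
  have pos: "F i x > 0" if "i \<in> I" for i x using ge[OF that, of x] \<open>c > 0\<close> by simp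
  have lb: "loc_bounded I (\<lambda>i x. F i x powr r)" if F: "loc_bounded I F" for r
    unfolding loc_bounded_def
  proof
    fix R
    obtain C where C: "\<forall>i\<in>I. \<forall>x. norm x \<le> R \<longrightarrow> norm (F i x) \<le> C"
      using F unfolding loc_bounded_def by meson
    have "norm (F i x powr r) \<le> C powr r + c powr r" if "i \<in> I" "norm x \<le> R" for i x
    proof (cases "r \<ge> 0")
      case True
      then have "F i x powr r \<le> C powr r"
        using C[rule_format, OF that] pos[OF that(1), of x] by (intro powr_mono2) auto
      then show ?thesis by (simp add: add_increasing2)
    next
      case False
      then have "F i x powr r \<le> c powr r"
        using ge[OF that(1), of x] \<open>c > 0\<close> by (intro powr_mono2') auto
      then show ?thesis by (simp add: add_increasing)
    qed
    then show "\<exists>C. \<forall>i\<in>I. \<forall>x. norm x \<le> R \<longrightarrow> norm (F i x powr r) \<le> C" by blast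
  qed
  show "symb I n F \<Longrightarrow> symb I n (\<lambda>i x. F i x powr r)"
  proof (induction n arbitrary: r)
    case 0
    then show ?case
      using pos by (auto intro!: lb continuous_on_powr continuous_on_const) (metis less_irrefl)
  next
    case (Suc n)
    show ?case
    proof (rule symb_SucI[where F' = "\<lambda>i x h. r * F i x powr (r - 1) * frechet_derivative (F i) (at x) h"])
      fix i x assume "i \<in> I"
      show "((\<lambda>x. F i x powr r) has_derivative
          (\<lambda>h. r * F i x powr (r - 1) * frechet_derivative (F i) (at x) h)) (at x)"
        by (rule derivative_eq_intros symb_has_derivative[OF Suc.prems \<open>i \<in> I\<close>] pos \<open>i \<in> I\<close> | simp)+
           (use pos[OF \<open>i \<in> I\<close>, of x] in \<open>auto simp: powr_diff field_simps\<close>)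
    next
      fix b :: 'a assume "b \<in> Basis"
      then show "symb I n (\<lambda>i x. r * F i x powr (r - 1) * frechet_derivative (F i) (at x) b)"
        using Suc by (intro symb_mult symb_const Suc.IH symb_SucD[OF Suc.prems]) auto
    qed (use Suc in \<open>auto intro!: lb\<close>)
  qed
qed

lemma symb_shift:
  fixes F :: "'i \<Rightarrow> 'a::euclidean_space \<Rightarrow> 'b::real_normed_vector"
  assumes "\<And>i. i \<in> I \<Longrightarrow> norm (s i) \<le> B"
  shows "symb I n F \<Longrightarrow> symb I n (\<lambda>i x. F i (x + s i))"
proof -
  have lb: "loc_bounded I (\<lambda>i x. F i (x + s i))" if F: "loc_bounded I F" for F :: "'i \<Rightarrow> 'a \<Rightarrow> 'b"
    unfolding loc_bounded_def
  proof
    fix R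
    obtain C where C: "\<forall>i\<in>I. \<forall>x. norm x \<le> R + B \<longrightarrow> norm (F i x) \<le> C"
      using F unfolding loc_bounded_def by meson
    have "norm (F i (x + s i)) \<le> C" if "i \<in> I" "norm x \<le> R" for i x
      using C assms[OF that(1)] that norm_triangle_mono by blast
    then show "\<exists>C. \<forall>i\<in>I. \<forall>x. norm x \<le> R \<longrightarrow> norm (F i (x + s i)) \<le> C" by blast
  qed
  show "symb I n F \<Longrightarrow> symb I n (\<lambda>i x. F i (x + s i))"
  proof (induction n arbitrary: F)
    case 0
    have "continuous_on UNIV (\<lambda>x. F i (x + s i))" if "i \<in> I" for i
      by (rule continuous_on_compose2[OF symb_continuous[OF 0 that]]) (auto intro: continuous_intros)
    with 0 show ?case by (auto intro!: lb)
  next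
    case (Suc n)
    show ?case
    proof (rule symb_SucI[where F' = "\<lambda>i x h. frechet_derivative (F i) (at (x + s i)) h"])
      fix i x assume "i \<in> I"
      have "((\<lambda>x. x + s i) has_derivative (\<lambda>h. h)) (at x)" by (auto intro!: derivative_eq_intros)
      from has_derivative_compose[OF this symb_has_derivative[OF Suc.prems \<open>i \<in> I\<close>]]
      show "((\<lambda>x. F i (x + s i)) has_derivative (\<lambda>h. frechet_derivative (F i) (at (x + s i)) h)) (at x)"
        by simp
    qed (use Suc in \<open>auto intro!: lb Suc.IH\<close>)
  qed
qed

lemma has_derivative_norm_bound:
  fixes f' :: "'a::euclidean_space \<Rightarrow> 'b::real_normed_vector"
  assumes "(f has_derivative f') F" "\<And>b. b \<in> Basis \<Longrightarrow> norm (f' b) \<le> C b"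
  shows "norm (f' h) \<le> (\<Sum>b\<in>Basis. C b) * norm h"
proof -
  interpret bounded_linear f' using assms(1) by (rule has_derivative_bounded_linear)
  have "f' h = (\<Sum>b\<in>Basis. (h \<bullet> b) *\<^sub>R f' b)"
    by (subst euclidean_representation[of h, symmetric]) (simp only: sum scale)
  also have "norm \<dots> \<le> (\<Sum>b\<in>Basis. norm h * C b)"
    using Basis_le_norm assms(2) by (intro sum_norm_le) (auto intro!: mult_mono)
  finally show ?thesis by (simp add: sum_distrib_left mult.commute)
qed

text \<open>Division by \<open>norm (s i)\<close> does no harm even for shifts tending to 0: the
  mean value inequality pays for it with one derivative, whence \<open>Suc n\<close> in the premise.
  Difference quotients commute with partial derivatives, which drives the induction.\<close>

lemma symb_difference_quotient:
  fixes F :: "'i \<Rightarrow> 'a::euclidean_space \<Rightarrow> 'b::real_normed_vector"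
  assumes "\<And>i. i \<in> I \<Longrightarrow> norm (s i) \<le> B"
  shows "symb I (Suc n) F \<Longrightarrow> symb I n (\<lambda>i x. (F i (x + s i) - F i x) /\<^sub>R norm (s i))"
proof -
  have lb: "loc_bounded I (\<lambda>i x. (F i (x + s i) - F i x) /\<^sub>R norm (s i))" if F: "symb I (Suc n) F"
    for n and F :: "'i \<Rightarrow> 'a \<Rightarrow> 'b"
    unfolding loc_bounded_def
  proof
    fix R
    have "\<forall>b\<in>Basis. \<exists>C. \<forall>i\<in>I. \<forall>x. norm x \<le> R + B \<longrightarrow> norm (partial b F i x) \<le> C"
    proof
      fix b :: 'a assume "b \<in> Basis"
      then have "loc_bounded I (partial b F)" using F by (auto intro: symb_loc_bounded)
      then show "\<exists>C. \<forall>i\<in>I. \<forall>x. norm x \<le> R + B \<longrightarrow> norm (partial b F i x) \<le> C"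
        unfolding loc_bounded_def by (rule spec)
    qed
    from bchoice[OF this] obtain C where
      C: "\<And>b i x. b \<in> Basis \<Longrightarrow> i \<in> I \<Longrightarrow> norm x \<le> R + B \<Longrightarrow> norm (partial b F i x) \<le> C b"
      by blast
    have "norm ((F i (x + s i) - F i x) /\<^sub>R norm (s i)) \<le> (\<Sum>b\<in>Basis. C b)" if i: "i \<in> I" and x: "norm x \<le> R" for i x
    proof (cases "s i = 0")
      case True
      have "0 \<le> B" using assms[OF i] norm_ge_zero order_trans by blast
      then have "0 \<le> C b" if "b \<in> Basis" for b
        using C[OF that i, of x] x norm_ge_zero order_trans by (smt (verit))
      then show ?thesis using True by (simp add: sum_nonneg)
    next
      case False
      have "norm (F i (x + s i) - F i x) \<le> (\<Sum>b\<in>Basis. C b) * norm (x + s i - x)"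
      proof (rule differentiable_bound)
        show "convex (cball (0::'a) (R + B))" by simp
        show "x + s i \<in> cball 0 (R + B)" using x assms[OF i] by (auto intro!: norm_triangle_mono)
        show "x \<in> cball 0 (R + B)" using x assms[OF i] norm_ge_zero[of "s i"] by (auto simp del: norm_ge_zero)
        fix y :: 'a assume y: "y \<in> cball 0 (R + B)"
        show "(F i has_derivative frechet_derivative (F i) (at y)) (at y within cball 0 (R + B))"
          using symb_has_derivative[OF F i] by (rule has_derivative_at_withinI)
        show "onorm (frechet_derivative (F i) (at y)) \<le> (\<Sum>b\<in>Basis. C b)"
          by (rule onorm_le, rule has_derivative_norm_bound[OF symb_has_derivative[OF F i]])
             (use C i y in auto)
      qed
      then show ?thesis using False by (simp add: divide_simps norm_inverse)
    qed
    then show "\<exists>C. \<forall>i\<in>I. \<forall>x. norm x \<le> R \<longrightarrow> norm ((F i (x + s i) - F i x) /\<^sub>R norm (s i)) \<le> C"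
      by blast
  qed
  show "symb I (Suc n) F \<Longrightarrow> symb I n (\<lambda>i x. (F i (x + s i) - F i x) /\<^sub>R norm (s i))"
  proof (induction n arbitrary: F)
    case 0
    have "continuous_on UNIV (\<lambda>x. (F i (x + s i) - F i x) /\<^sub>R norm (s i))" if "i \<in> I" for i
      by (intro continuous_on_scaleR continuous_on_const continuous_on_diff symb_continuous[OF 0 that]
          continuous_on_compose2[OF symb_continuous[OF 0 that], of UNIV "\<lambda>x. x + s i"])
         (auto intro: continuous_intros)
    with 0 show ?case unfolding symb.simps(1) by (blast intro: lb[OF 0])
  next
    case (Suc n)
    show ?case
    proof (rule symb_SucI[where F' = "\<lambda>i x h. (frechet_derivative (F i) (at (x + s i)) h -
        frechet_derivative (F i) (at x) h) /\<^sub>R norm (s i)"])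
      show "loc_bounded I (\<lambda>i x. (F i (x + s i) - F i x) /\<^sub>R norm (s i))"
        using Suc.prems by (rule lb)
      fix i x assume i: "i \<in> I"
      have "((\<lambda>x. x + s i) has_derivative (\<lambda>h. h)) (at x)" by (auto intro!: derivative_eq_intros)
      from has_derivative_compose[OF this symb_has_derivative[OF Suc.prems i]]
      have "((\<lambda>x. F i (x + s i)) has_derivative (\<lambda>h. frechet_derivative (F i) (at (x + s i)) h)) (at x)"
        by simp
      from has_derivative_scaleR_right[OF has_derivative_diff[OF this symb_has_derivative[OF Suc.prems i]]]
      show "((\<lambda>x. (F i (x + s i) - F i x) /\<^sub>R norm (s i)) has_derivative
           (\<lambda>h. (frechet_derivative (F i) (at (x + s i)) h - frechet_derivative (F i) (at x) h) /\<^sub>R norm (s i))) (at x)" .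
    next
      fix b :: 'a assume "b \<in> Basis"
      with Suc.prems show "symb I n (\<lambda>i x. (frechet_derivative (F i) (at (x + s i)) b -
          frechet_derivative (F i) (at x) b) /\<^sub>R norm (s i))"
        by (intro Suc.IH) (auto simp del: symb.simps simp: symb.simps(2)[of I "Suc n"])
    qed
  qed
qed

text \<open>A single function is a constant family, and continuity on compact balls supplies the
  bounds. The induction covers all lists of directions because each derivative prepends one
  more.\<close>

lemma smooth_symb:
  assumes "smooth f"
  shows "symb I n (\<lambda>_. f)"
proof -
  have "symb I n (\<lambda>_. partials bs f)" if "set bs \<subseteq> Basis" for bs
    using that
  proof (induction n arbitrary: bs)
    have lb: "loc_bounded I (\<lambda>_. partials bs f)" if "set bs \<subseteq> Basis" for bs
      unfolding loc_bounded_def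
    proof
      fix R
      have "continuous_on UNIV (partials bs f)"
        using assms that unfolding smooth_def
        by (auto intro!: continuous_at_imp_continuous_on differentiable_imp_continuous_within)
      then have "compact (partials bs f ` cball 0 R)"
        by (intro compact_continuous_image) (auto intro: continuous_on_subset)
      then obtain C where "\<forall>y\<in>partials bs f ` cball 0 R. norm y \<le> C"
        using compact_imp_bounded bounded_iff by blast
      then show "\<exists>C. \<forall>i\<in>I. \<forall>x. norm x \<le> R \<longrightarrow> norm (partials bs f x) \<le> C"
        by (intro exI[of _ C]) auto
    qed
    {
      case 0
      then show ?case
        using assms unfolding smooth_def
        by (auto intro!: lb continuous_at_imp_continuous_on differentiable_imp_continuous_within)
    next
      case (Suc n)
      have "symb I n (\<lambda>_ x. frechet_derivative (partials bs f) (at x) b)" if "b \<in> Basis" for b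
        using Suc.IH[of "b # bs"] Suc.prems that by simp
      then show ?case
        using Suc.prems assms unfolding smooth_def by (auto intro!: lb)
    }
  qed
  from this[of "[]"] show ?thesis by simp
qed

section \<open>Oscillatory integrals\<close>

lemma integrable_compact_support:
  fixes f :: "'a::euclidean_space \<Rightarrow> 'b::{banach, second_countable_topology}"
  assumes "continuous_on UNIV f" "\<And>x. norm x > R \<Longrightarrow> f x = 0"
  shows "integrable lborel f"
proof -
  have "integrable lborel (\<lambda>x. indicator (cball 0 R) x *\<^sub>R f x)"
    using assms(1) by (intro borel_integrable_compact) (auto intro: continuous_on_subset)
  moreover have "(\<lambda>x. indicator (cball 0 R) x *\<^sub>R f x) = f"
    using assms(2) by (force simp: indicator_def)
  ultimately show ?thesis by simp
qed

lemma integrable_indicator_cball: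
  "integrable lborel (\<lambda>x::'a::euclidean_space. C * indicator (cball 0 R) x :: real)"
  by (intro integrable_mult_right integrable_real_indicator) (auto intro: emeasure_lborel_cball_finite[unfolded infinity_ennreal_def])

lemma norm_integral_compact_support:
  fixes f :: "'a::euclidean_space \<Rightarrow> 'b::{banach, second_countable_topology}"
  assumes "\<And>x. norm x > R \<Longrightarrow> f x = 0" "\<And>x. norm x \<le> R \<Longrightarrow> norm (f x) \<le> C"
  shows "norm (integral\<^sup>L lborel f) \<le> C * measure lborel (cball 0 R :: 'a set)"
proof -
  have "norm (integral\<^sup>L lborel f) \<le> (LINT x|lborel. norm (f x))"
    by (rule integral_norm_bound)
  also have "\<dots> \<le> (LINT x|lborel. C * indicator (cball (0::'a) R) x)"
    using assms
    by (intro integral_mono' integrable_indicator_cball)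
       (auto simp: indicator_def not_le intro: order_trans[OF norm_ge_zero])
  finally show ?thesis by simp
qed

lemma has_derivative_eq_0_outside_closed:
  assumes "(f has_derivative f') (at x)" "closed K" "x \<notin> K" "\<And>y. y \<notin> K \<Longrightarrow> f y = 0"
  shows "f' h = 0"
proof -
  have "(f has_derivative (\<lambda>h. 0)) (at x)"
    by (rule has_derivative_transform_within_open[of "\<lambda>_. 0" _ _ _ "- K"]) (use assms in auto)
  then show ?thesis using has_derivative_unique[OF assms(1)] by simp
qed

text \<open>By translation invariance every difference quotient in direction \<open>b\<close>
  integrates to 0; dominated convergence carries this over to the derivative, without splitting the
  integral into coordinates.\<close>

lemma integral_directional_derivative_eq_0:
  fixes f :: "'a::euclidean_space \<Rightarrow> 'b::euclidean_space"
  assumes deriv: "\<And>x. (f has_derivative f' x) (at x)"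
    and cont: "continuous_on UNIV (\<lambda>x. f' x b)" and supp: "\<And>x. norm x > R \<Longrightarrow> f x = 0"
  shows "(LINT x|lborel. f' x b) = 0"
proof -
  have suppg: "f' x b = 0" if "norm x > R" for x
    by (rule has_derivative_eq_0_outside_closed[OF deriv, of "cball 0 R"]) (use supp that in auto)
  obtain B where B: "norm (f' x b) \<le> B" for x
  proof -
    have "bounded ((\<lambda>x. f' x b) ` cball 0 R)"
      by (intro compact_imp_bounded compact_continuous_image)
         (auto intro: continuous_on_subset[OF cont])
    then obtain B where B: "B > 0" "\<And>y. y \<in> (\<lambda>x. f' x b) ` cball 0 R \<Longrightarrow> norm y \<le> B"
      by (auto simp: bounded_pos)
    have "norm (f' x b) \<le> B" for x
      using B suppg[of x] by (cases "norm x \<le> R") auto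
    then show ?thesis by (rule that)
  qed
  have B0: "B \<ge> 0" using B[of 0] norm_ge_zero order_trans by blast
  have contf: "continuous_on UNIV f"
    by (intro continuous_at_imp_continuous_on ballI has_derivative_continuous[OF deriv])
  have [measurable]: "f \<in> borel_measurable borel" using contf by (rule borel_measurable_continuous_onI)
  have [measurable]: "(\<lambda>x. f' x b) \<in> borel_measurable borel"
    using cont by (rule borel_measurable_continuous_onI)
  have intf: "integrable lborel f" using contf supp by (rule integrable_compact_support)
  define e where "e n = 1 / real (Suc n)" for n
  have e: "e n > 0" "e n \<le> 1" for n by (auto simp: e_def)
  have e0: "e \<longlonglongrightarrow> 0" unfolding e_def by real_asymp
  define q where "q n x = (f (x + e n *\<^sub>R b) - f x) /\<^sub>R e n" for n x
  have [measurable]: "q n \<in> borel_measurable borel" for n unfolding q_def by measurable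
  have q0: "integral\<^sup>L lborel (q n) = 0" for n
  proof -
    have "integrable lborel (\<lambda>x. f (e n *\<^sub>R b + 1 *\<^sub>R x))"
      using intf by (subst integrable_lborel_affine) auto
    moreover have "integral\<^sup>L lborel f = (LINT x|lborel. f (e n *\<^sub>R b + 1 *\<^sub>R x))"
      using integral_lborel_affine[of f 1 "e n *\<^sub>R b"] by simp
    ultimately show ?thesis using intf unfolding q_def by (simp add: add.commute)
  qed
  \<comment> \<open>The bound \<open>B\<close> concerns the derivative in direction \<open>b\<close>
    only, so the mean value inequality is applied along the line through \<open>x\<close> rather
    than to \<open>f\<close> itself.\<close>
  have line: "((\<lambda>t. f (x + t *\<^sub>R b)) has_derivative (\<lambda>h. h *\<^sub>R f' (x + t *\<^sub>R b) b)) (at t within S)" for x t S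
  proof -
    interpret bounded_linear "f' (x + t *\<^sub>R b)" using deriv by (rule has_derivative_bounded_linear)
    have "((\<lambda>t. x + t *\<^sub>R b) has_derivative (\<lambda>h. h *\<^sub>R b)) (at t within S)"
      by (auto intro!: derivative_eq_intros)
    from has_derivative_compose[OF this deriv] show ?thesis by (simp add: scale)
  qed
  have qB: "norm (q n x) \<le> B" for n x
  proof -
    have "norm (f (x + e n *\<^sub>R b) - f (x + 0 *\<^sub>R b)) \<le> B * norm (e n - 0)"
      by (rule differentiable_bound[where S = UNIV and f = "\<lambda>t. f (x + t *\<^sub>R b)", OF _ line])
         (auto intro!: onorm_le mult_left_mono B simp: mult.commute[of B])
    then show ?thesis using e[of n] unfolding q_def norm_scaleR by (simp add: field_simps)
  qed
  have "(\<lambda>n. integral\<^sup>L lborel (q n)) \<longlonglongrightarrow> (LINT x|lborel. f' x b)"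
  proof (rule integral_dominated_convergence)
    show "integrable lborel (\<lambda>x::'a. B * indicator (cball 0 (R + norm b)) x)"
      by (rule integrable_indicator_cball)
    show "AE x in lborel. norm (q n x) \<le> B * indicator (cball 0 (R + norm b)) x" for n
    proof (rule AE_I2)
      fix x
      have "q n x = 0" if "norm x > R + norm b"
      proof -
        have "norm x \<le> norm (x + e n *\<^sub>R b) + norm (e n *\<^sub>R b)"
          by (metis add_diff_cancel_right' norm_triangle_ineq4)
        moreover have "norm (e n *\<^sub>R b) \<le> norm b" using e[of n] by (simp add: mult_left_le_one_le)
        moreover have "norm x > R" using that norm_ge_zero[of b] by linarith
        ultimately show ?thesis using that supp by (simp add: q_def)
      qed
      then show "norm (q n x) \<le> B * indicator (cball 0 (R + norm b)) x"
        using qB by (auto simp: indicator_def not_le)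
    qed
    show "AE x in lborel. (\<lambda>n. q n x) \<longlonglongrightarrow> f' x b"
    proof (rule AE_I2)
      fix x
      have "((\<lambda>t. (1 / norm (t - 0)) *\<^sub>R (f (x + t *\<^sub>R b) - (f (x + 0 *\<^sub>R b) + (t - 0) *\<^sub>R f' (x + 0 *\<^sub>R b) b))) \<longlongrightarrow> 0) (at 0)"
        using line[of x 0 UNIV] unfolding has_derivative_within by simp
      then have "(\<lambda>n. (1 / norm (e n - 0)) *\<^sub>R (f (x + e n *\<^sub>R b) - (f (x + 0 *\<^sub>R b) + (e n - 0) *\<^sub>R f' (x + 0 *\<^sub>R b) b))) \<longlonglongrightarrow> 0"
        by (rule filterlim_compose) (use e e0 in \<open>auto simp: filterlim_at less_imp_neq[THEN not_sym]\<close>)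
      moreover have "(1 / norm (e n - 0)) *\<^sub>R (f (x + e n *\<^sub>R b) - (f (x + 0 *\<^sub>R b) + (e n - 0) *\<^sub>R f' (x + 0 *\<^sub>R b) b)) = q n x - f' x b" for n
        using e[of n] by (simp add: q_def algebra_simps inverse_eq_divide)
      ultimately show "(\<lambda>n. q n x) \<longlonglongrightarrow> f' x b"
        using LIM_zero_cancel by fastforce
    qed
  qed measurable
  then show ?thesis using q0 by (simp add: LIMSEQ_const_iff)
qed

lemma integral_by_parts_compact_support:
  fixes f g :: "'a::euclidean_space \<Rightarrow> complex"
  assumes f: "\<And>x. (f has_derivative f' x) (at x)" "continuous_on UNIV (\<lambda>x. f' x b)"
    and g: "\<And>x. (g has_derivative g' x) (at x)" "continuous_on UNIV (\<lambda>x. g' x b)"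
    and supp: "\<And>x. norm x > R \<Longrightarrow> g x = 0"
  shows "(LINT x|lborel. f' x b * g x) = - (LINT x|lborel. f x * g' x b)"
proof -
  have cont: "continuous_on UNIV f" "continuous_on UNIV g"
    by (intro continuous_at_imp_continuous_on ballI has_derivative_continuous[OF f(1)]
        has_derivative_continuous[OF g(1)])+
  have supp': "g' x b = 0" if "norm x > R" for x
    by (rule has_derivative_eq_0_outside_closed[OF g(1), of "cball 0 R"]) (use supp that in auto)
  have "(LINT x|lborel. f x * g' x b + f' x b * g x) = 0"
    by (rule integral_directional_derivative_eq_0[where f = "\<lambda>x. f x * g x"
          and f' = "\<lambda>x h. f x * g' x h + f' x h * g x" and R = R])
       (use supp in \<open>auto intro!: has_derivative_mult f g continuous_intros cont\<close>)
  moreover have "integrable lborel (\<lambda>x. f x * g' x b)" "integrable lborel (\<lambda>x. f' x b * g x)"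
    by (rule integrable_compact_support[where R = R]; use supp supp' in \<open>auto intro!: continuous_intros f g cont\<close>)+
  ultimately show ?thesis by (simp add: eq_neg_iff_add_eq_0 add.commute)
qed

text \<open>Repeated integration by parts along the vector field \<open>w grad P\<close>. Each round
  gains a factor \<open>1 / s\<close> and replaces \<open>a\<close> by the divergence of
  \<open>a w grad P\<close>, which satisfies the same hypotheses. The factor \<open>w\<close> is a
  separate, globally smooth family that agrees with \<open>1 / |grad P|^2\<close> on
  \<open>K i\<close>, since that quotient may be singular elsewhere.\<close>

lemma nonstationary_phase:
  fixes P w :: "'i \<Rightarrow> 'a::euclidean_space \<Rightarrow> real" and a :: "'i \<Rightarrow> 'a \<Rightarrow> complex"
  assumes P: "\<And>n. symb I n P" and w: "\<And>n. symb I n w" and a: "\<And>n. symb I n a"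
    and K: "\<And>i. i \<in> I \<Longrightarrow> closed (K i)" "\<And>i. i \<in> I \<Longrightarrow> K i \<subseteq> cball 0 R"
    and supp: "\<And>i x. i \<in> I \<Longrightarrow> x \<notin> K i \<Longrightarrow> a i x = 0"
    and grad: "\<And>i x. i \<in> I \<Longrightarrow> x \<in> K i \<Longrightarrow> w i x * (\<Sum>b\<in>Basis. (partial b P i x)\<^sup>2) = 1"
  shows "\<exists>C. \<forall>i\<in>I. \<forall>s>0. s ^ M * norm (LINT x|lborel. exp (\<i> * of_real (s * P i x)) * a i x) \<le> C"
  using a supp
proof (induction M arbitrary: a)
  case 0
  from symb_loc_bounded[OF 0(1)] obtain C where
    C: "\<forall>i\<in>I. \<forall>x. norm x \<le> R \<longrightarrow> norm (a i x) \<le> C"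
    unfolding loc_bounded_def by meson
  have "norm (LINT x|lborel. exp (\<i> * of_real (s * P i x)) * a i x) \<le> C * measure lborel (cball 0 R :: 'a set)"
    if i: "i \<in> I" for i s
  proof (rule norm_integral_compact_support)
    fix x :: 'a assume "R < norm x"
    then show "exp (\<i> * of_real (s * P i x)) * a i x = 0"
      using 0(2)[OF i] K(2)[OF i] by force
  qed (use C i in \<open>auto simp: norm_mult\<close>)
  then show ?case by auto
next
  case (Suc M)
  define c where "c b i x = of_real (w i x * partial b P i x) * a i x" for b i x
  define a' where "a' i x = (\<Sum>b\<in>Basis. partial b (c b) i x)" for i x
  have pP: "symb I n (partial b P)" if "b \<in> Basis" for n b using P[of "Suc n"] that by simp
  have c: "symb I n (c b)" if "b \<in> Basis" for n b
    unfolding c_def using that by (intro symb_mult symb_of_real w pP Suc.prems)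
  have pc: "symb I n (partial b (c b))" if "b \<in> Basis" for n b using c[of b "Suc n"] that by simp
  have a': "symb I n a'" for n unfolding a'_def by (intro symb_sum pc)
  have cder: "(c b i has_derivative frechet_derivative (c b i) (at x)) (at x)" if "i \<in> I" "b \<in> Basis" for b i x
    using c[OF that(2), of 1] that(1) symb_has_derivative[of I 0] by simp
  have csupp: "c b i x = 0" if "i \<in> I" "x \<notin> K i" for b i x
    using Suc.prems(2)[OF that] by (simp add: c_def)
  have a'supp: "a' i x = 0" if "i \<in> I" "x \<notin> K i" for i x
    unfolding a'_def
    by (intro sum.neutral ballI has_derivative_eq_0_outside_closed[OF cder[OF that(1)] K(1)[OF that(1)] that(2)]
        csupp that(1))
  from Suc.IH[OF a' a'supp] obtain C where
    C: "\<And>i s. i \<in> I \<Longrightarrow> s > 0 \<Longrightarrow> s ^ M * norm (LINT x|lborel. exp (\<i> * of_real (s * P i x)) * a' i x) \<le> C"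
    by blast
  have "s ^ Suc M * norm (LINT x|lborel. exp (\<i> * of_real (s * P i x)) * a i x) \<le> C"
    if i: "i \<in> I" and s: "s > 0" for i s
  proof -
    let ?e = "\<lambda>x. exp (\<i> * complex_of_real (s * P i x))"
    let ?e' = "\<lambda>x h. ?e x * (\<i> * complex_of_real (s * frechet_derivative (P i) (at x) h))"
    have Pder: "(P i has_derivative frechet_derivative (P i) (at x)) (at x)" for x
      using symb_has_derivative[OF P i] .
    have eder: "(?e has_derivative ?e' x) (at x)" for x
    proof -
      have "((\<lambda>x. \<i> * complex_of_real (s * P i x)) has_derivative
          (\<lambda>h. \<i> * of_real (s * frechet_derivative (P i) (at x) h))) (at x)"
        by (intro has_derivative_mult_right has_derivative_of_real Pder)
      from has_derivative_compose[OF this DERIV_exp[unfolded has_field_derivative_def]]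
      show ?thesis by simp
    qed
    have contP: "continuous_on UNIV (P i)" using symb_continuous[OF P i] .
    have contpP: "continuous_on UNIV (\<lambda>x. partial b P i x)" if "b \<in> Basis" for b
      using symb_continuous[OF pP[OF that] i] .
    have e'cont: "continuous_on UNIV (\<lambda>x. ?e' x b)" if "b \<in> Basis" for b
      by (intro continuous_intros contP contpP that)
    have supp_c: "c b i x = 0" if "norm x > R" for b x
      using csupp[OF i] K(2)[OF i] that by force
    have parts: "(LINT x|lborel. ?e' x b * c b i x) = - (LINT x|lborel. ?e x * partial b (c b) i x)"
      if b: "b \<in> Basis" for b
      using eder e'cont[OF b] cder[OF i b] symb_continuous[OF pc[OF b] i] supp_c
      by (rule integral_by_parts_compact_support)
    have int1: "integrable lborel (\<lambda>x. ?e' x b * c b i x)" if b: "b \<in> Basis" for b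
      by (rule integrable_compact_support[where R = R])
         (use supp_c in \<open>auto intro!: continuous_intros contP contpP b symb_continuous[OF c[OF b] i]\<close>)
    have int2: "integrable lborel (\<lambda>x. ?e x * partial b (c b) i x)" if b: "b \<in> Basis" for b
    proof (rule integrable_compact_support[where R = R])
      fix x :: 'a assume "R < norm x"
      then have "partial b (c b) i x = 0"
        using has_derivative_eq_0_outside_closed[OF cder[OF i b], of "cball 0 R" x b] supp_c by auto
      then show "?e x * partial b (c b) i x = 0" by simp
    qed (intro continuous_intros contP symb_continuous[OF pc[OF b] i])
    \<comment> \<open>On \<open>K i\<close> this is the chain rule combined with
      \<open>w |grad P|^2 = 1\<close>; off \<open>K i\<close> both sides vanish together with
      \<open>a\<close>.\<close>
    have "\<i> * of_real s * (?e x * a i x) = (\<Sum>b\<in>Basis. ?e' x b * c b i x)" for x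
    proof (cases "x \<in> K i")
      case False
      then show ?thesis using Suc.prems(2)[OF i False] by (simp add: c_def)
    next
      case True
      have "(\<Sum>b\<in>Basis. ?e' x b * c b i x) =
          \<i> * of_real s * (?e x * a i x) * of_real (w i x * (\<Sum>b\<in>Basis. (partial b P i x)\<^sup>2))"
        unfolding c_def sum_distrib_left of_real_sum
        by (intro sum.cong) (auto simp: power2_eq_square)
      then show ?thesis using grad[OF i True] by simp
    qed
    then have "\<i> * of_real s * (LINT x|lborel. ?e x * a i x) = (LINT x|lborel. (\<Sum>b\<in>Basis. ?e' x b * c b i x))"
      by (simp flip: integral_mult_right_zero)
    also have "\<dots> = (\<Sum>b\<in>Basis. LINT x|lborel. ?e' x b * c b i x)"
      using int1 by (intro Bochner_Integration.integral_sum) auto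
    also have "\<dots> = - (\<Sum>b\<in>Basis. LINT x|lborel. ?e x * partial b (c b) i x)"
      unfolding sum_negf[symmetric] by (intro sum.cong refl parts)
    also have "\<dots> = - (LINT x|lborel. ?e x * a' i x)"
      unfolding a'_def sum_distrib_left using int2 by (subst Bochner_Integration.integral_sum) auto
    finally have "norm (\<i> * of_real s * (LINT x|lborel. ?e x * a i x)) = norm (LINT x|lborel. ?e x * a' i x)"
      by simp
    then have "s * norm (LINT x|lborel. ?e x * a i x) = norm (LINT x|lborel. ?e x * a' i x)"
      using s by (simp add: norm_mult)
    then have "s ^ Suc M * norm (LINT x|lborel. ?e x * a i x) = s ^ M * norm (LINT x|lborel. ?e x * a' i x)"
      by (simp only: power_Suc2 mult.assoc)
    then show ?thesis using C[OF i s] by (simp only:)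
  qed
  then show ?case by blast
qed

section \<open>Rapid decay of Fourier transforms of smooth functions with compact support\<close>

lemma symb_reindex:
  fixes F :: "'j \<Rightarrow> 'a::euclidean_space \<Rightarrow> 'b::real_normed_vector"
  shows "symb J n F \<Longrightarrow> g ` I \<subseteq> J \<Longrightarrow> symb I n (\<lambda>i. F (g i))"
proof (induction n arbitrary: F)
  have lb: "loc_bounded I (\<lambda>i. F (g i))" if "loc_bounded J F" "g ` I \<subseteq> J"
    for F :: "'j \<Rightarrow> 'a \<Rightarrow> 'b"
    using that unfolding loc_bounded_def by (meson image_subset_iff)
  {
    case 0
    then show ?case by (auto intro: lb)
  next
    case (Suc n)
    have "symb I n (\<lambda>i x. frechet_derivative (F (g i)) (at x) b)" if "b \<in> Basis" for b
      using Suc.IH[of "partial b F"] Suc.prems that by simp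
    with Suc.prems show ?case by (auto intro: lb)
  }
qed

text \<open>Nonstationary phase for linear phases: \<open>\<xi> = |\<xi>| v\<close> makes
  \<open>|\<xi>|\<close> the large parameter and the unit vector \<open>v\<close> the index. The
  gradient \<open>- v\<close> has length 1, so \<open>w = 1\<close> works.\<close>

lemma fourier_decay:
  fixes h :: "'a::euclidean_space \<Rightarrow> complex"
  assumes h: "\<And>n. symb (UNIV :: unit set) n (\<lambda>_. h)" and supp: "\<And>x. norm x > R \<Longrightarrow> h x = 0"
  shows "\<exists>C. \<forall>\<xi>. \<xi> \<noteq> 0 \<longrightarrow> norm \<xi> ^ M * norm (fourier h \<xi>) \<le> C"
proof -
  define I where "I = {v::'a. norm v = 1}"
  have "\<exists>C. \<forall>v\<in>I. \<forall>s>0. s ^ M * norm (LINT x|lborel. exp (\<i> * of_real (s * (x \<bullet> - v))) * h x) \<le> C"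
  proof (rule nonstationary_phase[where w = "\<lambda>_ _. 1" and K = "\<lambda>_. cball 0 R" and P = "\<lambda>v x. x \<bullet> - v" and a = "\<lambda>_. h"])
    show "symb I n (\<lambda>v x. x \<bullet> - v)" for n
      by (rule symb_inner[where B = 1]) (auto simp: I_def)
    show "symb I n (\<lambda>_. h)" for n using symb_reindex[OF h, of "\<lambda>_. ()" I] by simp
    fix v x :: 'a assume v: "v \<in> I"
    have "((\<lambda>x. x \<bullet> - v) has_derivative (\<lambda>k. k \<bullet> - v)) (at x)" by (auto intro!: derivative_eq_intros)
    from frechet_derivative_at[OF this]
    have "partial b (\<lambda>v x. x \<bullet> - v) v x = - (b \<bullet> v)" for b by (metis inner_minus_right)
    moreover have "(\<Sum>b\<in>Basis. (b \<bullet> v)\<^sup>2) = 1"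
      using v euclidean_inner[of v v] by (simp add: I_def power2_eq_square inner_commute dot_square_norm)
    ultimately show "1 * (\<Sum>b\<in>Basis. (partial b (\<lambda>v x. x \<bullet> - v) v x)\<^sup>2) = 1" by simp
  qed (use supp in \<open>auto intro: symb_const\<close>)
  then obtain C where C: "\<And>v s. v \<in> I \<Longrightarrow> s > 0 \<Longrightarrow>
      s ^ M * norm (LINT x|lborel. exp (\<i> * of_real (s * (x \<bullet> - v))) * h x) \<le> C" by blast
  have "norm \<xi> ^ M * norm (fourier h \<xi>) \<le> C" if "\<xi> \<noteq> 0" for \<xi>
  proof -
    have "norm \<xi> * (x \<bullet> - (\<xi> /\<^sub>R norm \<xi>)) = - (x \<bullet> \<xi>)" for x
      using that by simp
    with C[of "\<xi> /\<^sub>R norm \<xi>" "norm \<xi>"] that show ?thesis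
      unfolding fourier_def by (simp only:) (simp add: I_def mult.commute)
  qed
  then show ?thesis by blast
qed

lemma integrable_fourier:
  fixes h :: "'a::euclidean_space \<Rightarrow> complex"
  assumes h: "\<And>n. symb (UNIV :: unit set) n (\<lambda>_. h)" and supp: "\<And>x. norm x > R \<Longrightarrow> h x = 0"
  shows "integrable lborel (fourier h)"
proof -
  have cont: "continuous_on UNIV h" using symb_continuous[OF h] by simp
  then have [measurable]: "h \<in> borel_measurable borel" by (rule borel_measurable_continuous_onI)
  have int: "integrable lborel h" using cont supp by (rule integrable_compact_support)
  obtain C1 where C1: "\<And>\<xi>. \<xi> \<noteq> 0 \<Longrightarrow> norm \<xi> ^ (2 * DIM('a)) * norm (fourier h \<xi>) \<le> C1"
    using fourier_decay[OF assms] by blast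
  define C where "C = max C1 (LINT x|lborel. norm (h x))"
  have C0: "C \<ge> 0" by (simp add: C_def le_max_iff_disj)
  have bd: "norm (fourier h \<xi>) \<le> 2 ^ DIM('a) * C * cauchy_weight \<xi>" for \<xi>
  proof (rule decay_le_cauchy_weight[OF _ _ C0])
    have "norm (fourier h \<xi>) \<le> (LINT x|lborel. norm (h x * exp (- \<i> * of_real (x \<bullet> \<xi>))))"
      unfolding fourier_def by (rule integral_norm_bound)
    then show "norm (fourier h \<xi>) \<le> C" by (simp add: C_def norm_mult)
    show "norm \<xi> ^ (2 * DIM('a)) * norm (fourier h \<xi>) \<le> C"
      using C1[of \<xi>] C0 by (cases "\<xi> = 0") (auto simp: C_def power_0_left)
  qed
  show ?thesis
  proof (rule Bochner_Integration.integrable_bound)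
    show "integrable lborel (\<lambda>\<xi>. 2 ^ DIM('a) * C * cauchy_weight \<xi> :: real)"
      using has_bochner_integral_cauchy_weight by (auto simp: has_bochner_integral_iff)
    show "fourier h \<in> borel_measurable lborel" by (simp add: borel_measurable_fourier)
    show "AE x in lborel. norm (fourier h x) \<le> norm (2 ^ DIM('a) * C * cauchy_weight x)"
      using bd C0 by (auto simp: abs_mult abs_of_nonneg[OF cauchy_weight_nonneg])
  qed
qed

text \<open>The square of the integral is an integral over the difference \<open>h\<close> of two copies of the
  variable; for fixed \<open>h\<close> the phase \<open>\<phi> (\<eta> + h) - \<phi> \<eta>\<close> has no stationary point, and the parameter
  \<open>y\<close> drops out of its gradient.\<close>

lemma oscillatory_integral_bound:
  fixes \<phi> \<zeta> \<theta> :: "'a::euclidean_space \<Rightarrow> real"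
  assumes \<phi>: "\<And>n. symb (UNIV :: unit set) n (\<lambda>_. \<phi>)"
    and \<zeta>: "\<And>n. symb (UNIV :: unit set) n (\<lambda>_. \<zeta>)"
    and \<theta>: "\<And>n. symb (UNIV :: unit set) n (\<lambda>_. \<theta>)"
    and K: "closed K" "K \<subseteq> cball 0 R" "\<And>x. x \<notin> K \<Longrightarrow> \<zeta> x = 0" "\<And>x. x \<in> K \<Longrightarrow> \<theta> x = 1"
    and c: "c > 0"
    and grad: "\<And>x y. \<theta> x \<noteq> 0 \<Longrightarrow> \<theta> y \<noteq> 0 \<Longrightarrow> c * (norm (x - y))\<^sup>2 \<le>
      (\<Sum>b\<in>Basis. (frechet_derivative \<phi> (at x) b - frechet_derivative \<phi> (at y) b)\<^sup>2)"
  shows "\<exists>C\<ge>0. \<forall>s>0. \<forall>y. (norm (LINT \<eta>|lborel. exp (\<i> * of_real (y \<bullet> \<eta> - s * \<phi> \<eta>)) * of_real (\<zeta> \<eta>)))\<^sup>2 * s ^ DIM('a) \<le> C"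
proof -
  \<comment> \<open>For \<open>norm h > 2 * R\<close> the two copies of the support are disjoint and
    the integral over \<open>x\<close> vanishes. The remaining shifts are bounded, as the shift and
    difference quotient lemmas require.\<close>
  define I where "I = {h::'a. h \<noteq> 0 \<and> norm h \<le> 2 * R}"
  define P where "P h x = (\<phi> (x + h) - \<phi> x) /\<^sub>R norm h" for h x
  \<comment> \<open>The second summand makes \<open>g\<close> invertible everywhere. Where the
    product of cutoffs vanishes it equals 1; where the product is nonzero, the hypothesis on the
    gradient bounds the first summand below by \<open>c\<close>; where both \<open>x\<close> and
    \<open>x + h\<close> lie in \<open>K\<close> it vanishes, so that \<open>1 / g\<close> is the
    factor required by nonstationary phase.\<close>
  define g where "g h x = (\<Sum>b\<in>Basis. (partial b P h x)\<^sup>2) + (1 - \<theta> x * \<theta> (x + h))\<^sup>2" for h x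
  define w where "w h x = g h x powr (- 1)" for h x
  define a where "a h x = complex_of_real (\<zeta> x * \<zeta> (x + h))" for h x
  define J where "J s h = (LINT x|lborel. exp (\<i> * of_real (s * (\<phi> (x + h) - \<phi> x))) * a h x)" for s h
  have bound: "\<And>h. h \<in> I \<Longrightarrow> norm h \<le> 2 * R" by (simp add: I_def)
  have re: "symb I n (\<lambda>_. f)" if "symb (UNIV :: unit set) n (\<lambda>_. f)" for f :: "'a \<Rightarrow> real" and n
    using symb_reindex[OF that, of "\<lambda>_. ()" I] by simp
  have sh: "symb I n (\<lambda>h x. F h (x + h))" if "symb I n F" for n and F :: "'a \<Rightarrow> 'a \<Rightarrow> real"
    using symb_shift[where s = "\<lambda>h. h" and I = I and B = "2 * R", OF _ that] bound by simp
  have P: "symb I n P" for n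
    using symb_difference_quotient[where s = "\<lambda>h. h" and I = I and B = "2 * R", OF _ re[OF \<phi>[of "Suc n"]]] bound
    unfolding P_def[abs_def] by simp
  have pP: "symb I n (partial b P)" if "b \<in> Basis" for n b using P[of "Suc n"] that by simp
  have g: "symb I n g" for n
    unfolding g_def[abs_def] using sh[OF re[OF \<theta>]]
    by (intro symb_add symb_sum symb_power2 symb_diff symb_const symb_mult re[OF \<theta>] pP) auto
  have der: "(\<phi> has_derivative frechet_derivative \<phi> (at x)) (at x)" for x
    using symb_has_derivative[OF \<phi>[of "Suc 0"]] by simp
  have pPeq: "partial b P h x = (frechet_derivative \<phi> (at (x + h)) b - frechet_derivative \<phi> (at x) b) /\<^sub>R norm h" for b h x
  proof -
    have "((\<lambda>x. x + h) has_derivative (\<lambda>k. k)) (at x)" by (auto intro!: derivative_eq_intros)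
    from has_derivative_compose[OF this der]
    have "((\<lambda>x. \<phi> (x + h)) has_derivative (\<lambda>k. frechet_derivative \<phi> (at (x + h)) k)) (at x)" by simp
    from frechet_derivative_at[OF has_derivative_scaleR_right[OF has_derivative_diff[OF this der]], of "inverse (norm h)"]
    show ?thesis unfolding P_def by metis
  qed
  have ge: "min 1 c \<le> g h x" if "h \<in> I" for h x
  proof (cases "\<theta> x * \<theta> (x + h) = 0")
    case True
    have "0 \<le> (\<Sum>b\<in>Basis. (partial b P h x)\<^sup>2)" by (intro sum_nonneg) simp
    then have "1 \<le> g h x" unfolding g_def True by simp
    then show ?thesis by simp
  next
    case False
    have h: "norm h > 0" using that by (simp add: I_def)
    have "c * (norm (x + h - x))\<^sup>2 \<le>
      (\<Sum>b\<in>Basis. (frechet_derivative \<phi> (at (x + h)) b - frechet_derivative \<phi> (at x) b)\<^sup>2)"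
      using False by (intro grad) auto
    then have "c \<le> (\<Sum>b\<in>Basis. (frechet_derivative \<phi> (at (x + h)) b - frechet_derivative \<phi> (at x) b)\<^sup>2) / (norm h)\<^sup>2"
      using h by (simp add: pos_le_divide_eq)
    also have "\<dots> = (\<Sum>b\<in>Basis. (partial b P h x)\<^sup>2)"
      unfolding pPeq
      by (simp add: sum_distrib_left power_mult_distrib divide_inverse mult.commute power_inverse)
    also have "\<dots> \<le> g h x" by (simp add: g_def)
    finally show ?thesis by simp
  qed
  have w: "symb I n w" for n
    unfolding w_def by (rule symb_powr[OF _ ge g]) (use c in auto)
  have a: "symb I n a" for n
    unfolding a_def using sh[OF re[OF \<zeta>]] by (intro symb_of_real symb_mult re[OF \<zeta>])
  define KK where "KK h = K \<inter> (\<lambda>x. x + h) -` K" for h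
  have KK: "closed (KK h)" "KK h \<subseteq> cball 0 R" for h
    unfolding KK_def using K(1,2)
    by (auto intro!: closed_Int continuous_closed_vimage continuous_intros)
  have supp: "a h x = 0" if "x \<notin> KK h" for h x
    using that K(3) by (auto simp: a_def KK_def)
  have grad1: "w h x * (\<Sum>b\<in>Basis. (partial b P h x)\<^sup>2) = 1" if "h \<in> I" "x \<in> KK h" for h x
  proof -
    have "\<theta> x = 1" "\<theta> (x + h) = 1" using that K(4) by (auto simp: KK_def)
    then have "(\<Sum>b\<in>Basis. (partial b P h x)\<^sup>2) = g h x" by (simp add: g_def)
    moreover have "g h x > 0" using ge[OF that(1), of x] c by simp
    ultimately show ?thesis by (simp add: w_def powr_minus)
  qed
  obtain C1 where C1: "\<And>h s. h \<in> I \<Longrightarrow> s > 0 \<Longrightarrow>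
      s ^ (2 * DIM('a)) * norm (LINT x|lborel. exp (\<i> * of_real (s * P h x)) * a h x) \<le> C1"
    using nonstationary_phase[OF P w a KK supp grad1, of "\<lambda>h. h" "2 * DIM('a)"] by blast
  obtain Z where Z: "\<And>x. norm x \<le> R \<Longrightarrow> \<bar>\<zeta> x\<bar> \<le> Z"
    using symb_loc_bounded[OF \<zeta>] unfolding loc_bounded_def by fastforce
  have \<zeta>0: "\<zeta> x = 0" if "norm x > R" for x using K(2,3) that by force
  have Z': "\<bar>\<zeta> x\<bar> \<le> max Z 0" for x using Z[of x] \<zeta>0[of x] by (cases "norm x \<le> R") auto
  define C where "C = max C1 (max Z 0 * max Z 0 * measure lborel (cball 0 R :: 'a set))"
  have C0: "C \<ge> 0" by (simp add: C_def le_max_iff_disj)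
  \<comment> \<open>Since the phase is \<open>s * norm h\<close> times \<open>P h\<close>, the large
    parameter is \<open>s * norm h\<close>. A majorant depending on \<open>h\<close> only through
    \<open>s *\<^sub>R h\<close> has integral proportional to \<open>s^(-d)\<close>, the origin of
    the rate.\<close>
  have Jdecay: "norm (J s h) \<le> 2 ^ DIM('a) * C * cauchy_weight (s *\<^sub>R h)" if s: "s > 0" for s h
  proof (rule decay_le_cauchy_weight[OF _ _ C0])
    have "norm (J s h) \<le> (max Z 0 * max Z 0) * measure lborel (cball 0 R :: 'a set)"
      unfolding J_def
    proof (rule norm_integral_compact_support)
      fix x :: 'a
      show "norm (exp (\<i> * of_real (s * (\<phi> (x + h) - \<phi> x))) * a h x) \<le> max Z 0 * max Z 0"
        using mult_mono[OF Z'[of x] Z'[of "x + h"]] by (simp add: norm_mult a_def abs_mult)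
    qed (use \<zeta>0 in \<open>auto simp: a_def\<close>)
    then show "norm (J s h) \<le> C" by (simp add: C_def le_max_iff_disj)
    consider "h = 0" | "h \<in> I" | "norm h > 2 * R" unfolding I_def by force
    then show "norm (s *\<^sub>R h) ^ (2 * DIM('a)) * norm (J s h) \<le> C"
    proof cases
      case 1
      then show ?thesis using C0 by (simp add: power_0_left)
    next
      case 2
      then have "h \<noteq> 0" by (simp add: I_def)
      then have "s * norm h * P h x = s * (\<phi> (x + h) - \<phi> x)" for x
        by (simp add: P_def)
      then have "(LINT x|lborel. exp (\<i> * of_real (s * norm h * P h x)) * a h x) = J s h"
        by (simp only: J_def)
      with C1[OF 2, of "s * norm h"] s \<open>h \<noteq> 0\<close> show ?thesis by (simp add: C_def le_max_iff_disj)
    next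
      case 3
      have "a h x = 0" for x
      proof (cases "norm x > R")
        case False
        then have "norm (x + h) > R" using 3 norm_triangle_ineq4[of "x + h" x] by simp
        then show ?thesis by (simp add: a_def \<zeta>0)
      qed (simp add: a_def \<zeta>0)
      then show ?thesis using C0 by (simp add: J_def)
    qed
  qed
  have cont\<phi>: "continuous_on UNIV \<phi>" and cont\<zeta>: "continuous_on UNIV \<zeta>"
    using symb_continuous[OF \<phi>] symb_continuous[OF \<zeta>] by auto
  have [measurable]: "\<phi> \<in> borel_measurable borel" "\<zeta> \<in> borel_measurable borel"
    by (intro borel_measurable_continuous_onI cont\<phi> cont\<zeta>)+
  have "(norm (LINT \<eta>|lborel. exp (\<i> * of_real (y \<bullet> \<eta> - s * \<phi> \<eta>)) * of_real (\<zeta> \<eta>)))\<^sup>2 * s ^ DIM('a)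
      \<le> 2 ^ DIM('a) * C * pi ^ DIM('a)" if s: "s > 0" for s y
  proof -
    define F where "F \<eta> = exp (\<i> * of_real (y \<bullet> \<eta> - s * \<phi> \<eta>)) * complex_of_real (\<zeta> \<eta>)" for \<eta>
    define G where "G \<eta> = exp (\<i> * of_real (- (y \<bullet> \<eta> - s * \<phi> \<eta>))) * complex_of_real (\<zeta> \<eta>)" for \<eta>
    have intF: "integrable lborel F" and intG: "integrable lborel G"
      by (rule integrable_compact_support[where R = R];
          use \<zeta>0 in \<open>auto simp: F_def G_def intro!: continuous_intros cont\<phi> cont\<zeta>\<close>)+
    have [measurable]: "F \<in> borel_measurable borel" "G \<in> borel_measurable borel"
      using intF intG by auto
    have FG: "F x * G (x + h) = exp (\<i> * of_real (- (y \<bullet> h))) * (exp (\<i> * of_real (s * (\<phi> (x + h) - \<phi> x))) * a h x)" for x h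
    proof -
      have "exp (\<i> * complex_of_real (y \<bullet> x - s * \<phi> x)) * exp (\<i> * complex_of_real (- (y \<bullet> (x + h) - s * \<phi> (x + h)))) =
        exp (\<i> * of_real (- (y \<bullet> h))) * exp (\<i> * of_real (s * (\<phi> (x + h) - \<phi> x)))"
        unfolding mult_exp_exp by (simp add: inner_add_right algebra_simps)
      then show ?thesis unfolding F_def G_def a_def by (simp add: mult_ac)
    qed
    have cnjF: "cnj (F x) = G x" for x
      unfolding F_def G_def by (simp add: exp_cnj algebra_simps)
    have "of_real ((norm (integral\<^sup>L lborel F))\<^sup>2) = integral\<^sup>L lborel F * integral\<^sup>L lborel G"
      unfolding complex_norm_square cnjF[symmetric] by simp
    also have "\<dots> = (LINT x|lborel. (LINT h|lborel. F x * G (x + h)))"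
    proof -
      have "integral\<^sup>L lborel G = (LINT h|lborel. G (x + h))" for x
        using integral_lborel_affine[of G 1 x] by simp
      then show ?thesis by simp
    qed
    also have "\<dots> = (LINT h|lborel. (LINT x|lborel. F x * G (x + h)))"
    proof (rule lborel_pair.Fubini_integral[symmetric], rule lborel_pair.Fubini_integrable)
      have n: "(LINT h|lborel. norm (G (x + h))) = (LINT h|lborel. norm (G h))" for x
        using integral_lborel_affine[of "\<lambda>h. norm (G h)" 1 x] by simp
      show "integrable lborel (\<lambda>x. LINT h|lborel. norm (case (x, h) of (x, h) \<Rightarrow> F x * G (x + h)))"
        using intF by (simp add: norm_mult n)
      have "integrable lborel (\<lambda>h. G (x + h))" for x
        using integrable_lborel_affine[of G 1 x] intG by simp
      then show "AE x in lborel. integrable lborel (\<lambda>h. case (x, h) of (x, h) \<Rightarrow> F x * G (x + h))"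
        by simp
    qed measurable
    also have "\<dots> = (LINT h|lborel. exp (\<i> * of_real (- (y \<bullet> h))) * J s h)"
      unfolding FG J_def by simp
    finally have "(norm (integral\<^sup>L lborel F))\<^sup>2 = norm (LINT h|lborel. exp (\<i> * of_real (- (y \<bullet> h))) * J s h)"
      by (metis abs_power2 norm_of_real)
    also have "\<dots> \<le> (LINT h|lborel. norm (exp (\<i> * of_real (- (y \<bullet> h))) * J s h))"
      by (rule integral_norm_bound)
    also have "\<dots> \<le> (LINT h|lborel. 2 ^ DIM('a) * C * cauchy_weight (s *\<^sub>R (h::'a)))"
    proof (rule integral_mono')
      have "integrable lborel (\<lambda>h. cauchy_weight (0 + s *\<^sub>R h :: 'a))"
        using s has_bochner_integral_cauchy_weight
        by (subst integrable_lborel_affine) (auto simp: has_bochner_integral_iff)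
      then show "integrable lborel (\<lambda>h::'a. 2 ^ DIM('a) * C * cauchy_weight (s *\<^sub>R h))" by simp
    qed (use Jdecay[OF s] C0 in \<open>auto simp: norm_mult cauchy_weight_nonneg\<close>)
    also have "\<dots> * s ^ DIM('a) = 2 ^ DIM('a) * C * pi ^ DIM('a)"
      using integral_lborel_affine[of "cauchy_weight :: 'a \<Rightarrow> real" s 0] s
        has_bochner_integral_integral_eq[OF has_bochner_integral_cauchy_weight[where 'a='a]] by simp
    finally show ?thesis using s unfolding F_def by simp
  qed
  then show ?thesis
    by (intro exI[of _ "2 ^ DIM('a) * C * pi ^ DIM('a)"]) (auto simp: C0)
qed

section \<open>Laplace transforms\<close>

lemma has_bochner_integral_Gamma:
  fixes x s :: real
  assumes x: "x > 0" and s: "s > 0"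
  shows "has_bochner_integral lborel (\<lambda>t. indicator {0..} t *\<^sub>R (t powr (x - 1) * exp (- s * t))) (Gamma x / s powr x)"
proof -
  have "has_bochner_integral lborel (\<lambda>t::real. indicator {0..} t * t powr (x - 1) / exp t) (Gamma x)"
    by (rule has_bochner_integral_nn_integral)
       (use Gamma_conv_nn_integral_real[OF x] Gamma_real_pos[OF x] in auto)
  then have "has_bochner_integral lborel (\<lambda>t::real. indicator {0..} (s * t) * (s * t) powr (x - 1) / exp (s * t)) (Gamma x / s)"
    using lborel_has_bochner_integral_real_affine_iff[of s "\<lambda>t::real. indicator {0..} t * t powr (x - 1) / exp t" "Gamma x" 0] s
    by (simp add: divide_inverse mult.commute)
  from has_bochner_integral_mult_right[OF this, of "s powr (1 - x)"]
  have "has_bochner_integral lborel (\<lambda>t. s powr (1 - x) * (indicator {0..} (s * t) * (s * t) powr (x - 1) / exp (s * t)))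
      (s powr (1 - x) * (Gamma x / s))" by simp
  moreover have "s powr (1 - x) * (indicator {0..} (s * t) * (s * t) powr (x - 1) / exp (s * t)) =
      indicator {0..} t *\<^sub>R (t powr (x - 1) * exp (- s * t))" for t
    using s by (auto simp: indicator_def zero_le_mult_iff powr_mult exp_minus field_simps powr_add[symmetric])
  moreover have "s powr (1 - x) * (Gamma x / s) = Gamma x / s powr x"
    using s by (simp add: powr_diff)
  ultimately show ?thesis by simp
qed

lemma integrable_powr_decay:
  fixes f :: "real \<Rightarrow> complex"
  assumes cont: "continuous_on UNIV f" and a: "a > 0" and R: "R > 0"
    and bound: "\<And>y. \<bar>y\<bar> \<ge> R \<Longrightarrow> norm (f y) \<le> A * \<bar>y\<bar> powr (-1-a)"
  shows "integrable lborel f"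
proof -
  have lim: "((\<lambda>x. - (x powr (-a)) / a) \<longlongrightarrow> 0) at_top" using a by real_asymp
  have e: "(\<integral>\<^sup>+x. ennreal (x powr (-1-a)) * indicator {R..} x \<partial>lborel) = ennreal (0 - (- (R powr (-a)) / a))"
    by (rule nn_integral_FTC_atLeast[OF _ _ _ lim])
       (use a R in \<open>auto intro!: derivative_eq_intros simp: powr_diff powr_minus field_simps\<close>)
  have i: "integrable lborel (\<lambda>x. indicator {R..} x *\<^sub>R (x powr (-1-a)))"
  proof (rule integrableI_nonneg)
    have "(\<integral>\<^sup>+x. ennreal (indicator {R..} x *\<^sub>R (x powr (-1-a))) \<partial>lborel) =
       (\<integral>\<^sup>+x. ennreal (x powr (-1-a)) * indicator {R..} x \<partial>lborel)"
      by (intro nn_integral_cong) (auto simp: indicator_def)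
    then show "(\<integral>\<^sup>+x. ennreal (indicator {R..} x *\<^sub>R (x powr (-1-a))) \<partial>lborel) < \<infinity>" using e by simp
  qed auto
  have i2: "integrable lborel (\<lambda>x. indicator {R..} (-x) *\<^sub>R ((-x) powr (-1-a)))"
    using lborel_integrable_real_affine_iff[of "-1" "\<lambda>x. indicator {R..} x *\<^sub>R (x powr (-1-a))" 0] i by simp
  have [measurable]: "f \<in> borel_measurable borel" using cont by (rule borel_measurable_continuous_onI)
  have "bounded (f ` {-R..R})"
    by (intro compact_imp_bounded compact_continuous_image) (auto intro: continuous_on_subset[OF cont])
  then obtain B where B: "B > 0" "\<And>y. y \<in> {-R..R} \<Longrightarrow> norm (f y) \<le> B"
    by (auto simp: bounded_pos)
  show ?thesis
  proof (rule Bochner_Integration.integrable_bound)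
    show "integrable lborel (\<lambda>x. B * indicator {-R..R} x + \<bar>A\<bar> * (indicator {R..} x *\<^sub>R (x powr (-1-a)))
        + \<bar>A\<bar> * (indicator {R..} (-x) *\<^sub>R ((-x) powr (-1-a))) :: real)"
      by (intro Bochner_Integration.integrable_add integrable_mult_right i i2) (use R in auto)
    show "AE y in lborel. norm (f y) \<le> norm (B * indicator {-R..R} y + \<bar>A\<bar> * (indicator {R..} y *\<^sub>R (y powr (-1-a)))
        + \<bar>A\<bar> * (indicator {R..} (-y) *\<^sub>R ((-y) powr (-1-a))) :: real)"
    proof (rule AE_I2)
      fix y :: real
      have "A * \<bar>y\<bar> powr (-1-a) \<le> \<bar>A\<bar> * \<bar>y\<bar> powr (-1-a)" by (intro mult_right_mono) auto
      then have b: "\<bar>y\<bar> \<ge> R \<Longrightarrow> norm (f y) \<le> \<bar>A\<bar> * \<bar>y\<bar> powr (-1-a)" using bound[of y] by linarith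
      consider "y \<in> {-R..R}" | "y > R" | "y < -R" by force
      then have "norm (f y) \<le> B * indicator {-R..R} y + \<bar>A\<bar> * (indicator {R..} y *\<^sub>R (y powr (-1-a)))
        + \<bar>A\<bar> * (indicator {R..} (-y) *\<^sub>R ((-y) powr (-1-a)))"
      proof cases
        case 1
        then show ?thesis using B(2)[OF 1] by (auto intro!: add_increasing2)
      qed (use b R in \<open>auto simp: indicator_def\<close>)
      then show "norm (f y) \<le> norm (B * indicator {-R..R} y + \<bar>A\<bar> * (indicator {R..} y *\<^sub>R (y powr (-1-a)))
        + \<bar>A\<bar> * (indicator {R..} (-y) *\<^sub>R ((-y) powr (-1-a))))" by simp
    qed
  qed measurable
qed

section \<open>The Bromwich formula\<close>

text \<open>The function \<open>v t exp (- c t)\<close>, extended by 0 to negative \<open>t\<close>,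
  is bounded and integrable, and continuous because \<open>v 0 = 0\<close>. Its Fourier transform at
  \<open>y\<close> is \<open>V (c + i y)\<close>, so one-dimensional Fourier inversion
  applies.\<close>

lemma laplace_inversion:
  fixes v :: "real \<Rightarrow> complex" and V :: "complex \<Rightarrow> complex"
  assumes cont: "continuous_on {0..} v" and v0: "v 0 = 0"
    and growth: "\<And>t. t \<ge> 0 \<Longrightarrow> norm (v t) \<le> B * exp (c0 * t)" and c: "c0 < c"
    and lap: "\<And>y. (LINT t|lborel. indicator {0..} t *\<^sub>R (v t * exp (- Complex c y * of_real t))) = V (Complex c y)"
    and int: "integrable lborel (\<lambda>y. V (Complex c y))" and t: "t \<ge> 0"
  shows "v t = (LINT y|lborel. V (Complex c y) * exp (Complex c y * of_real t)) / of_real (2 * pi)"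
proof -
  have B: "B \<ge> 0" using order_trans[OF norm_ge_zero growth[of 0]] by simp
  define g where "g t = (if t \<in> {0..} then v t * exp (- of_real (c * t)) else 0)" for t
  have contg: "continuous_on UNIV g"
  proof -
    have "continuous_on ({0..} \<union> {..0}) g"
      unfolding g_def using v0
      by (intro continuous_on_If continuous_on_mult continuous_on_exp continuous_on_minus continuous_on_of_real
          continuous_intros cont) (auto intro: antisym)
    moreover have "{0..} \<union> {..0} = (UNIV :: real set)" by auto
    ultimately show ?thesis by simp
  qed
  then have [measurable]: "g \<in> borel_measurable borel" by (rule borel_measurable_continuous_onI)
  have gb: "norm (g t) \<le> indicator {0..} t *\<^sub>R (B * exp (- (c - c0) * t))" for t
  proof (cases "t \<ge> 0")
    case True
    have "norm (g t) = norm (v t) * exp (- (c * t))"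
      using True by (simp add: g_def norm_mult)
    also have "\<dots> \<le> (B * exp (c0 * t)) * exp (- (c * t))"
      using growth[OF True] by (intro mult_right_mono) auto
    also have "\<dots> = B * exp (- (c - c0) * t)" by (simp add: mult.assoc mult_exp_exp algebra_simps)
    finally show ?thesis using True by simp
  qed (simp add: g_def)
  have "integrable lborel (\<lambda>t. indicator {0..} t *\<^sub>R exp (- complex_of_real (c - c0) * of_real t))"
    using has_bochner_integral_exp_half_line[of "of_real (c - c0)"] c by (auto simp: has_bochner_integral_iff)
  then have "integrable lborel (\<lambda>t. B * norm (indicator {0..} t *\<^sub>R exp (- complex_of_real (c - c0) * of_real t)))"
    by (intro integrable_mult_right integrable_norm)
  moreover have "B * norm (indicator {0..} t *\<^sub>R exp (- complex_of_real (c - c0) * of_real t)) =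
      indicator {0..} t *\<^sub>R (B * exp (- (c - c0) * t))" for t
    by (auto simp: indicator_def)
  ultimately have intb: "integrable lborel (\<lambda>t. indicator {0..} t *\<^sub>R (B * exp (- (c - c0) * t)))"
    by (simp only:)
  have intg: "integrable lborel g"
    by (rule Bochner_Integration.integrable_bound[OF intb]) (use gb B in \<open>auto simp: abs_mult\<close>)
  have bdd: "norm (g t) \<le> B" for t
  proof (cases "t \<ge> 0")
    case True
    then have "exp (- (c - c0) * t) \<le> 1" using c by (simp add: mult_nonpos_nonneg)
    then have "B * exp (- (c - c0) * t) \<le> B" using B by (simp add: mult_left_le)
    with gb[of t] True show ?thesis by simp
  qed (use B in \<open>simp add: g_def\<close>)
  have F: "fourier g y = V (Complex c y)" for y
  proof -
    have "g t * exp (- \<i> * of_real (t * y)) = indicator {0..} t *\<^sub>R (v t * exp (- Complex c y * of_real t))" for t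
      by (auto simp: g_def indicator_def Complex_eq mult.assoc mult_exp_exp algebra_simps)
    then show ?thesis using lap[of y] by (simp add: fourier_def)
  qed
  have "g t = inv_fourier (fourier g) t"
    by (rule fourier_inversion[symmetric, OF intg contg bdd]) (use int F in \<open>simp add: F[abs_def]\<close>)
  also have "\<dots> = (LINT y|lborel. V (Complex c y) * exp (\<i> * of_real (t * y))) / of_real (2 * pi)"
    by (simp add: inv_fourier_def F)
  finally have "v t = exp (of_real (c * t)) * ((LINT y|lborel. V (Complex c y) * exp (\<i> * of_real (t * y))) / of_real (2 * pi))"
    using t by (simp add: g_def exp_minus field_simps)
  also have "\<dots> = (LINT y|lborel. exp (of_real (c * t)) * (V (Complex c y) * exp (\<i> * of_real (t * y)))) / of_real (2 * pi)"
    by simp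
  also have "(\<lambda>y. exp (of_real (c * t)) * (V (Complex c y) * exp (\<i> * of_real (t * y)))) =
      (\<lambda>y. V (Complex c y) * exp (Complex c y * of_real t))"
    by (auto simp: Complex_eq algebra_simps exp_add)
  finally show ?thesis .
qed

section \<open>Moving the contour into a sector\<close>

text \<open>The complement of a closed cone around the negative real axis, apex 0 included in the
  cone. For \<kappa> > 0 it contains the closed right half plane without 0, in particular the point
  \<open>- i\<close>.\<close>

definition wide_sector :: "real \<Rightarrow> complex set" where
  "wide_sector \<kappa> = {s. Re s > - \<kappa> * \<bar>Im s\<bar>}"

lemma open_wide_sector: "open (wide_sector \<kappa>)"
  unfolding wide_sector_def by (intro open_Collect_less continuous_intros)

text \<open>For \<kappa> > 0 the sector is not convex, but every point is visible from 1. This gives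
  global primitives, and contours are then moved by comparing values of a primitive.\<close>

lemma starlike_wide_sector:
  assumes "\<kappa> > 0"
  shows "starlike (wide_sector \<kappa>)"
  unfolding starlike_def
proof (intro bexI ballI subsetI)
  show "1 \<in> wide_sector \<kappa>" by (simp add: wide_sector_def)
  fix s z assume s: "s \<in> wide_sector \<kappa>" and "z \<in> closed_segment 1 s"
  then obtain u where u: "0 \<le> u" "u \<le> 1" and z: "z = (1 - u) *\<^sub>R 1 + u *\<^sub>R s"
    unfolding closed_segment_def by blast
  have Re: "Re z = (1 - u) + u * Re s" and Im: "Im z = u * Im s" by (simp_all add: z)
  show "z \<in> wide_sector \<kappa>"
  proof (cases "u = 0")
    case False
    then have "u * (- \<kappa> * \<bar>Im s\<bar>) < u * Re s"
      using s u by (intro mult_strict_left_mono) (auto simp: wide_sector_def)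
    then show ?thesis unfolding wide_sector_def using u Re Im by (simp add: abs_mult algebra_simps)
  qed (use Re Im in \<open>simp add: wide_sector_def\<close>)
qed

lemma primitive_segment_bound:
  fixes F f :: "complex \<Rightarrow> complex"
  assumes "\<And>s. s \<in> D \<Longrightarrow> (F has_field_derivative f s) (at s)"
    and "closed_segment a b \<subseteq> D" "\<And>s. s \<in> closed_segment a b \<Longrightarrow> norm (f s) \<le> B"
  shows "norm (F b - F a) \<le> B * norm (b - a)"
  using assms
  by (intro field_differentiable_bound[where S = "closed_segment a b" and f' = f])
     (auto intro: has_field_derivative_at_within)

lemma norm_ge_Im_Re: "\<bar>Im s\<bar> \<le> norm s" "\<bar>Re s\<bar> \<le> norm s"
  by (simp_all add: abs_Im_le_cmod abs_Re_le_cmod)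

text \<open>The Bromwich line is moved to the two rays \<open>r (- \<kappa> / 2 \<plusminus> i)\<close>, on which \<open>exp (t s)\<close> decays;
  there the singularity of size \<open>|s| powr (\<alpha> - 1)\<close> at the origin produces the rate \<open>t powr (- \<alpha>)\<close>.\<close>

lemma laplace_decay_of_ray_bound:
  fixes v :: "real \<Rightarrow> complex" and V :: "complex \<Rightarrow> complex"
  assumes cont: "continuous_on {0..} v" and v0: "v 0 = 0"
    and growth: "\<And>t. t \<ge> 0 \<Longrightarrow> norm (v t) \<le> B * exp (c0 * t)" and c: "c0 < c" "0 < c"
    and lap: "\<And>y. (LINT t|lborel. indicator {0..} t *\<^sub>R (v t * exp (- Complex c y * of_real t))) = V (Complex c y)"
    and \<alpha>: "0 < \<alpha>" and \<kappa>: "0 < \<kappa>"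
    and V: "continuous_on (wide_sector \<kappa>) V" "finite k"
      "\<And>s. s \<in> wide_sector \<kappa> - k \<Longrightarrow> V field_differentiable at s"
    and R: "R > 0" "\<And>s. s \<in> wide_sector \<kappa> \<Longrightarrow> R \<le> norm s \<Longrightarrow> norm (V s) \<le> A * norm s powr (-1-\<alpha>)"
    and r0: "r0 > 0" "\<And>s. s \<in> wide_sector \<kappa> \<Longrightarrow> norm s \<le> r0 \<Longrightarrow> norm (V s) \<le> A * norm s powr (\<alpha> - 1)"
    and ray: "\<And>r \<tau>. r > 0 \<Longrightarrow> \<bar>\<tau>\<bar> = 1 \<Longrightarrow> norm (V (of_real r * Complex (- \<kappa> / 2) \<tau>)) \<le> A * r powr (\<alpha> - 1)"
  shows "\<exists>C. \<forall>t>0. norm (v t) \<le> C * t powr (- \<alpha>)"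
proof -
  have A: "A \<ge> 0" using ray[of 1 1] by (simp add: order_trans[OF norm_ge_zero])
  have inD: "s \<in> wide_sector \<kappa>" if "Re s \<ge> - (\<kappa> / 2) * \<bar>Im s\<bar>" "s \<noteq> 0" for s
  proof (cases "Im s = 0")
    case True
    then have "Re s > 0" using that by (simp add: complex_eq_iff)
    then show ?thesis using True by (simp add: wide_sector_def)
  next
    case False
    then have "\<kappa> * \<bar>Im s\<bar> > 0" using \<kappa> by simp
    with that(1) show ?thesis unfolding wide_sector_def by simp
  qed
  have lineD: "Complex c y \<in> wide_sector \<kappa>" for y
    using c(2) \<kappa> by (intro inD) (auto simp: complex_eq_iff intro: order_trans[of _ 0])
  have contline: "continuous_on UNIV (\<lambda>y. V (Complex c y))"
    by (rule continuous_on_compose2[OF V(1)]) (use lineD in \<open>auto simp: Complex_eq intro!: continuous_intros\<close>)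
  have intline: "integrable lborel (\<lambda>y. V (Complex c y))"
  proof (rule integrable_powr_decay[OF contline \<alpha> R(1)])
    fix y assume y: "R \<le> \<bar>y\<bar>"
    have le: "\<bar>y\<bar> \<le> norm (Complex c y)" using norm_ge_Im_Re(1)[of "Complex c y"] by simp
    then have "norm (V (Complex c y)) \<le> A * norm (Complex c y) powr (-1-\<alpha>)"
      using y by (intro R(2) lineD) auto
    also have "\<dots> \<le> A * \<bar>y\<bar> powr (-1-\<alpha>)"
      using le y R(1) \<alpha> A by (intro mult_left_mono powr_mono2') auto
    finally show "norm (V (Complex c y)) \<le> A * \<bar>y\<bar> powr (-1-\<alpha>)" .
  qed
  \<comment> \<open>Half of the opening \<kappa> keeps the open rays strictly inside the
    sector.\<close>
  define w where "w \<tau> = Complex (- \<kappa> / 2) \<tau>" for \<tau>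
  define G where "G = Gamma \<alpha> / (\<kappa> / 2) powr \<alpha>"
  have w1: "norm (w 1) = norm (w (-1))" by (simp add: w_def cmod_def)
  have "norm (v t) \<le> (A * norm (w 1) * G / pi) * t powr (-\<alpha>)" if t: "t > 0" for t
  proof -
    define f where "f s = V s * exp (s * of_real t)" for s
    \<comment> \<open>Every piece of contour becomes a difference of values of one primitive
      \<open>F\<close>, so the deformation of the Bromwich line reduces to a telescoping
      sum.\<close>
    have "\<exists>F. \<forall>s\<in>wide_sector \<kappa>. (F has_field_derivative f s) (at s)"
    proof (rule holomorphic_starlike_primitive[OF _ starlike_wide_sector[OF \<kappa>] open_wide_sector V(2)])
      show "continuous_on (wide_sector \<kappa>) f" unfolding f_def by (intro continuous_intros V(1))
      show "f field_differentiable at s" if "s \<in> wide_sector \<kappa> - k" for s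
        unfolding f_def using V(3)[OF that]
        by (intro field_differentiable_mult field_differentiable_compose[OF _ field_differentiable_within_exp, unfolded o_def]
            derivative_intros) (auto intro!: derivative_intros)
    qed
    then obtain F where F: "\<And>s. s \<in> wide_sector \<kappa> \<Longrightarrow> (F has_field_derivative f s) (at s)" by blast
    have normf: "norm (f s) = norm (V s) * exp (Re s * t)" for s by (simp add: f_def norm_mult)
    have line: "(LINT y|lborel. indicator {-L..L} y *\<^sub>R (\<i> * f (Complex c y))) = F (Complex c L) - F (Complex c (-L))"
      if "L > 0" for L
    proof (rule integral_FTC_Icc[where F = "\<lambda>y. F (Complex c y)"])
      show "- L \<le> L" using that by simp
      fix y :: real
      have "((\<lambda>y. Complex c y) has_vector_derivative \<i>) (at y within {-L..L})"
        unfolding Complex_eq by (auto intro!: derivative_eq_intros)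
      from field_vector_diff_chain_within[OF this has_field_derivative_at_within[OF F[OF lineD]]]
      show "((\<lambda>y. F (Complex c y)) has_vector_derivative \<i> * f (Complex c y)) (at y within {-L..L})"
        by (simp add: o_def)
    next
      show "continuous_on {-L..L} (\<lambda>y. \<i> * f (Complex c y))"
        unfolding f_def
        by (intro continuous_intros continuous_on_subset[OF contline]) (auto simp: Complex_eq intro!: continuous_intros)
    qed
    have "(\<lambda>n. LINT y|lborel. indicator {-real (Suc n)..real (Suc n)} y *\<^sub>R (\<i> * f (Complex c y)))
        \<longlonglongrightarrow> (LINT y|lborel. \<i> * f (Complex c y))"
    proof (rule integral_dominated_convergence)
      have [measurable]: "(\<lambda>y. V (Complex c y)) \<in> borel_measurable borel" using intline by auto
      have [measurable]: "(\<lambda>y. exp (Complex c y * of_real t)) \<in> borel_measurable borel"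
        unfolding Complex_eq by measurable
      show "(\<lambda>y. \<i> * f (Complex c y)) \<in> borel_measurable lborel" unfolding f_def by measurable
      show "(\<lambda>y. indicator {-real (Suc n)..real (Suc n)} y *\<^sub>R (\<i> * f (Complex c y))) \<in> borel_measurable lborel" for n
        unfolding f_def by measurable
      show "integrable lborel (\<lambda>y. norm (V (Complex c y)) * exp (c * t))" using intline by simp
      show "AE y in lborel. norm (indicator {-real (Suc n)..real (Suc n)} y *\<^sub>R (\<i> * f (Complex c y)))
          \<le> norm (V (Complex c y)) * exp (c * t)" for n
        by (auto simp: norm_mult normf indicator_def)
      show "AE y in lborel. (\<lambda>n. indicator {-real (Suc n)..real (Suc n)} y *\<^sub>R (\<i> * f (Complex c y)))
          \<longlonglongrightarrow> \<i> * f (Complex c y)"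
      proof (rule AE_I2)
        fix y :: real
        have "eventually (\<lambda>n. \<bar>y\<bar> \<le> real (Suc n)) sequentially" by real_asymp
        then have "eventually (\<lambda>n. indicator {-real (Suc n)..real (Suc n)} y *\<^sub>R (\<i> * f (Complex c y)) = \<i> * f (Complex c y)) sequentially"
          by eventually_elim (auto simp: indicator_def)
        then show "(\<lambda>n. indicator {-real (Suc n)..real (Suc n)} y *\<^sub>R (\<i> * f (Complex c y))) \<longlonglongrightarrow> \<i> * f (Complex c y)"
          by (rule tendsto_eventually)
      qed
    qed
    also have "(LINT y|lborel. \<i> * f (Complex c y)) = \<i> * of_real (2 * pi) * v t"
      using laplace_inversion[OF cont v0 growth c(1) lap intline, of t] t by (simp add: f_def)
    finally have lim: "(\<lambda>n. F (Complex c (real (Suc n))) - F (Complex c (-real (Suc n)))) \<longlonglongrightarrow> \<i> * of_real (2 * pi) * v t"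
      unfolding line[OF of_nat_0_less_iff[THEN iffD2, OF zero_less_Suc]] .
    have rayD: "of_real r * w \<tau> \<in> wide_sector \<kappa>" if "r > 0" "\<bar>\<tau>\<bar> = 1" for r \<tau>
      using that \<kappa> by (intro inD) (auto simp: w_def complex_eq_iff abs_mult)
    \<comment> \<open>On a ray the integrand is at most a constant times
      \<open>r^(\<alpha> - 1) exp (- \<kappa> t r / 2)\<close>, a Gamma integral. Its bound does not
      depend on the endpoints and is the only contribution left in the limit.\<close>
    have rays: "norm (F (of_real L * w \<tau>) - F (of_real e * w \<tau>)) \<le> A * norm (w 1) * (Gamma \<alpha> / (\<kappa> / 2 * t) powr \<alpha>)"
      if e: "0 < e" "e \<le> L" and \<tau>: "\<bar>\<tau>\<bar> = 1" for e L \<tau>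
    proof -
      have nw: "norm (w \<tau>) = norm (w 1)" using \<tau> by (auto simp: w_def cmod_def abs_square_eq_1)
      have "(LINT r|lborel. indicator {e..L} r *\<^sub>R (w \<tau> * f (of_real r * w \<tau>))) = F (of_real L * w \<tau>) - F (of_real e * w \<tau>)"
      proof (rule integral_FTC_Icc[where F = "\<lambda>r. F (of_real r * w \<tau>)"])
        fix r assume "e \<le> r" "r \<le> L"
        then have r: "of_real r * w \<tau> \<in> wide_sector \<kappa>" using e \<tau> by (intro rayD) auto
        have "((\<lambda>r. of_real r * w \<tau>) has_vector_derivative w \<tau>) (at r within {e..L})"
          by (auto intro!: derivative_eq_intros)
        from field_vector_diff_chain_within[OF this has_field_derivative_at_within[OF F[OF r]]]
        show "((\<lambda>r. F (of_real r * w \<tau>)) has_vector_derivative w \<tau> * f (of_real r * w \<tau>)) (at r within {e..L})"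
          by (simp add: o_def)
      next
        show "continuous_on {e..L} (\<lambda>r. w \<tau> * f (of_real r * w \<tau>))"
          unfolding f_def using e \<tau>
          by (intro continuous_intros continuous_on_compose2[OF V(1)]) (auto intro!: rayD continuous_intros)
      qed (use e in auto)
      then have "norm (F (of_real L * w \<tau>) - F (of_real e * w \<tau>)) \<le>
          (LINT r|lborel. norm (indicator {e..L} r *\<^sub>R (w \<tau> * f (of_real r * w \<tau>))))"
        by (metis integral_norm_bound)
      also have "\<dots> \<le> (LINT r|lborel. A * norm (w 1) * (indicator {0..} r *\<^sub>R (r powr (\<alpha> - 1) * exp (- (\<kappa> / 2 * t) * r))))"
      proof (rule integral_mono')
        show "integrable lborel (\<lambda>r. A * norm (w 1) * (indicator {0..} r *\<^sub>R (r powr (\<alpha> - 1) * exp (- (\<kappa> / 2 * t) * r))))"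
          using has_bochner_integral_Gamma[of \<alpha> "\<kappa> / 2 * t"] \<alpha> \<kappa> t
          by (intro integrable_mult_right) (auto simp: has_bochner_integral_iff)
        fix r
        show "norm (indicator {e..L} r *\<^sub>R (w \<tau> * f (of_real r * w \<tau>))) \<le>
          A * norm (w 1) * (indicator {0..} r *\<^sub>R (r powr (\<alpha> - 1) * exp (- (\<kappa> / 2 * t) * r)))"
        proof (cases "e \<le> r \<and> r \<le> L")
          case True
          then have r: "r > 0" using e by simp
          have "norm (w \<tau> * f (of_real r * w \<tau>)) = norm (w 1) * (norm (V (of_real r * w \<tau>)) * exp (- (\<kappa> / 2 * t) * r))"
            by (simp add: norm_mult normf nw) (simp add: w_def mult_ac)
          also have "\<dots> \<le> norm (w 1) * ((A * r powr (\<alpha> - 1)) * exp (- (\<kappa> / 2 * t) * r))"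
            using ray[OF r \<tau>] by (intro mult_left_mono mult_right_mono) (auto simp: w_def)
          finally show ?thesis using True r by (simp add: mult_ac)
        qed (use A in \<open>auto simp: indicator_def\<close>)
      qed (use A in auto)
      also have "\<dots> = A * norm (w 1) * (Gamma \<alpha> / (\<kappa> / 2 * t) powr \<alpha>)"
        using has_bochner_integral_integral_eq[OF has_bochner_integral_Gamma[of \<alpha> "\<kappa> / 2 * t"]] \<alpha> \<kappa> t
        by simp
      finally show ?thesis .
    qed
    \<comment> \<open>The horizontal connection at height \<open>L\<close> has length
      \<open>O(L)\<close>, and \<open>V\<close> is \<open>O(L^(-1-\<alpha>))\<close> there, so it
      contributes \<open>O(L^(-\<alpha>))\<close>.\<close>
    have far: "norm (F (Complex c (\<tau> * L)) - F (of_real L * w \<tau>)) \<le> exp (c * t) * (A * L powr (-1-\<alpha>)) * (c + \<kappa> / 2 * L)"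
      if L: "L \<ge> R" and \<tau>: "\<bar>\<tau>\<bar> = 1" for L \<tau>
    proof -
      have L0: "L > 0" using L R(1) by simp
      have im: "Im (of_real L * w \<tau>) = Im (Complex c (\<tau> * L))" by (simp add: w_def)
      have seg: "Im s = \<tau> * L \<and> - (\<kappa> / 2) * L \<le> Re s \<and> Re s \<le> c"
        if "s \<in> closed_segment (of_real L * w \<tau>) (Complex c (\<tau> * L))" for s
      proof -
        have "- (\<kappa> / 2) * L \<le> c" using \<kappa> L0 c(2) by (smt (verit) mult_nonneg_nonneg divide_pos_pos mult_minus_left)
        then show ?thesis
          using that unfolding closed_segment_same_Im[OF im] by (auto simp: w_def closed_segment_eq_real_ivl mult_ac)
      qed
      have absIm: "\<bar>Im s\<bar> = L" if "s \<in> closed_segment (of_real L * w \<tau>) (Complex c (\<tau> * L))" for s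
        using seg[OF that] \<tau> L0 by (simp add: abs_mult)
      have segD: "s \<in> wide_sector \<kappa>" if "s \<in> closed_segment (of_real L * w \<tau>) (Complex c (\<tau> * L))" for s
        using seg[OF that] absIm[OF that] L0 by (intro inD) auto
      have "norm (F (Complex c (\<tau> * L)) - F (of_real L * w \<tau>)) \<le>
          exp (c * t) * (A * L powr (-1-\<alpha>)) * norm (Complex c (\<tau> * L) - of_real L * w \<tau>)"
      proof (rule primitive_segment_bound[OF F])
        fix s assume s: "s \<in> closed_segment (of_real L * w \<tau>) (Complex c (\<tau> * L))"
        have le: "L \<le> norm s" using norm_ge_Im_Re(1)[of s] absIm[OF s] by simp
        have "norm (V s) \<le> A * norm s powr (-1-\<alpha>)" using segD[OF s] le L by (intro R(2)) auto
        also have "\<dots> \<le> A * L powr (-1-\<alpha>)"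
          using le L0 \<alpha> A by (intro mult_left_mono powr_mono2') auto
        finally have "norm (V s) * exp (Re s * t) \<le> (A * L powr (-1-\<alpha>)) * exp (c * t)"
          using seg[OF s] t A by (intro mult_mono) auto
        then show "norm (f s) \<le> exp (c * t) * (A * L powr (-1-\<alpha>))" by (simp add: normf mult.commute)
      qed (use segD in auto)
      also have "norm (Complex c (\<tau> * L) - of_real L * w \<tau>) = c + \<kappa> / 2 * L"
      proof -
        have "Complex c (\<tau> * L) - of_real L * w \<tau> = of_real (c + \<kappa> / 2 * L)"
          by (simp add: complex_eq_iff w_def)
        then show ?thesis using c(2) \<kappa> L0 by (simp del: of_real_add)
      qed
      finally show ?thesis .
    qed
    \<comment> \<open>In units of \<open>e\<close>, the constant \<open>M\<close> bounds both the
      distance from 0 and the length of each of the three segments used next.\<close>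
    define M where "M = 2 + \<kappa>"
    have M: "M > 2" using \<kappa> by (simp add: M_def)
    \<comment> \<open>The origin is not in the sector, so the two rays are joined around it on the
      right: horizontally to \<open>e + i e\<close>, vertically to \<open>e - i e\<close>,
      horizontally back. Length \<open>O(e)\<close> times size \<open>O(e^(\<alpha> - 1))\<close>
      tends to 0. The sum of two powers covers both signs of \<open>\<alpha> - 1\<close>.\<close>
    have near: "norm (F (of_real e * w 1) - F (of_real e * w (-1))) \<le> 3 * (exp (M * e * t) * (A * (e powr (\<alpha> - 1) + (M * e) powr (\<alpha> - 1))) * (M * e))"
      if e: "e > 0" "M * e \<le> r0" for e
    proof -
      define B1 where "B1 = exp (M * e * t) * (A * (e powr (\<alpha> - 1) + (M * e) powr (\<alpha> - 1)))"
      have B1: "norm (f s) \<le> B1" if "s \<in> wide_sector \<kappa>" "e \<le> norm s" "norm s \<le> M * e" for s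
      proof -
        have "norm s powr (\<alpha> - 1) \<le> e powr (\<alpha> - 1) + (M * e) powr (\<alpha> - 1)"
        proof (cases "\<alpha> \<le> 1")
          case True
          then have "norm s powr (\<alpha> - 1) \<le> e powr (\<alpha> - 1)" using that e by (intro powr_mono2') auto
          then show ?thesis by (simp add: add_increasing2)
        next
          case False
          then have "norm s powr (\<alpha> - 1) \<le> (M * e) powr (\<alpha> - 1)" using that e by (intro powr_mono2) auto
          then show ?thesis by (simp add: add_increasing)
        qed
        then have p: "A * norm s powr (\<alpha> - 1) \<le> A * (e powr (\<alpha> - 1) + (M * e) powr (\<alpha> - 1))"
          using A by (rule mult_left_mono)
        have "norm (V s) \<le> A * norm s powr (\<alpha> - 1)" using that e by (intro r0(2)) auto
        with p have "norm (V s) \<le> A * (e powr (\<alpha> - 1) + (M * e) powr (\<alpha> - 1))" by simp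
        moreover have "Re s * t \<le> M * e * t"
          using norm_ge_Im_Re(2)[of s] that(3) t by (intro mult_right_mono) auto
        ultimately show ?thesis unfolding normf B1_def
          using A M by (subst mult.commute, intro mult_mono) auto
      qed
      have hor: "norm (F (Complex e (\<tau> * e)) - F (of_real e * w \<tau>)) \<le> B1 * (M * e)" if \<tau>: "\<bar>\<tau>\<bar> = 1" for \<tau>
      proof -
        have im: "Im (of_real e * w \<tau>) = Im (Complex e (\<tau> * e))" by (simp add: w_def)
        have seg: "s \<in> wide_sector \<kappa> \<and> e \<le> norm s \<and> norm s \<le> M * e"
          if "s \<in> closed_segment (of_real e * w \<tau>) (Complex e (\<tau> * e))" for s
        proof -
          have "- (\<kappa> / 2) * e \<le> e" using \<kappa> e by (smt (verit) mult_nonneg_nonneg divide_pos_pos mult_minus_left)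
          then have s: "Im s = \<tau> * e" "- (\<kappa> / 2) * e \<le> Re s" "Re s \<le> e"
            using that unfolding closed_segment_same_Im[OF im] by (auto simp: w_def closed_segment_eq_real_ivl mult_ac)
          have im: "\<bar>Im s\<bar> = e" using s \<tau> e by (simp add: abs_mult)
          have "0 \<le> \<kappa> * e" using \<kappa> e by simp
          then have "\<bar>Re s\<bar> \<le> (1 + \<kappa>) * e" using s e by (simp add: abs_le_iff algebra_simps)
          then have "norm s \<le> M * e" using cmod_le[of s] im by (simp add: M_def algebra_simps)
          moreover have "e \<le> norm s" using norm_ge_Im_Re(1)[of s] im by simp
          moreover have "s \<in> wide_sector \<kappa>" using s im e by (intro inD) auto
          ultimately show ?thesis by simp
        qed
        have "norm (F (Complex e (\<tau> * e)) - F (of_real e * w \<tau>)) \<le> B1 * norm (Complex e (\<tau> * e) - of_real e * w \<tau>)"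
          by (rule primitive_segment_bound[OF F]) (use seg B1 in auto)
        also have "Complex e (\<tau> * e) - of_real e * w \<tau> = of_real (e + \<kappa> / 2 * e)"
          by (simp add: complex_eq_iff w_def)
        also have "norm (of_real (e + \<kappa> / 2 * e) :: complex) \<le> M * e"
          unfolding norm_of_real M_def using \<kappa> e by (simp add: algebra_simps)
        finally show ?thesis using A M unfolding B1_def by (auto simp: mult_left_mono)
      qed
      have ver: "norm (F (Complex e (1 * e)) - F (Complex e (-1 * e))) \<le> B1 * (M * e)"
      proof -
        have re: "Re (Complex e (-1 * e)) = Re (Complex e (1 * e))" by simp
        have seg: "s \<in> wide_sector \<kappa> \<and> e \<le> norm s \<and> norm s \<le> M * e"
          if "s \<in> closed_segment (Complex e (-1 * e)) (Complex e (1 * e))" for s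
        proof -
          have s: "Re s = e" "\<bar>Im s\<bar> \<le> e"
            using that e unfolding closed_segment_same_Re[OF re] by (auto simp: closed_segment_eq_real_ivl)
          have "norm s \<le> 2 * e" using cmod_le[of s] s e by simp
          also have "\<dots> \<le> M * e" using M e by simp
          finally have "norm s \<le> M * e" .
          moreover have "e \<le> norm s" using norm_ge_Im_Re(2)[of s] s by simp
          moreover have "- (\<kappa> / 2) * \<bar>Im s\<bar> \<le> 0" using \<kappa> by simp
          then have "s \<in> wide_sector \<kappa>" using s e by (intro inD) auto
          ultimately show ?thesis by simp
        qed
        have "norm (F (Complex e (1 * e)) - F (Complex e (-1 * e))) \<le> B1 * norm (Complex e (1 * e) - Complex e (-1 * e))"
          by (rule primitive_segment_bound[OF F]) (use seg B1 in auto)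
        also have "norm (Complex e (1 * e) - Complex e (-1 * e)) = 2 * e"
        proof -
          have "Complex e (1 * e) - Complex e (-1 * e) = \<i> * of_real (2 * e)" by (simp add: complex_eq_iff)
          then show ?thesis using e by (simp add: norm_mult del: of_real_mult)
        qed
        also have "B1 * (2 * e) \<le> B1 * (M * e)"
          using A M e unfolding B1_def by (intro mult_left_mono mult_right_mono) auto
        finally show ?thesis .
      qed
      have "F (of_real e * w 1) - F (of_real e * w (-1)) =
          - (F (Complex e (1 * e)) - F (of_real e * w 1)) + (F (Complex e (1 * e)) - F (Complex e (-1 * e)))
          + (F (Complex e (-1 * e)) - F (of_real e * w (-1)))" by simp
      also have "norm \<dots> \<le> B1 * (M * e) + B1 * (M * e) + B1 * (M * e)"
        using hor[of 1] hor[of "-1"] ver by (intro norm_triangle_mono) (auto simp: norm_minus_commute)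
      also have "\<dots> = 3 * (B1 * (M * e))" by simp
      finally show ?thesis by (simp only: B1_def)
    qed
    define E1 where "E1 n = exp (c * t) * (A * real (Suc n) powr (-1-\<alpha>)) * (c + \<kappa> / 2 * real (Suc n))" for n
    define e where "e n = 1 / real (Suc n)" for n
    define E2 where "E2 n = 3 * (exp (M * e n * t) * (A * (e n powr (\<alpha> - 1) + (M * e n) powr (\<alpha> - 1))) * (M * e n))" for n
    have E1: "E1 \<longlonglongrightarrow> 0" unfolding E1_def using \<alpha> \<kappa> c(2) by real_asymp
    have E2: "E2 \<longlonglongrightarrow> 0" unfolding E2_def e_def using \<alpha> M by real_asymp
    define G' where "G' = A * norm (w 1) * (Gamma \<alpha> / (\<kappa> / 2 * t) powr \<alpha>)"
    have "eventually (\<lambda>n. norm (F (Complex c (real (Suc n))) - F (Complex c (-real (Suc n)))) \<le> 2 * G' + 2 * E1 n + E2 n) sequentially"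
    proof -
      have "eventually (\<lambda>n. real (Suc n) \<ge> R) sequentially" by real_asymp
      moreover have "eventually (\<lambda>n. M * e n \<le> r0) sequentially" unfolding e_def using r0(1) by real_asymp
      ultimately show ?thesis
      proof eventually_elim
        case (elim n)
        let ?L = "real (Suc n)"
        have "1 / ?L \<le> 1" by simp
        also have "1 \<le> ?L" by simp
        finally have en: "0 < e n" "e n \<le> ?L" by (auto simp: e_def)
        have "F (Complex c ?L) - F (Complex c (- ?L)) =
           (F (Complex c (1 * ?L)) - F (of_real ?L * w 1)) + (F (of_real ?L * w 1) - F (of_real (e n) * w 1))
           + (F (of_real (e n) * w 1) - F (of_real (e n) * w (-1)))
           + - (F (of_real ?L * w (-1)) - F (of_real (e n) * w (-1)))
           + - (F (Complex c (-1 * ?L)) - F (of_real ?L * w (-1)))" by simp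
        also have "norm \<dots> \<le> E1 n + G' + E2 n + G' + E1 n"
          unfolding E1_def E2_def G'_def
          by (intro norm_triangle_mono far rays near) (use elim en far[of ?L "-1"] rays[of "e n" ?L "-1"] in \<open>auto simp: norm_minus_commute\<close>)
        finally show ?case by simp
      qed
    qed
    moreover have "(\<lambda>n. 2 * G' + 2 * E1 n + E2 n) \<longlonglongrightarrow> 2 * G' + 2 * 0 + 0"
      by (intro tendsto_intros E1 E2)
    ultimately have "norm (\<i> * of_real (2 * pi) * v t) \<le> 2 * G' + 2 * 0 + 0"
      using tendsto_norm[OF lim] by (intro tendsto_le[OF sequentially_bot]) auto
    then have "norm (v t) \<le> G' / pi" by (simp add: norm_mult field_simps)
    also have "G' / pi = (A * norm (w 1) * G / pi) * t powr (-\<alpha>)"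
    proof -
      have "(\<kappa> / 2 * t) powr \<alpha> = (\<kappa> / 2) powr \<alpha> * t powr \<alpha>"
        using \<kappa> t by (intro powr_mult)
      then show ?thesis unfolding G'_def G_def by (simp add: powr_minus field_simps)
    qed
    finally show ?thesis .
  qed
  then show ?thesis by blast
qed

text \<open>This supplies the bound along whole rays. The hypotheses on \<open>V\<close> cover radii
  near 0 and near infinity, where \<open>-1 - \<alpha> \<le> \<alpha> - 1\<close> lets the weaker
  rate take over for \<open>r \<ge> 1\<close>; in between, the rays are compact and \<open>V\<close>
  is continuous.\<close>

lemma laplace_decay:
  fixes v :: "real \<Rightarrow> complex" and V :: "complex \<Rightarrow> complex"
  assumes cont: "continuous_on {0..} v" and v0: "v 0 = 0"
    and growth: "\<And>t. t \<ge> 0 \<Longrightarrow> norm (v t) \<le> B * exp (c0 * t)" and c: "c0 < c" "0 < c"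
    and lap: "\<And>y. (LINT t|lborel. indicator {0..} t *\<^sub>R (v t * exp (- Complex c y * of_real t))) = V (Complex c y)"
    and \<alpha>: "0 < \<alpha>" "\<alpha> < 1" and \<kappa>: "0 < \<kappa>"
    and V: "continuous_on (wide_sector \<kappa>) V" "finite k"
      "\<And>s. s \<in> wide_sector \<kappa> - k \<Longrightarrow> V field_differentiable at s"
    and R: "R \<ge> 1" "\<And>s. s \<in> wide_sector \<kappa> \<Longrightarrow> R \<le> norm s \<Longrightarrow> norm (V s) \<le> A * norm s powr (-1-\<alpha>)"
    and r0: "r0 > 0" "\<And>s. s \<in> wide_sector \<kappa> \<Longrightarrow> norm s \<le> r0 \<Longrightarrow> norm (V s) \<le> A * norm s powr (\<alpha> - 1)"
    and A: "A \<ge> 0"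
  shows "\<exists>C. \<forall>t>0. norm (v t) \<le> C * t powr (- \<alpha>)"
proof -
  define w where "w = (\<lambda>\<tau>. Complex (- \<kappa> / 2) \<tau>)"
  have D: "of_real r * w \<tau> \<in> wide_sector \<kappa>" if "r > 0" "\<bar>\<tau>\<bar> = 1" for r \<tau>
  proof -
    have "\<kappa> * r > 0" using \<kappa> that by simp
    then show ?thesis using that by (simp add: wide_sector_def w_def abs_mult mult.commute)
  qed
  have w1: "1 \<le> norm (w \<tau>)" if "\<bar>\<tau>\<bar> = 1" for \<tau>
    using norm_ge_Im_Re(1)[of "w \<tau>"] that by (simp add: w_def)
  have nw: "norm (w \<tau>) = norm (w 1)" if "\<bar>\<tau>\<bar> = 1" for \<tau>
    using that by (auto simp: w_def cmod_def abs_square_eq_1)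
  define r1 where "r1 = r0 / norm (w 1)"
  have w10: "norm (w 1) > 0" using w1[OF abs_one] by linarith
  then have r1: "r1 > 0" using r0(1) by (simp add: r1_def)
  have "\<exists>M\<ge>0. \<forall>r\<in>{r1..R}. norm (V (of_real r * w \<tau>)) \<le> M" if \<tau>: "\<bar>\<tau>\<bar> = 1" for \<tau>
  proof -
    have "continuous_on {r1..R} (\<lambda>r. V (of_real r * w \<tau>))"
      by (rule continuous_on_compose2[OF V(1)]) (use r1 \<tau> in \<open>auto intro!: D continuous_intros\<close>)
    then have "bounded ((\<lambda>r. V (of_real r * w \<tau>)) ` {r1..R})"
      by (intro compact_imp_bounded compact_continuous_image) auto
    then obtain M where "M > 0" "\<forall>y\<in>(\<lambda>r. V (of_real r * w \<tau>)) ` {r1..R}. norm y \<le> M"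
      unfolding bounded_pos by blast
    then show ?thesis by (intro exI[of _ M]) auto
  qed
  then obtain M where M: "\<And>\<tau>. \<bar>\<tau>\<bar> = 1 \<Longrightarrow> M \<tau> \<ge> 0"
    "\<And>\<tau> r. \<bar>\<tau>\<bar> = 1 \<Longrightarrow> r \<in> {r1..R} \<Longrightarrow> norm (V (of_real r * w \<tau>)) \<le> M \<tau>" by metis
  \<comment> \<open>For \<open>r \<le> R\<close> and \<alpha> < 1 one has
    \<open>R^(1-\<alpha>) r^(\<alpha>-1) \<ge> 1\<close>, so a constant bound on the middle range
    takes the form required of a ray bound.\<close>
  define A' where "A' = A + (M 1 + M (-1)) * R powr (1 - \<alpha>)"
  have MM: "M 1 + M (-1) \<ge> 0" using M(1)[of 1] M(1)[of "-1"] by simp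
  have AA: "A \<le> A'" using MM by (simp add: A'_def)
  have ray: "norm (V (of_real r * Complex (- \<kappa> / 2) \<tau>)) \<le> A' * r powr (\<alpha> - 1)" if r: "r > 0" and \<tau>: "\<bar>\<tau>\<bar> = 1" for r \<tau>
  proof -
    have n: "norm (of_real r * w \<tau>) = r * norm (w \<tau>)" using r by (simp add: norm_mult)
    have ge: "r \<le> r * norm (w \<tau>)" using w1[OF \<tau>] r by simp
    consider "r \<ge> R" | "r \<le> r1" | "r \<in> {r1..R}" by force
    then show ?thesis
    proof cases
      case 1
      have "norm (V (of_real r * w \<tau>)) \<le> A * (r * norm (w \<tau>)) powr (-1-\<alpha>)"
        using R(2)[OF D[OF r \<tau>]] n ge 1 by simp
      also have "\<dots> \<le> A * r powr (-1-\<alpha>)"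
        using ge r \<alpha> A by (intro mult_left_mono powr_mono2') auto
      also have "\<dots> \<le> A * r powr (\<alpha> - 1)"
        using 1 R(1) \<alpha> A by (intro mult_left_mono powr_mono) auto
      also have "\<dots> \<le> A' * r powr (\<alpha> - 1)" using AA by (intro mult_right_mono) auto
      finally show ?thesis by (simp add: w_def)
    next
      case 2
      have "norm (of_real r * w \<tau>) \<le> r0"
        unfolding n nw[OF \<tau>] using 2 pos_le_divide_eq[OF w10, of r r0] by (simp add: r1_def)
      then have "norm (V (of_real r * w \<tau>)) \<le> A * (r * norm (w \<tau>)) powr (\<alpha> - 1)"
        using r0(2)[OF D[OF r \<tau>]] n by simp
      also have "\<dots> \<le> A * r powr (\<alpha> - 1)"
        using ge r \<alpha> A by (intro mult_left_mono powr_mono2') auto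
      also have "\<dots> \<le> A' * r powr (\<alpha> - 1)" using AA by (intro mult_right_mono) auto
      finally show ?thesis by (simp add: w_def)
    next
      case 3
      have "norm (V (of_real r * w \<tau>)) \<le> M \<tau>" using M(2)[OF \<tau> 3] .
      also have "M \<tau> \<le> M 1 + M (-1)"
      proof -
        have "\<tau> = 1 \<or> \<tau> = -1" using \<tau> by linarith
        then show ?thesis using M(1)[of 1] M(1)[of "-1"] by auto
      qed
      also have "\<dots> \<le> (M 1 + M (-1)) * (R powr (1 - \<alpha>) * r powr (\<alpha> - 1))"
      proof -
        have "R powr (\<alpha> - 1) \<le> r powr (\<alpha> - 1)" using 3 r \<alpha> by (intro powr_mono2') auto
        then have "R powr (1 - \<alpha>) * R powr (\<alpha> - 1) \<le> R powr (1 - \<alpha>) * r powr (\<alpha> - 1)"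
          by (intro mult_left_mono) auto
        then have "1 \<le> R powr (1 - \<alpha>) * r powr (\<alpha> - 1)" using R(1) by (simp add: powr_add[symmetric])
        then show ?thesis using MM by (simp add: mult_le_cancel_left1)
      qed
      also have "\<dots> \<le> A' * r powr (\<alpha> - 1)" using A by (simp add: A'_def algebra_simps)
      finally show ?thesis by (simp add: w_def)
    qed
  qed
  show ?thesis
  proof (rule laplace_decay_of_ray_bound[OF cont v0 growth c lap \<alpha>(1) \<kappa> V])
    show "R > 0" using R(1) by simp
    show "norm (V s) \<le> A' * norm s powr (-1-\<alpha>)" if "s \<in> wide_sector \<kappa>" "R \<le> norm s" for s
      using R(2)[OF that] AA by (meson mult_right_mono order_trans powr_ge_zero)
    show "norm (V s) \<le> A' * norm s powr (\<alpha>-1)" if "s \<in> wide_sector \<kappa>" "norm s \<le> r0" for s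
      using r0(2)[OF that] AA by (meson mult_right_mono order_trans powr_ge_zero)
  qed (use r0(1) ray in auto)
qed

section \<open>The Mittag-Leffler function\<close>

text \<open>Euler's integral is at least its part over \<open>{T..T+1}\<close>. The free parameter
  \<open>T\<close> is tuned below to the radius on which the Mittag-Leffler series is
  estimated.\<close>

lemma inverse_Gamma_le:
  fixes x T :: real
  assumes "x \<ge> 1" "T > 0"
  shows "1 / Gamma x \<le> exp (T + 1) * T powr (1 - x)"
proof -
  have x: "x > 0" using assms by simp
  note h = has_bochner_integral_Gamma[OF x zero_less_one, unfolded has_bochner_integral_iff]
  have "(LINT t|lborel. indicator {T..T+1} t *\<^sub>R (T powr (x - 1) * exp (- (T + 1)))) \<le>
      (LINT t|lborel. indicator {0..} t *\<^sub>R (t powr (x - 1) * exp (- 1 * t)))"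
  proof (rule integral_mono')
    show "integrable lborel (\<lambda>t. indicator {0..} t *\<^sub>R (t powr (x - 1) * exp (- 1 * t)))"
      using h by simp
    show "indicator {T..T+1} t *\<^sub>R (T powr (x - 1) * exp (- (T + 1))) \<le>
        indicator {0..} t *\<^sub>R (t powr (x - 1) * exp (- 1 * t))" for t
    proof (cases "t \<in> {T..T+1}")
      case True
      have "T powr (x - 1) * exp (- (T + 1)) \<le> t powr (x - 1) * exp (- 1 * t)"
        using True assms by (intro mult_mono powr_mono2) auto
      then show ?thesis using True assms by simp
    qed (auto simp: indicator_def)
  qed (simp add: indicator_def)
  then have "T powr (x - 1) * exp (- (T + 1)) \<le> Gamma x"
    using h by (simp add: mult.commute)
  then have "1 / Gamma x \<le> 1 / (T powr (x - 1) * exp (- (T + 1)))"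
    using assms by (intro divide_left_mono) (auto simp: Gamma_real_pos x)
  also have "\<dots> = exp (T + 1) * T powr (1 - x)"
    unfolding exp_minus using assms by (simp add: powr_diff field_simps)
  finally show ?thesis .
qed

lemma mittag_leffler_term_le:
  assumes \<alpha>: "\<alpha> > 0" and r: "r > 0" "norm z \<le> r"
  shows "norm (z ^ k / complex_of_real (Gamma (\<alpha> * real k + 1))) \<le> exp ((2 * r) powr (1 / \<alpha>) + 1) * (1 / 2) ^ k"
proof -
  \<comment> \<open>With this \<open>T\<close> the Gamma bound contributes
    \<open>T^(-\<alpha> k) = (2 r)^(-k)\<close>, leaving a geometric series of ratio 1/2. The price
    \<open>exp (T + 1)\<close> has \<open>T\<close> linear in \<open>t\<close> once
    \<open>r = t^\<alpha>\<close>, so it is admissible as exponential growth for Laplace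
    transforms.\<close>
  define T where "T = (2 * r) powr (1 / \<alpha>)"
  have T: "T > 0" using r by (simp add: T_def)
  have x: "\<alpha> * real k + 1 \<ge> 1" using \<alpha> by simp
  have G: "Gamma (\<alpha> * real k + 1) > 0" using x by (intro Gamma_real_pos) simp
  have "T powr (1 - (\<alpha> * real k + 1)) = (1 / (2 * r)) ^ k"
    using \<alpha> r by (simp add: T_def powr_powr powr_minus powr_realpow power_one_over inverse_eq_divide)
  with inverse_Gamma_le[OF x T]
  have "1 / Gamma (\<alpha> * real k + 1) \<le> exp (T + 1) * (1 / (2 * r)) ^ k" by simp
  then have "norm z ^ k * (1 / Gamma (\<alpha> * real k + 1)) \<le> r ^ k * (exp (T + 1) * (1 / (2 * r)) ^ k)"
    using r G by (intro mult_mono power_mono) auto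
  also have "\<dots> = exp (T + 1) * (1 / 2) ^ k"
    using r by (simp add: power_divide power_mult_distrib)
  finally show ?thesis using G by (simp add: norm_divide norm_power T_def)
qed

lemma
  assumes \<alpha>: "\<alpha> > 0"
  shows summable_mittag_leffler: "summable (\<lambda>k. z ^ k / complex_of_real (Gamma (\<alpha> * real k + 1)))"
    and norm_mittag_leffler_le:
      "r > 0 \<Longrightarrow> norm z \<le> r \<Longrightarrow> norm (mittag_leffler \<alpha> z) \<le> 2 * exp ((2 * r) powr (1 / \<alpha>) + 1)"
proof -
  let ?t = "\<lambda>k. z ^ k / complex_of_real (Gamma (\<alpha> * real k + 1))"
  have sg: "summable (\<lambda>k. exp ((2 * r) powr (1 / \<alpha>) + 1) * (1 / 2) ^ k :: real)" for r
    by (intro summable_mult summable_geometric) auto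
  have n: "summable (\<lambda>k. norm (?t k))" if "r > 0" "norm z \<le> r" for r
    by (rule summable_comparison_test'[OF sg[of r], of 0]) (use mittag_leffler_term_le[OF \<alpha> that] in simp)
  have "summable (\<lambda>k. norm (?t k))"
    by (rule n[of "norm z + 1"]) (simp_all add: add_nonneg_pos)
  then show "summable ?t" by (rule summable_norm_cancel)
  show "norm (mittag_leffler \<alpha> z) \<le> 2 * exp ((2 * r) powr (1 / \<alpha>) + 1)" if "r > 0" "norm z \<le> r"
  proof -
    have "norm (mittag_leffler \<alpha> z) \<le> (\<Sum>k. norm (?t k))"
      unfolding mittag_leffler_def by (rule summable_norm[OF n[OF that]])
    also have "\<dots> \<le> (\<Sum>k. exp ((2 * r) powr (1 / \<alpha>) + 1) * (1 / 2) ^ k)"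
      using mittag_leffler_term_le[OF \<alpha> that] by (intro suminf_le n[OF that] sg) auto
    also have "\<dots> = 2 * exp ((2 * r) powr (1 / \<alpha>) + 1)"
      by (subst suminf_mult) (auto simp: suminf_geometric)
    finally show ?thesis .
  qed
qed

lemma mittag_leffler_0: "mittag_leffler \<alpha> 0 = 1"
  unfolding mittag_leffler_def
  by (subst suminf_finite[of "{0}"]) (auto simp: power_0_left)

lemma continuous_on_mittag_leffler:
  assumes "\<alpha> > 0"
  shows "continuous_on UNIV (mittag_leffler \<alpha>)"
proof -
  have "isCont (\<lambda>z. \<Sum>k. (1 / complex_of_real (Gamma (\<alpha> * real k + 1))) * z ^ k) z" for z
    by (rule isCont_powser_converges_everywhere) (use summable_mittag_leffler[OF assms] in simp)
  then show ?thesis unfolding mittag_leffler_def[abs_def]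
    by (intro continuous_at_imp_continuous_on) simp
qed

section \<open>The Laplace transform of the Mittag-Leffler function\<close>

text \<open>The integrals over \<open>{0..n}\<close> can be differentiated under the integral sign.
  On a ball of radius \<open>d\<close>, half the distance from its centre to the boundary line, the
  tails are dominated by those of \<open>B exp (- d t)\<close>, so the convergence is locally
  uniform.\<close>

lemma holomorphic_laplace:
  fixes v :: "real \<Rightarrow> complex"
  assumes cont: "continuous_on {0..} v"
    and growth: "\<And>t. t \<ge> 0 \<Longrightarrow> norm (v t) \<le> B * exp (c0 * t)"
  shows "(\<lambda>s. LINT t|lborel. indicator {0..} t *\<^sub>R (v t * exp (- s * of_real t))) holomorphic_on {s. Re s > c0}"
proof (rule holomorphic_uniform_sequence)
  have B: "B \<ge> 0" using order_trans[OF norm_ge_zero growth[of 0]] by simp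
  show "open {s. Re s > c0}" by (rule open_halfspace_Re_gt)
  define v0 where "v0 t = indicator {0..} t *\<^sub>R v t" for t
  have [measurable]: "v0 \<in> borel_measurable borel"
    unfolding v0_def[abs_def] using cont by (rule borel_measurable_continuous_on_indicator[rotated]) simp
  have meas: "(\<lambda>t. indicator {0..} t *\<^sub>R (v t * exp (- s * of_real t))) \<in> borel_measurable borel" for s
  proof -
    have "(\<lambda>t. indicator {0..} t *\<^sub>R (v t * exp (- s * of_real t))) =
      (\<lambda>t. v0 t * exp (- s * of_real t))" by (auto simp: v0_def)
    then show ?thesis by simp
  qed
  let ?L = "\<lambda>n s. integral (cbox 0 (real n)) (\<lambda>t. v t * exp (- s * of_real t))"
  have contn: "continuous_on {0..real n} v" for n using cont by (rule continuous_on_subset) auto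
  show "?L n holomorphic_on {s. Re s > c0}" for n
  proof (rule leibniz_rule_holomorphic)
    show "((\<lambda>s. v t * exp (- s * of_real t)) has_field_derivative v t * (exp (- s * of_real t) * (- of_real t)))
        (at s within {s. Re s > c0})" for s t
      by (auto intro!: derivative_eq_intros)
    show "(\<lambda>t. v t * exp (- s * of_real t)) integrable_on cbox 0 (real n)" for s
      using contn[of n] by (intro integrable_continuous continuous_intros) auto
    show "continuous_on ({s. Re s > c0} \<times> cbox 0 (real n)) (\<lambda>(s, t). v t * (exp (- s * of_real t) * - of_real t))"
      unfolding case_prod_unfold
      by (intro continuous_intros continuous_on_compose2[OF contn[of n]]) auto
    show "convex {s. Re s > c0}" by (rule convex_halfspace_Re_gt)
  qed
  fix x assume "x \<in> {s. Re s > c0}"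
  then have x: "Re x > c0" by simp
  define d where "d = (Re x - c0) / 2"
  have d: "d > 0" using x by (simp add: d_def)
  have Re: "Re s \<ge> c0 + d" if "s \<in> cball x d" for s
  proof -
    have "Re x - Re s \<le> d" using norm_ge_Im_Re(2)[of "x - s"] that by (simp add: dist_norm)
    moreover have "2 * d = Re x - c0" by (simp add: d_def)
    ultimately show ?thesis by linarith
  qed
  have bnd: "norm (v t * exp (- s * of_real t)) \<le> B * exp (- d * t)" if "s \<in> cball x d" "t \<ge> 0" for s t
  proof -
    have "- Re s * t \<le> - (c0 + d) * t"
      using Re[OF that(1)] that(2) by (intro mult_right_mono) auto
    then have "norm (v t) * exp (- Re s * t) \<le> (B * exp (c0 * t)) * exp (- (c0 + d) * t)"
      using growth[OF that(2)] B by (intro mult_mono) auto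
    also have "\<dots> = B * exp (- d * t)" by (simp add: mult.assoc mult_exp_exp algebra_simps)
    finally show ?thesis by (simp add: norm_mult)
  qed
  have "has_bochner_integral lborel (\<lambda>t. indicator {0..} t *\<^sub>R (t powr (1 - 1) * exp (- d * t))) (Gamma 1 / d powr 1)"
    using has_bochner_integral_Gamma[of 1 d] d by simp
  then have "integrable lborel (\<lambda>t. B * (indicator {0..} t *\<^sub>R (t powr (1 - 1) * exp (- d * t))))"
    by (auto simp: has_bochner_integral_iff)
  \<comment> \<open>At \<open>t = 0\<close> the power \<open>t powr 0\<close> has the value 0, not
    1, so the identity holds only almost everywhere.\<close>
  moreover have "AE t in lborel. B * (indicator {0..} t *\<^sub>R (t powr (1 - 1) * exp (- d * t))) = indicator {0..} t *\<^sub>R (B * exp (- d * t))"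
    using AE_lborel_singleton[of 0] by eventually_elim (auto simp: indicator_def)
  ultimately have dom: "integrable lborel (\<lambda>t. indicator {0..} t *\<^sub>R (B * exp (- d * t)))"
    by (subst (asm) integrable_cong_AE) auto
  have int: "integrable lborel (\<lambda>t. indicator {0..} t *\<^sub>R (v t * exp (- s * of_real t)))" if "s \<in> cball x d" for s
  proof (rule Bochner_Integration.integrable_bound[OF dom])
    show "(\<lambda>t. indicator {0..} t *\<^sub>R (v t * exp (- s * of_real t))) \<in> borel_measurable lborel"
      unfolding measurable_lborel2 by (rule meas)
    show "AE t in lborel. norm (indicator {0..} t *\<^sub>R (v t * exp (- s * of_real t)))
        \<le> norm (indicator {0..} t *\<^sub>R (B * exp (- d * t)))"
      using bnd[OF that] B by (auto simp: indicator_def)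
  qed
  define tail where "tail n = (LINT t|lborel. indicator {real n<..} t *\<^sub>R (B * exp (- d * t)))" for n
  have tail: "tail \<longlonglongrightarrow> 0"
  proof -
    have "tail \<longlonglongrightarrow> (LINT (t::real)|lborel. (0::real))" unfolding tail_def[abs_def]
    proof (rule integral_dominated_convergence[OF _ _ dom])
      show "AE t in lborel. (\<lambda>n. indicator {real n<..} t *\<^sub>R (B * exp (- d * t))) \<longlonglongrightarrow> 0"
      proof (rule AE_I2)
        fix t :: real
        have "eventually (\<lambda>n. real n \<ge> t) sequentially" by real_asymp
        then have "eventually (\<lambda>n. indicator {real n<..} t *\<^sub>R (B * exp (- d * t)) = 0) sequentially"
          by eventually_elim (auto simp: indicator_def)
        then show "(\<lambda>n. indicator {real n<..} t *\<^sub>R (B * exp (- d * t))) \<longlonglongrightarrow> 0"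
          by (rule tendsto_eventually)
      qed
    qed (use B in \<open>auto simp: indicator_def\<close>)
    then show ?thesis by simp
  qed
  have close: "dist (?L n s) (LINT t|lborel. indicator {0..} t *\<^sub>R (v t * exp (- s * of_real t))) \<le> tail n"
    if s: "s \<in> cball x d" for n s
  proof -
    have si: "set_integrable lborel {0..real n} (\<lambda>t. v t * exp (- s * of_real t))"
      using contn[of n] by (intro borel_integrable_atLeastAtMost' continuous_intros)
    have L: "?L n s = (LINT t|lborel. indicator {0..real n} t *\<^sub>R (v t * exp (- s * of_real t)))"
      using set_borel_integral_eq_integral(2)[OF si] by (simp add: set_lebesgue_integral_def)
    have si': "integrable lborel (\<lambda>t. indicator {0..real n} t *\<^sub>R (v t * exp (- s * of_real t)))"
      using si by (simp add: set_integrable_def)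
    have "(LINT t|lborel. indicator {0..} t *\<^sub>R (v t * exp (- s * of_real t))) - ?L n s =
      (LINT t|lborel. indicator {0..} t *\<^sub>R (v t * exp (- s * of_real t)) - indicator {0..real n} t *\<^sub>R (v t * exp (- s * of_real t)))"
      unfolding L by (rule Bochner_Integration.integral_diff[symmetric, OF int[OF s] si'])
    also have "(\<lambda>t. indicator {0..} t *\<^sub>R (v t * exp (- s * of_real t)) - indicator {0..real n} t *\<^sub>R (v t * exp (- s * of_real t))) =
      (\<lambda>t. indicator {real n<..} t *\<^sub>R (v t * exp (- s * of_real t)))"
      by (auto simp: indicator_def fun_eq_iff)
    also have "norm (LINT t|lborel. indicator {real n<..} t *\<^sub>R (v t * exp (- s * of_real t))) \<le>
        (LINT t|lborel. norm (indicator {real n<..} t *\<^sub>R (v t * exp (- s * of_real t))))"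
      by (rule integral_norm_bound)
    also have "\<dots> \<le> tail n" unfolding tail_def
    proof (rule integral_mono')
      show "integrable lborel (\<lambda>t. indicator {real n<..} t *\<^sub>R (B * exp (- d * t)))"
        by (rule Bochner_Integration.integrable_bound[OF dom]) (use B in \<open>auto simp: indicator_def\<close>)
    qed (use bnd[OF s] B in \<open>auto simp: indicator_def\<close>)
    finally show ?thesis by (simp add: dist_norm norm_minus_commute)
  qed
  have "uniform_limit (cball x d) ?L (\<lambda>s. LINT t|lborel. indicator {0..} t *\<^sub>R (v t * exp (- s * of_real t))) sequentially"
  proof (rule uniform_limitI)
    fix e :: real assume "e > 0"
    from order_tendstoD(2)[OF tail this]
    show "\<forall>\<^sub>F n in sequentially. \<forall>s\<in>cball x d. dist (?L n s) (LINT t|lborel. indicator {0..} t *\<^sub>R (v t * exp (- s * of_real t))) < e"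
    proof eventually_elim
      case (elim n)
      then show ?case using close by (blast intro: le_less_trans)
    qed
  qed
  moreover have "cball x d \<subseteq> {s. Re s > c0}" using Re d by fastforce
  ultimately show "\<exists>d>0. cball x d \<subseteq> {s. Re s > c0} \<and> uniform_limit (cball x d) ?L
     (\<lambda>s. LINT t|lborel. indicator {0..} t *\<^sub>R (v t * exp (- s * of_real t))) sequentially"
    using d by blast
qed

lemma exp_neg_le_powr:
  fixes t :: real
  assumes "0 < \<alpha>" "\<alpha> \<le> 1" "t > 0"
  shows "exp (- t) \<le> t powr (- \<alpha>)"
proof -
  have "t powr \<alpha> \<le> exp t"
  proof (cases "t \<le> 1")
    case True
    then have "t powr \<alpha> \<le> 1" using assms by (intro powr_le1) auto
    also have "1 \<le> exp t" using assms by simp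
    finally show ?thesis .
  next
    case False
    then have "t powr \<alpha> \<le> t powr 1" using assms by (intro powr_mono) auto
    also have "t powr 1 = t" using assms by simp
    also have "t \<le> exp t" using exp_ge_add_one_self[of t] by linarith
    finally show ?thesis .
  qed
  then show ?thesis using assms by (simp add: exp_minus powr_minus)
qed

text \<open>Integrated term by term, the series becomes the geometric series with terms
  \<open>\<omega>^k s^(-\<alpha> k - 1)\<close>, absolutely convergent for \<open>s > 1\<close>.
  Real \<open>s\<close> suffice, since the identity theorem later extends the formula to a half
  plane.\<close>

lemma laplace_mittag_leffler_real:
  fixes s :: real and \<omega> :: complex
  assumes \<alpha>: "0 < \<alpha>" and \<omega>: "norm \<omega> = 1" and s: "s > 1"
  shows "(LINT t|lborel. indicator {0..} t *\<^sub>R (mittag_leffler \<alpha> (\<omega> * of_real (t powr \<alpha>)) * exp (- of_real s * of_real t)))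
    = of_real (s powr (\<alpha> - 1)) / (of_real (s powr \<alpha>) - \<omega>)"
proof -
  define g where "g k t = indicator {0..} t *\<^sub>R (t powr (\<alpha> * real k + 1 - 1) * exp (- s * t))" for k and t :: real
  define c where "c k = \<omega> ^ k / complex_of_real (Gamma (\<alpha> * real k + 1))" for k
  define f where "f k t = c k * complex_of_real (g k t)" for k t
  have x: "\<alpha> * real k + 1 > 0" for k using \<alpha> by (simp add: add_nonneg_pos)
  have G: "Gamma (\<alpha> * real k + 1) > 0" for k using x by (rule Gamma_real_pos)
  have hg: "has_bochner_integral lborel (g k) (Gamma (\<alpha> * real k + 1) / s powr (\<alpha> * real k + 1))" for k
    unfolding g_def[abs_def] using s by (intro has_bochner_integral_Gamma x) simp
  have intf: "integrable lborel (f k)" for k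
    unfolding f_def[abs_def] using hg by (auto simp: has_bochner_integral_iff)
  have g0: "g k t \<ge> 0" for k t by (simp add: g_def indicator_def)
  have nc: "norm (c k) = 1 / Gamma (\<alpha> * real k + 1)" for k
    using G[of k] by (simp add: c_def norm_divide norm_power \<omega>)
  have nf: "(LINT t|lborel. norm (f k t)) = (1 / s powr \<alpha>) ^ k / s" for k
  proof -
    have "(LINT t|lborel. norm (f k t)) = norm (c k) * (LINT t|lborel. g k t)"
      using g0 by (simp add: f_def norm_mult)
    also have "\<dots> = 1 / s powr (\<alpha> * real k + 1)"
      unfolding nc has_bochner_integral_integral_eq[OF hg] using G[of k] by simp
    also have "\<dots> = (1 / s powr \<alpha>) ^ k / s"
      using s by (simp add: powr_add powr_powr[symmetric] powr_realpow power_one_over inverse_eq_divide)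
    finally show ?thesis .
  qed
  have sa: "s powr \<alpha> > 1" using s \<alpha> by simp
  then have sa1: "1 / s powr \<alpha> < 1" by (subst divide_less_eq_1_pos) auto
  \<comment> \<open>The point \<open>t = 0\<close> is excluded because \<open>0 powr 0\<close> is 0,
    so the term \<open>k = 0\<close> would lose its value 1 there.\<close>
  have eq: "indicator {0..} t *\<^sub>R (mittag_leffler \<alpha> (\<omega> * of_real (t powr \<alpha>)) * exp (- of_real s * of_real t)) = (\<Sum>k. f k t)"
    and summ: "summable (\<lambda>k. norm (f k t))" if "t \<noteq> 0" for t
  proof -
    show "summable (\<lambda>k. norm (f k t))"
    proof (cases "t > 0")
      case True
      have e: "norm (f k t) = norm ((\<omega> * of_real (t powr \<alpha>)) ^ k / complex_of_real (Gamma (\<alpha> * real k + 1))) * exp (- s * t)" for k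
        using True G[of k] by (simp add: f_def c_def g_def norm_mult norm_divide norm_power \<omega> powr_powr[symmetric] powr_realpow)
      have "summable (\<lambda>k. norm ((\<omega> * of_real (t powr \<alpha>)) ^ k / complex_of_real (Gamma (\<alpha> * real k + 1))))"
      proof (rule summable_comparison_test'[where N = 0])
        show "summable (\<lambda>k. exp ((2 * t powr \<alpha>) powr (1 / \<alpha>) + 1) * (1 / 2) ^ k :: real)"
          by (intro summable_mult summable_geometric) auto
        show "norm (norm ((\<omega> * of_real (t powr \<alpha>)) ^ k / complex_of_real (Gamma (\<alpha> * real k + 1)))) \<le>
            exp ((2 * t powr \<alpha>) powr (1 / \<alpha>) + 1) * (1 / 2) ^ k" for k
          using mittag_leffler_term_le[OF \<alpha>, of "t powr \<alpha>" "\<omega> * of_real (t powr \<alpha>)" k] True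
          by (simp add: norm_mult \<omega>)
      qed
      then show ?thesis unfolding e by (rule summable_mult2)
    qed (use that in \<open>simp add: f_def g_def\<close>)
    show "indicator {0..} t *\<^sub>R (mittag_leffler \<alpha> (\<omega> * of_real (t powr \<alpha>)) * exp (- of_real s * of_real t)) = (\<Sum>k. f k t)"
    proof (cases "t > 0")
      case True
      have "f k t = (\<omega> * of_real (t powr \<alpha>)) ^ k / of_real (Gamma (\<alpha> * real k + 1)) * exp (- of_real s * of_real t)" for k
        using True by (simp add: f_def c_def g_def powr_powr[symmetric] powr_realpow power_mult_distrib exp_of_real[symmetric] del: exp_of_real)
      then show ?thesis
        using True suminf_mult2[OF summable_mittag_leffler[OF \<alpha>], of "\<omega> * of_real (t powr \<alpha>)" "exp (- of_real s * of_real t)"]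
        by (simp add: mittag_leffler_def)
    qed (use that in \<open>simp add: f_def g_def\<close>)
  qed
  have "(LINT t|lborel. indicator {0..} t *\<^sub>R (mittag_leffler \<alpha> (\<omega> * of_real (t powr \<alpha>)) * exp (- of_real s * of_real t)))
     = (LINT t|lborel. (\<Sum>k. f k t))"
  proof (rule integral_cong_AE)
    have [measurable]: "mittag_leffler \<alpha> \<in> borel_measurable borel"
      by (rule borel_measurable_continuous_onI[OF continuous_on_mittag_leffler[OF \<alpha>]])
    show "(\<lambda>t. indicator {0..} t *\<^sub>R (mittag_leffler \<alpha> (\<omega> * of_real (t powr \<alpha>)) * exp (- of_real s * of_real t))) \<in> borel_measurable lborel"
      by measurable
    show "(\<lambda>t. \<Sum>k. f k t) \<in> borel_measurable lborel"
      using intf by (intro borel_measurable_suminf) auto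
    show "AE t in lborel. indicator {0..} t *\<^sub>R (mittag_leffler \<alpha> (\<omega> * of_real (t powr \<alpha>)) * exp (- of_real s * of_real t)) = (\<Sum>k. f k t)"
      using AE_lborel_singleton[of 0] by eventually_elim (rule eq)
  qed
  also have "\<dots> = (\<Sum>k. integral\<^sup>L lborel (f k))"
  proof (rule integral_suminf[OF intf])
    show "AE t in lborel. summable (\<lambda>k. norm (f k t))"
      using AE_lborel_singleton[of 0] by eventually_elim (rule summ)
    show "summable (\<lambda>k. LINT t|lborel. norm (f k t))"
      unfolding nf using sa1 by (intro summable_divide summable_geometric) simp
  qed
  also have "(\<lambda>k. integral\<^sup>L lborel (f k)) = (\<lambda>k. (\<omega> / of_real (s powr \<alpha>)) ^ k / of_real s)"
  proof
    fix k
    have "integral\<^sup>L lborel (f k) = c k * of_real (Gamma (\<alpha> * real k + 1) / s powr (\<alpha> * real k + 1))"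
      unfolding f_def[abs_def] using has_bochner_integral_integral_eq[OF hg[of k]] by simp
    also have "\<dots> = \<omega> ^ k / of_real (s powr (\<alpha> * real k + 1))"
      using G[of k] by (simp add: c_def)
    also have "s powr (\<alpha> * real k + 1) = (s powr \<alpha>) ^ k * s"
      using s by (simp add: powr_add powr_powr[symmetric] powr_realpow)
    finally show "integral\<^sup>L lborel (f k) = (\<omega> / of_real (s powr \<alpha>)) ^ k / of_real s"
      by (simp add: power_divide)
  qed
  also have "(\<Sum>k. (\<omega> / of_real (s powr \<alpha>)) ^ k / of_real s) = 1 / (1 - \<omega> / of_real (s powr \<alpha>)) / of_real s"
  proof -
    have "norm (\<omega> / complex_of_real (s powr \<alpha>)) < 1" using sa1 by (simp add: norm_divide \<omega>)
    then show ?thesis by (subst suminf_divide) (auto intro: summable_geometric simp: suminf_geometric)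
  qed
  also have "\<dots> = of_real (s powr (\<alpha> - 1)) / (of_real (s powr \<alpha>) - \<omega>)"
  proof -
    have "of_real (s powr \<alpha>) - \<omega> \<noteq> 0"
    proof
      assume "of_real (s powr \<alpha>) - \<omega> = 0"
      then have "norm \<omega> = norm (complex_of_real (s powr \<alpha>))" by simp
      then show False using sa by (simp add: \<omega>)
    qed
    moreover have "complex_of_real (s powr (\<alpha> - 1)) = of_real (s powr \<alpha>) / of_real s"
      using s by (simp add: powr_diff)
    ultimately show ?thesis using s sa by (simp add: divide_simps)
  qed
  finally show ?thesis .
qed

text \<open>The weights \<open>a\<close> and \<open>1 - a\<close> of the two exponentials make the difference vanish at \<open>t = 0\<close>, so
  that its transform is integrable on vertical lines.\<close>

lemma mittag_leffler_decay:
  fixes \<omega> a :: complex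
  assumes \<alpha>: "0 < \<alpha>" "\<alpha> < 1" and \<omega>: "norm \<omega> = 1" and \<kappa>: "\<kappa> > 0"
    and pole: "\<And>s::complex. s \<in> wide_sector \<kappa> - {- \<i>} \<Longrightarrow> s powr \<alpha> \<noteq> \<omega>"
    and lim: "((\<lambda>s::complex. s powr (\<alpha> - 1) / (s powr \<alpha> - \<omega>) - a / (s + \<i>)) \<longlongrightarrow> l) (at (- \<i>))"
  shows "\<exists>C. \<forall>t>0. norm (mittag_leffler \<alpha> (\<omega> * of_real (t powr \<alpha>)) - a * exp (- \<i> * of_real t)
      - (1 - a) * exp (- of_real t)) \<le> C * t powr (- \<alpha>)"
proof -
  define u where "u t = mittag_leffler \<alpha> (\<omega> * of_real (t powr \<alpha>))" for t
  define v where "v t = u t - a * exp (- \<i> * of_real t) - (1 - a) * exp (- of_real t)" for t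
  define Q where "Q s = s powr (\<alpha> - 1) / (s powr \<alpha> - \<omega>) - a / (s + \<i>)" for s :: complex
  \<comment> \<open>At \<open>- i\<close> the value is the limit \<open>l\<close>, any pole there
    being cancelled by \<open>a / (s + i)\<close>. The pole at -1 of the last term lies outside the
    sector.\<close>
  define V where "V s = (if s = - \<i> then l else Q s) - (1 - a) / (s + 1)" for s
  define c0 where "c0 = 2 powr (1 / \<alpha>)"
  have c0: "c0 > 1" unfolding c0_def using \<alpha> powr_less_mono[of 0 "1 / \<alpha>" 2] by simp
  define B where "B = 2 * exp 1 + norm a + norm (1 - a)"
  have contu: "continuous_on {0..} u"
  proof -
    have "continuous_on {0..} (\<lambda>t::real. t powr \<alpha>)"
      using \<alpha> by (intro continuous_on_powr' continuous_on_id continuous_on_const) auto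
    then have "continuous_on {0..} (\<lambda>t::real. \<omega> * complex_of_real (t powr \<alpha>))"
      by (intro continuous_on_mult continuous_on_const continuous_on_of_real)
    from continuous_on_compose2[OF continuous_on_mittag_leffler[OF \<alpha>(1)] this]
    show ?thesis unfolding u_def[abs_def] by simp
  qed
  have ug: "norm (u t) \<le> (2 * exp 1) * exp (c0 * t)" if "t \<ge> 0" for t
  proof (cases "t = 0")
    case True
    have "(1::real) \<le> 2 * exp 1" using exp_ge_add_one_self[of "1::real"] by linarith
    then show ?thesis using True by (simp add: u_def mittag_leffler_0)
  next
    case False
    then have t: "t > 0" using that by simp
    have "norm (u t) \<le> 2 * exp ((2 * t powr \<alpha>) powr (1 / \<alpha>) + 1)"
      unfolding u_def using t by (intro norm_mittag_leffler_le \<alpha>(1)) (auto simp: norm_mult \<omega>)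
    also have "(2 * t powr \<alpha>) powr (1 / \<alpha>) = c0 * t"
      using t \<alpha> by (simp add: c0_def powr_mult powr_powr)
    finally show ?thesis by (simp add: exp_add mult_ac)
  qed
  have contv: "continuous_on {0..} v" unfolding v_def[abs_def] by (intro continuous_intros contu)
  have v0: "v 0 = 0" by (simp add: v_def u_def mittag_leffler_0)
  have growth: "norm (v t) \<le> B * exp (c0 * t)" if "t \<ge> 0" for t
  proof -
    have 1: "1 \<le> exp (c0 * t)" using that c0 by simp
    have "norm (v t) \<le> norm (u t) + norm (a * exp (- \<i> * of_real t)) + norm ((1 - a) * exp (- of_real t))"
      unfolding v_def by (intro order_trans[OF norm_triangle_ineq4] add_right_mono norm_triangle_ineq4)
    also have "\<dots> \<le> (2 * exp 1) * exp (c0 * t) + norm a * exp (c0 * t) + norm (1 - a) * exp (c0 * t)"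
    proof (intro add_mono ug that)
      show "norm (a * exp (- \<i> * of_real t)) \<le> norm a * exp (c0 * t)"
        using mult_left_mono[OF 1, of "norm a"] by (simp add: norm_mult)
      have "exp (- t) \<le> 1" using that by simp
      then have "exp (- t) \<le> exp (c0 * t)" using 1 by linarith
      from mult_left_mono[OF this, of "norm (1 - a)"]
      show "norm ((1 - a) * exp (- of_real t)) \<le> norm (1 - a) * exp (c0 * t)" by (simp add: norm_mult)
    qed
    also have "\<dots> = B * exp (c0 * t)" by (simp add: B_def algebra_simps)
    finally show ?thesis .
  qed
  define U where "U = {s. Re s > c0}"
  have slit: "s \<notin> \<real>\<^sub>\<le>\<^sub>0" if "s \<in> U \<or> s \<in> wide_sector \<kappa>" for s
    using that c0 by (auto simp: U_def wide_sector_def elim!: nonpos_Reals_cases)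
  have poleU: "s powr \<alpha> \<noteq> \<omega>" "s \<noteq> - \<i>" "s \<noteq> -1" if "s \<in> U" for s :: complex
  proof -
    have "norm s > 1" using that c0 complex_Re_le_cmod[of s] by (simp add: U_def)
    then have "norm (s powr complex_of_real \<alpha>) > 1"
      using \<alpha> by (simp add: norm_powr_real_powr')
    then show "s powr \<alpha> \<noteq> \<omega>" using \<omega> by auto
    show "s \<noteq> - \<i>" "s \<noteq> -1" using that c0 by (auto simp: U_def)
  qed
  have s1: "s + 1 \<noteq> 0" if "s \<in> wide_sector \<kappa>" for s
  proof
    assume "s + 1 = 0"
    then have "s = -1" by (simp add: eq_neg_iff_add_eq_0)
    then show False using that by (simp add: wide_sector_def)
  qed
  define LV where "LV s = (LINT t|lborel. indicator {0..} t *\<^sub>R (v t * exp (- s * of_real t)))" for s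
  have realV: "LV (of_real s) = V (of_real s)" if s: "s > c0" for s
  proof -
    have s1: "s > 1" using s c0 by simp
    let ?i = "\<lambda>t g. indicator {0..} t *\<^sub>R (g * exp (- complex_of_real s * of_real t))"
    \<comment> \<open>A function that is not integrable has integral 0 by convention; the value
      computed for this transform is nonzero, hence integrability.\<close>
    have iu: "integrable lborel (\<lambda>t. ?i t (u t))"
    proof (rule ccontr)
      assume "\<not> integrable lborel (\<lambda>t. ?i t (u t))"
      then have "(LINT t|lborel. ?i t (u t)) = 0" by (rule not_integrable_integral_eq)
      then have "of_real (s powr (\<alpha> - 1)) / (of_real (s powr \<alpha>) - \<omega>) = 0"
        using laplace_mittag_leffler_real[OF \<alpha>(1) \<omega> s1] by (simp add: u_def)
      moreover have "of_real s \<in> U" using s by (simp add: U_def)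
      from poleU(1)[OF this] have "of_real (s powr \<alpha>) \<noteq> \<omega>" using s1 by (simp add: powr_of_real)
      ultimately show False using s1 by simp
    qed
    have e1: "has_bochner_integral lborel (\<lambda>t. ?i t (exp (- \<i> * of_real t))) (1 / (of_real s + \<i>))"
    proof -
      have "exp (- (of_real s + \<i>) * of_real t) = exp (- \<i> * of_real t) * exp (- complex_of_real s * of_real t)" for t
        unfolding mult_exp_exp by (simp add: algebra_simps)
      then show ?thesis using has_bochner_integral_exp_half_line[of "of_real s + \<i>"] s1 by simp
    qed
    have e2: "has_bochner_integral lborel (\<lambda>t. ?i t (exp (- of_real t))) (1 / (of_real s + 1))"
    proof -
      have "exp (- (of_real s + 1) * of_real t) = exp (- of_real t) * exp (- complex_of_real s * of_real t)" for t
        unfolding mult_exp_exp by (simp add: algebra_simps)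
      then show ?thesis using has_bochner_integral_exp_half_line[of "of_real s + 1"] s1 by simp
    qed
    have "has_bochner_integral lborel (\<lambda>t. ?i t (u t)) (of_real (s powr (\<alpha> - 1)) / (of_real (s powr \<alpha>) - \<omega>))"
      using iu laplace_mittag_leffler_real[OF \<alpha>(1) \<omega> s1] by (simp add: has_bochner_integral_iff u_def)
    from has_bochner_integral_diff[OF has_bochner_integral_diff[OF this has_bochner_integral_mult_right[OF e1, of a]]
        has_bochner_integral_mult_right[OF e2, of "1 - a"]]
    have "has_bochner_integral lborel (\<lambda>t. ?i t (u t) - a * ?i t (exp (- \<i> * of_real t)) - (1 - a) * ?i t (exp (- of_real t)))
       (of_real (s powr (\<alpha> - 1)) / (of_real (s powr \<alpha>) - \<omega>) - a * (1 / (of_real s + \<i>)) - (1 - a) * (1 / (of_real s + 1)))"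
      by simp
    moreover have "?i t (u t) - a * ?i t (exp (- \<i> * of_real t)) - (1 - a) * ?i t (exp (- of_real t)) = ?i t (v t)" for t
      by (simp add: v_def indicator_def algebra_simps)
    ultimately have "LV (of_real s) = of_real (s powr (\<alpha> - 1)) / (of_real (s powr \<alpha>) - \<omega>) - a * (1 / (of_real s + \<i>)) - (1 - a) * (1 / (of_real s + 1))"
      unfolding LV_def by (simp only: has_bochner_integral_integral_eq)
    moreover have "complex_of_real s \<noteq> - \<i>" by (auto simp: complex_eq_iff)
    ultimately show ?thesis using s1 by (simp add: V_def Q_def powr_of_real flip: of_real_diff)
  qed
  have derQ: "Q field_differentiable at s" if "s \<notin> \<real>\<^sub>\<le>\<^sub>0" "s powr \<alpha> \<noteq> \<omega>" "s \<noteq> - \<i>" for s :: complex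
  proof -
    have "(\<lambda>s. s powr \<beta>) field_differentiable at s" for \<beta> :: complex
      using has_field_derivative_powr[OF that(1)] field_differentiable_def by blast
    then show ?thesis
      unfolding Q_def[abs_def] using that
      by (intro field_differentiable_diff field_differentiable_divide field_differentiable_add
          field_differentiable_const field_differentiable_ident)
         (auto simp: eq_neg_iff_add_eq_0)
  qed
  have derV: "V field_differentiable at s" if "s \<notin> \<real>\<^sub>\<le>\<^sub>0" "s powr \<alpha> \<noteq> \<omega>" "s \<noteq> - \<i>" "s + 1 \<noteq> 0" for s :: complex
  proof -
    have "(\<lambda>s. Q s - (1 - a) / (s + 1)) field_differentiable at s"
      using that by (intro field_differentiable_diff field_differentiable_divide field_differentiable_add
          field_differentiable_const field_differentiable_ident derQ)
    then obtain D where "((\<lambda>s. Q s - (1 - a) / (s + 1)) has_field_derivative D) (at s)"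
      unfolding field_differentiable_def by blast
    then have "(V has_field_derivative D) (at s)"
      by (rule has_field_derivative_transform_within_open[where S = "- {- \<i>}"])
         (use that in \<open>auto simp: V_def\<close>)
    then show ?thesis unfolding field_differentiable_def by blast
  qed
  have LV: "LV s = V s" if s: "Re s > c0" for s
  proof -
    have hLV: "LV holomorphic_on U"
      unfolding LV_def[abs_def] U_def by (rule holomorphic_laplace[OF contv growth])
    have hV: "V holomorphic_on U"
      unfolding holomorphic_on_def
    proof
      fix s assume s: "s \<in> U"
      have "s + 1 \<noteq> 0" using poleU(3)[OF s] eq_neg_iff_add_eq_0[of s 1] by simp
      then show "V field_differentiable at s within U"
        using s by (auto intro: field_differentiable_at_within[OF derV[OF slit poleU(1)[OF s] poleU(2)[OF s]]])
    qed
    \<comment> \<open>Both sides are holomorphic on the half plane \<open>U\<close> and agree on a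
      real half line, which has a limit point in \<open>U\<close>.\<close>
    have "LV s - V s = 0"
    proof (rule analytic_continuation[where f = "\<lambda>s. LV s - V s" and S = U and U = "of_real ` {c0<..}" and \<xi> = "of_real (c0 + 1)"])
      show "(\<lambda>s. LV s - V s) holomorphic_on U" using hLV hV by (rule holomorphic_on_diff)
      show "open U" unfolding U_def by (rule open_halfspace_Re_gt)
      show "connected U" unfolding U_def by (intro convex_connected convex_halfspace_Re_gt)
      show "of_real (c0 + 1) islimpt complex_of_real ` {c0<..}"
      proof -
        have "c0 + 1 islimpt {c0<..}"
          by (rule interior_limit_point) (simp add: interior_open)
        then show ?thesis
          by (intro islimpt_isCont_image) (auto simp: eventually_at_filter simp del: of_real_add)
      qed
    qed (use s realV in \<open>auto simp: U_def\<close>)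
    then show ?thesis by simp
  qed
  \<comment> \<open>\<open>A\<close> has one summand for each of the three fractions in
    \<open>V\<close>. For \<open>norm s \<ge> R\<close> every denominator factor is at least half of
    \<open>|s|^\<alpha>\<close> or \<open>|s|\<close>; for \<open>norm s \<le> r0\<close> both
    \<open>|s|^\<alpha>\<close> and \<open>|s|\<close> are at most 1/2, so every denominator is at
    least 1/2.\<close>
  define A where "A = 2 + 2 * norm a + 2 * norm (1 - a)"
  define R where "R = max 2 (2 powr (1 / \<alpha>))"
  define r0 where "r0 = (1 / 2) powr (1 / \<alpha>)"
  have np: "norm (s powr complex_of_real b) = norm s powr b" for s :: complex and b :: real
    by (simp add: norm_powr_real_powr')
  have "\<exists>C. \<forall>t>0. norm (v t) \<le> C * t powr (- \<alpha>)"
  proof (rule laplace_decay[OF contv v0 growth, of "c0 + 1"])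
    show "(LINT t|lborel. indicator {0..} t *\<^sub>R (v t * exp (- Complex (c0 + 1) y * of_real t))) = V (Complex (c0 + 1) y)" for y
      using LV[of "Complex (c0 + 1) y"] by (simp add: LV_def)
    show "continuous_on (wide_sector \<kappa>) V"
    proof (rule continuous_at_imp_continuous_on, rule ballI)
      fix s assume s: "s \<in> wide_sector \<kappa>"
      show "isCont V s"
      proof (cases "s = - \<i>")
        case False
        then show ?thesis
          using derV[of s] slit[of s] pole[of s] s1[OF s] s by (auto intro: field_differentiable_imp_continuous_at)
      next
        case True
        have "((\<lambda>s. Q s - (1 - a) / (s + 1)) \<longlongrightarrow> l - (1 - a) / (- \<i> + 1)) (at (- \<i>))"
          unfolding Q_def using lim by (intro tendsto_intros) (auto simp: complex_eq_iff)
        moreover have "eventually (\<lambda>s. Q s - (1 - a) / (s + 1) = V s) (at (- \<i>))"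
          by (auto simp: eventually_at_filter V_def)
        ultimately have "(V \<longlongrightarrow> V (- \<i>)) (at (- \<i>))"
          unfolding V_def[of "- \<i>"] by (simp add: Lim_transform_eventually)
        then show ?thesis using True by (simp add: isCont_def)
      qed
    qed
    show "finite {- \<i>}" by simp
    show "V field_differentiable at s" if "s \<in> wide_sector \<kappa> - {- \<i>}" for s :: complex
      using derV[of s] slit[of s] pole[of s] s1[of s] that by auto
    show "R \<ge> 1" by (simp add: R_def)
    show "norm (V s) \<le> A * norm s powr (-1-\<alpha>)" if s: "s \<in> wide_sector \<kappa>" "R \<le> norm s" for s :: complex
    proof -
      have n2: "norm s \<ge> 2" using s by (simp add: R_def)
      have "norm s \<ge> 2 powr (1 / \<alpha>)" using s by (simp add: R_def)
      then have "(2 powr (1 / \<alpha>)) powr \<alpha> \<le> norm s powr \<alpha>" using \<alpha> by (intro powr_mono2) auto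
      then have sa2: "2 \<le> norm s powr \<alpha>" using \<alpha> by (simp add: powr_powr)
      have ni: "s \<noteq> - \<i>" using n2 by auto
      have s0: "s \<noteq> 0" using n2 by auto
      have den: "norm s powr \<alpha> / 2 \<le> norm (s powr \<alpha> - \<omega>)"
        using norm_triangle_ineq2[of "s powr \<alpha>" \<omega>] sa2 by (simp add: np \<omega>)
      then have d0: "s powr \<alpha> - \<omega> \<noteq> 0" using sa2 by auto
      have hp: "norm s / 2 \<le> norm (s + p)" if "norm p = 1" for p
        using norm_triangle_ineq2[of s "- p"] that n2 by simp
      have hi: "s + \<i> \<noteq> 0" "s + 1 \<noteq> 0" using hp[of \<i>] hp[of 1] n2 by auto
      \<comment> \<open>Each fraction is \<open>1 / s\<close> times its weight plus a smaller
        remainder. The leading terms cancel because the weights satisfy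
        \<open>1 = a + (1 - a)\<close>, the counterpart of \<open>v 0 = 0\<close>; what remains is
        \<open>O(|s|^(-1-\<alpha>))\<close>.\<close>
      have split: "V s = \<omega> / (s * (s powr \<alpha> - \<omega>)) + a * \<i> / (s * (s + \<i>)) + (1 - a) / (s * (s + 1))"
      proof -
        have "s powr (\<alpha> - 1) = s powr \<alpha> / s" using s0 by (simp add: powr_diff)
        then have "s powr (\<alpha> - 1) / (s powr \<alpha> - \<omega>) = 1 / s + \<omega> / (s * (s powr \<alpha> - \<omega>))"
          using s0 d0 by (simp add: divide_simps; simp add: algebra_simps)
        moreover have "a / (s + \<i>) = a / s - a * \<i> / (s * (s + \<i>))"
          using s0 hi by (simp add: divide_simps; simp add: algebra_simps)
        moreover have "(1 - a) / (s + 1) = (1 - a) / s - (1 - a) / (s * (s + 1))"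
          using s0 hi by (simp add: divide_simps; simp add: algebra_simps)
        moreover have "1 / s = a / s + (1 - a) / s" by (simp add: add_divide_distrib[symmetric])
        ultimately show ?thesis using ni by (simp add: V_def Q_def)
      qed
      have p1: "norm (\<omega> / (s * (s powr \<alpha> - \<omega>))) \<le> 2 * norm s powr (-1-\<alpha>)"
      proof -
        have "norm (\<omega> / (s * (s powr \<alpha> - \<omega>))) = 1 / (norm s * norm (s powr \<alpha> - \<omega>))"
          by (simp add: norm_divide norm_mult \<omega>)
        also have "\<dots> \<le> 1 / (norm s * (norm s powr \<alpha> / 2))"
          using den sa2 n2 by (intro divide_left_mono mult_left_mono mult_pos_pos) auto
        also have "\<dots> = 2 * norm s powr (-1-\<alpha>)"
          using n2 by (simp add: powr_diff powr_minus field_simps)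
        finally show ?thesis .
      qed
      have p2: "norm (b / (s * (s + p))) \<le> 2 * norm b * norm s powr (-1-\<alpha>)" if p: "norm p = 1" for b p
      proof -
        have "norm (b / (s * (s + p))) = norm b * (1 / (norm s * norm (s + p)))"
          by (simp add: norm_divide norm_mult)
        also have "\<dots> \<le> norm b * (1 / (norm s * (norm s / 2)))"
          using hp[OF p] n2 by (intro divide_left_mono mult_left_mono mult_pos_pos) auto
        also have "1 / (norm s * (norm s / 2)) = 2 * norm s powr (-2)"
          using n2 by (simp add: powr_minus powr_numeral power2_eq_square field_simps)
        also have "norm s powr (-2) \<le> norm s powr (-1-\<alpha>)" using n2 \<alpha> by (intro powr_mono) auto
        finally show ?thesis by (simp add: mult_left_mono mult.assoc)
      qed
      have "norm (V s) \<le> 2 * norm s powr (-1-\<alpha>) + 2 * norm (a * \<i>) * norm s powr (-1-\<alpha>) + 2 * norm (1 - a) * norm s powr (-1-\<alpha>)"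
        unfolding split by (intro norm_triangle_mono p1 p2) auto
      then show ?thesis by (simp add: A_def algebra_simps norm_mult)
    qed
    show "r0 > 0" by (simp add: r0_def)
    show "norm (V s) \<le> A * norm s powr (\<alpha> - 1)" if s: "s \<in> wide_sector \<kappa>" "norm s \<le> r0" for s :: complex
    proof -
      have "norm s powr \<alpha> \<le> r0 powr \<alpha>" using s \<alpha> by (intro powr_mono2) auto
      then have sa: "norm s powr \<alpha> \<le> 1 / 2" using \<alpha> by (simp add: r0_def powr_powr)
      have "r0 \<le> (1 / 2) powr 1" unfolding r0_def using \<alpha> by (intro powr_mono') (auto simp: divide_simps)
      then have n: "norm s \<le> 1 / 2" using s by simp
      have s0: "norm s > 0" using s(1) by (auto simp: wide_sector_def)
      have one: "1 \<le> norm s powr (\<alpha> - 1)"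
      proof -
        have "1 powr (\<alpha> - 1) \<le> norm s powr (\<alpha> - 1)" using s0 n \<alpha> by (intro powr_mono2') auto
        then show ?thesis by simp
      qed
      have ni: "s \<noteq> - \<i>" using n by auto
      have den: "1 / 2 \<le> norm (s powr \<alpha> - \<omega>)"
        using norm_triangle_ineq2[of \<omega> "s powr \<alpha>"] sa by (simp add: np \<omega> norm_minus_commute)
      have p1: "norm (s powr (\<alpha> - 1) / (s powr \<alpha> - \<omega>)) \<le> 2 * norm s powr (\<alpha> - 1)"
      proof -
        have "norm (s powr (\<alpha> - 1) / (s powr \<alpha> - \<omega>)) = norm s powr (\<alpha> - 1) / norm (s powr \<alpha> - \<omega>)"
          using np[of s "\<alpha> - 1"] by (simp add: norm_divide)
        also have "\<dots> \<le> norm s powr (\<alpha> - 1) / (1 / 2)" using den by (intro divide_left_mono) auto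
        finally show ?thesis by simp
      qed
      have p2: "norm (b / (s + p)) \<le> 2 * norm b * norm s powr (\<alpha> - 1)" if p: "norm p = 1" for b p
      proof -
        have "1 / 2 \<le> norm (s + p)" using norm_triangle_ineq2[of p "- s"] p n by (simp add: add.commute)
        then have "norm (b / (s + p)) \<le> norm b / (1 / 2)"
          unfolding norm_divide by (intro divide_left_mono) auto
        also have "\<dots> \<le> 2 * norm b * norm s powr (\<alpha> - 1)"
          using mult_left_mono[OF one, of "2 * norm b"] by simp
        finally show ?thesis .
      qed
      have "V s = s powr (\<alpha> - 1) / (s powr \<alpha> - \<omega>) - a / (s + \<i>) - (1 - a) / (s + 1)"
        using ni by (simp add: V_def Q_def)
      also have "norm \<dots> \<le> 2 * norm s powr (\<alpha> - 1) + 2 * norm a * norm s powr (\<alpha> - 1) + 2 * norm (1 - a) * norm s powr (\<alpha> - 1)"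
        by (rule order_trans[OF norm_triangle_ineq4]; intro add_mono p2 order_trans[OF norm_triangle_ineq4] p1) auto
      finally show ?thesis by (simp add: A_def algebra_simps)
    qed
    show "A \<ge> 0" by (simp add: A_def)
  qed (use \<alpha> \<kappa> c0 in auto)
  then show ?thesis by (simp add: v_def u_def)
qed

section \<open>Location of the poles and bounds on the rays\<close>

text \<open>Comparing moduli gives \<open>|s| = 1\<close>; comparing arguments gives
  \<open>\<alpha> Arg s = - pi \<gamma> / 2 + 2 pi n\<close>. The left side is at most
  \<open>pi\<close> in absolute value and \<open>pi \<gamma> / 2\<close> is at most
  \<open>pi / 2\<close>, so \<open>n = 0\<close>. The second conclusion records that a root exists
  on the principal branch only for a small enough angle.\<close>

lemma powr_eq_ipow:
  fixes s :: complex
  assumes \<alpha>: "0 < \<alpha>" "\<alpha> < 1" and \<gamma>: "0 \<le> \<gamma>" "\<gamma> \<le> 1" and s: "s \<noteq> 0" "s powr \<alpha> = ipow (- \<gamma>)"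
  shows "s = cis (- (pi * \<gamma> / (2 * \<alpha>)))" "pi * \<gamma> / (2 * \<alpha>) \<le> pi"
proof -
  have "norm s powr \<alpha> = norm (s powr complex_of_real \<alpha>)" using norm_powr_real_powr'[of "of_real \<alpha>" s] by simp
  also have "\<dots> = 1" unfolding s(2) ipow_def by simp
  finally have "(norm s powr \<alpha>) powr (1 / \<alpha>) = 1" by simp
  then have n: "norm s = 1" using \<alpha> by (simp add: powr_powr)
  have Ln: "Ln s = \<i> * of_real (Arg s)"
    using s(1) n by (intro complex_eqI) (simp_all add: Arg_def)
  have "exp (\<i> * of_real (\<alpha> * Arg s)) = exp (\<i> * of_real (- (pi * \<gamma> / 2)))"
    using s by (simp add: powr_def Ln ipow_def mult_ac)
  then obtain n :: int where "\<i> * of_real (\<alpha> * Arg s) = \<i> * of_real (- (pi * \<gamma> / 2)) + complex_of_real (of_int (2 * n) * pi) * \<i>"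
    unfolding exp_eq by blast
  from arg_cong[OF this, of Im] have eq: "\<alpha> * Arg s = - (pi * \<gamma> / 2) + 2 * of_int n * pi"
    by simp
  have A: "- pi < Arg s" "Arg s \<le> pi" using Arg_bounded[of s] by auto
  have "\<bar>Arg s\<bar> \<le> pi" using A by linarith
  then have "\<alpha> * \<bar>Arg s\<bar> \<le> 1 * pi" using \<alpha> by (intro mult_mono) auto
  then have b1: "\<bar>\<alpha> * Arg s\<bar> \<le> pi" using \<alpha> by (simp add: abs_mult)
  have b2: "0 \<le> pi * \<gamma> / 2" "pi * \<gamma> / 2 \<le> pi / 2" using \<gamma> by auto
  have "n = 0"
  proof (rule ccontr)
    assume "n \<noteq> 0"
    then have "1 \<le> \<bar>real_of_int n\<bar>" by linarith
    then have "2 * pi * 1 \<le> 2 * pi * \<bar>real_of_int n\<bar>" by (intro mult_left_mono) auto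
    also have "\<dots> = \<bar>2 * of_int n * pi\<bar>" by (simp add: abs_mult)
    also have "\<dots> \<le> pi + pi / 2" using b1 b2 unfolding eq by linarith
    finally show False using pi_gt_zero by linarith
  qed
  then have "\<alpha> * Arg s = - (pi * \<gamma> / 2)" using eq by simp
  then have Arg: "Arg s = - (pi * \<gamma> / (2 * \<alpha>))" using \<alpha> by (simp add: field_simps)
  then show "pi * \<gamma> / (2 * \<alpha>) \<le> pi" using A by linarith
  have "cis (Arg s) = s" using cis_Arg[OF s(1)] n by (simp add: sgn_div_norm)
  then show "s = cis (- (pi * \<gamma> / (2 * \<alpha>)))" using Arg by simp
qed

lemma norm_ipow: "norm (ipow a) = 1"
  by (simp add: ipow_def)

text \<open>With \<open>t = \<rho>^(1/\<alpha>)\<close> the rate \<open>t^(-\<alpha>)\<close> is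
  \<open>1 / \<rho>\<close>, and the auxiliary \<open>exp (- t)\<close> is of that size as well. For
  \<open>\<rho> \<le> 1\<close> the crude exponential bound on the series suffices.\<close>

lemma mittag_leffler_bound_of_decay:
  fixes \<omega> a :: complex
  assumes \<alpha>: "0 < \<alpha>" "\<alpha> < 1" and \<omega>: "norm \<omega> = 1"
    and "\<exists>C. \<forall>t>0. norm (mittag_leffler \<alpha> (\<omega> * of_real (t powr \<alpha>)) - a * exp (- \<i> * of_real t)
      - (1 - a) * exp (- of_real t)) \<le> C * t powr (- \<alpha>)"
  shows "\<exists>C\<ge>0. \<forall>\<rho>\<ge>0. norm (mittag_leffler \<alpha> (\<omega> * of_real \<rho>) - a * exp (- \<i> * of_real (\<rho> powr (1 / \<alpha>)))) \<le> C / (1 + \<rho>)"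
proof -
  obtain C where C: "\<And>t. t > 0 \<Longrightarrow> norm (mittag_leffler \<alpha> (\<omega> * of_real (t powr \<alpha>)) - a * exp (- \<i> * of_real t)
      - (1 - a) * exp (- of_real t)) \<le> C * t powr (- \<alpha>)" using assms(4) by blast
  have C0: "C \<ge> 0" using order_trans[OF norm_ge_zero C[of 1]] by simp
  define K where "K = max (C + norm (1 - a)) (2 * exp (2 powr (1 / \<alpha>) + 1) + norm a)"
  have K: "K \<ge> 0" using C0 by (simp add: K_def le_max_iff_disj)
  have "norm (mittag_leffler \<alpha> (\<omega> * of_real \<rho>) - a * exp (- \<i> * of_real (\<rho> powr (1 / \<alpha>)))) \<le> 2 * K / (1 + \<rho>)"
    if \<rho>: "\<rho> \<ge> 0" for \<rho>
  proof (cases "\<rho> \<le> 1")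
    case True
    have "norm (mittag_leffler \<alpha> (\<omega> * of_real \<rho>)) \<le> 2 * exp ((2 * 1) powr (1 / \<alpha>) + 1)"
      using True \<rho> by (intro norm_mittag_leffler_le \<alpha>) (auto simp: norm_mult \<omega>)
    moreover have "norm (a * exp (- \<i> * of_real (\<rho> powr (1 / \<alpha>)))) = norm a" by (simp add: norm_mult)
    ultimately have "norm (mittag_leffler \<alpha> (\<omega> * of_real \<rho>) - a * exp (- \<i> * of_real (\<rho> powr (1 / \<alpha>)))) \<le> K"
      unfolding K_def by (intro order_trans[OF norm_triangle_ineq4]) auto
    also have "K \<le> 2 * K / (1 + \<rho>)"
      using K True \<rho> by (simp add: pos_le_divide_eq mult_left_mono algebra_simps mult_left_le)
    finally show ?thesis .
  next
    case False
    define t where "t = \<rho> powr (1 / \<alpha>)"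
    have t: "t > 0" "t powr \<alpha> = \<rho>" "t powr (- \<alpha>) = 1 / \<rho>"
      using False \<alpha> by (auto simp: t_def powr_powr powr_minus_divide)
    let ?m = "mittag_leffler \<alpha> (\<omega> * of_real \<rho>) - a * exp (- \<i> * of_real t)"
    have "norm ?m \<le> norm (?m - (1 - a) * exp (- of_real t)) + norm ((1 - a) * exp (- of_real t))"
      by (metis diff_add_cancel norm_triangle_ineq)
    also have "norm ((1 - a) * exp (- of_real t)) = norm (1 - a) * exp (- t)" by (simp add: norm_mult)
    also have "norm (?m - (1 - a) * exp (- of_real t)) + norm (1 - a) * exp (- t) \<le> C * t powr (- \<alpha>) + norm (1 - a) * t powr (- \<alpha>)"
      using C[OF t(1)] exp_neg_le_powr[OF \<alpha>(1) _ t(1)] \<alpha> unfolding t(2)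
      by (intro add_mono mult_left_mono) auto
    also have "\<dots> = (C + norm (1 - a)) / \<rho>" by (simp add: t(3) add_divide_distrib)
    also have "\<dots> \<le> K / \<rho>" using False by (intro divide_right_mono) (auto simp: K_def)
    also have "\<dots> \<le> 2 * K / (1 + \<rho>)"
    proof -
      have "K * 1 \<le> K * \<rho>" using K False by (intro mult_left_mono) auto
      then show ?thesis using False by (simp add: divide_simps algebra_simps)
    qed
    finally show ?thesis unfolding t_def .
  qed
  then show ?thesis using K by (intro exI[of _ "2 * K"]) auto
qed

lemma minus_i_notin_nonpos_Reals: "- \<i> \<notin> \<real>\<^sub>\<le>\<^sub>0"
  by (auto elim!: nonpos_Reals_cases simp: complex_eq_iff)

text \<open>For \<gamma> > \<alpha> the only candidate for a pole has argument
  \<open>- pi \<gamma> / (2 \<alpha>)\<close>, beyond \<open>- pi / 2\<close>: it lies in the open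
  left half plane or does not exist on the principal branch. Nothing has to be subtracted at
  \<open>- i\<close>, so \<open>a = 0\<close>.\<close>

lemma mittag_leffler_ray_bound:
  assumes \<alpha>: "0 < \<alpha>" "\<alpha> < 1" and \<gamma>: "\<alpha> < \<gamma>" "\<gamma> \<le> 1"
  shows "\<exists>C\<ge>0. \<forall>\<rho>\<ge>0. norm (mittag_leffler \<alpha> (ipow (- \<gamma>) * of_real \<rho>)) \<le> C / (1 + \<rho>)"
proof -
  define \<theta> where "\<theta> = pi * \<gamma> / (2 * \<alpha>)"
  have \<theta>: "\<theta> > pi / 2" using \<alpha> \<gamma> by (simp add: \<theta>_def field_simps)
  \<comment> \<open>The candidate \<open>cis (- \<theta>)\<close> has real part
    \<open>cos \<theta>\<close>; with \<open>\<kappa> = - cos \<theta>\<close> this is at most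
    \<open>- \<kappa> |sin \<theta>|\<close>, just outside the sector. If
    \<open>cos \<theta> \<ge> 0\<close>, then \<open>\<theta> > pi\<close>, there is no root, and 1
    is an arbitrary choice.\<close>
  define \<kappa> where "\<kappa> = (if cos \<theta> < 0 then - cos \<theta> else 1)"
  have \<kappa>: "\<kappa> > 0" by (simp add: \<kappa>_def)
  have sol: "s = cis (- \<theta>) \<and> \<theta> \<le> pi" if "s \<noteq> 0" "s powr \<alpha> = ipow (- \<gamma>)" for s :: complex
    using powr_eq_ipow[OF \<alpha> _ \<gamma>(2) that] \<alpha> \<gamma> by (simp add: \<theta>_def)
  have cosneg: "cos \<theta> < 0" if "\<theta> \<le> pi"
  proof -
    have "cos \<theta> < cos (pi / 2)" using \<theta> that by (intro cos_monotone_0_pi) auto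
    then show ?thesis by simp
  qed
  have pole: "s powr \<alpha> \<noteq> ipow (- \<gamma>)" if "s \<in> wide_sector \<kappa>" for s :: complex
  proof
    assume eq: "s powr \<alpha> = ipow (- \<gamma>)"
    have "s \<noteq> 0" using that by (auto simp: wide_sector_def)
    from sol[OF this eq] have s: "s = cis (- \<theta>)" and "\<theta> \<le> pi" by auto
    then have \<kappa>': "\<kappa> = - cos \<theta>" using cosneg by (simp add: \<kappa>_def)
    have "\<kappa> * \<bar>sin \<theta>\<bar> \<le> \<kappa> * 1" using \<kappa> by (intro mult_left_mono) auto
    moreover have "cos \<theta> > - \<kappa> * \<bar>sin \<theta>\<bar>" using that by (simp add: s wide_sector_def)
    ultimately show False using \<kappa>' by simp
  qed
  have pole': "(- \<i>) powr \<alpha> \<noteq> ipow (- \<gamma>)"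
  proof
    assume "(- \<i>) powr \<alpha> = ipow (- \<gamma>)"
    from sol[OF _ this] have "- \<i> = cis (- \<theta>)" "\<theta> \<le> pi" by auto
    then have "cos \<theta> = 0" by (simp add: complex_eq_iff)
    then show False using cosneg[OF \<open>\<theta> \<le> pi\<close>] by simp
  qed
  have contp: "isCont (\<lambda>s. s powr \<beta>) (- \<i>)" for \<beta> :: complex
    using has_field_derivative_powr[OF minus_i_notin_nonpos_Reals] DERIV_isCont by blast
  \<comment> \<open>With \<open>a = 0\<close> the limit demanded at \<open>- i\<close> is the value
    of a continuous function.\<close>
  have "isCont (\<lambda>s. s powr (complex_of_real \<alpha> - 1) / (s powr \<alpha> - ipow (- \<gamma>)) - 0 / (s + \<i>)) (- \<i>)"
    using contp pole' by (simp add: continuous_intros)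
  from this[unfolded isCont_def]
  have "\<exists>C. \<forall>t>0. norm (mittag_leffler \<alpha> (ipow (- \<gamma>) * of_real (t powr \<alpha>)) - 0 * exp (- \<i> * of_real t)
      - (1 - 0) * exp (- of_real t)) \<le> C * t powr (- \<alpha>)"
    by (intro mittag_leffler_decay[OF \<alpha> norm_ipow \<kappa>] pole) auto
  from mittag_leffler_bound_of_decay[OF \<alpha> norm_ipow this] show ?thesis by simp
qed

text \<open>Here the root is exactly \<open>- i\<close>, a simple one. The residue
  \<open>1 / \<alpha>\<close> is the numerator \<open>s^(\<alpha>-1)\<close> divided by the
  derivative \<open>\<alpha> s^(\<alpha>-1)\<close> of the denominator.\<close>

lemma mittag_leffler_critical_ray:
  assumes \<alpha>: "0 < \<alpha>" "\<alpha> < 1"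
  shows "\<exists>C\<ge>0. \<forall>\<rho>\<ge>0. norm (mittag_leffler \<alpha> (ipow (- \<alpha>) * of_real \<rho>)
      - of_real (1 / \<alpha>) * exp (- \<i> * of_real (\<rho> powr (1 / \<alpha>)))) \<le> C / (1 + \<rho>)"
proof -
  have i: "(- \<i>) powr \<alpha> = ipow (- \<alpha>)"
    by (simp add: powr_def ipow_def Ln_minus_ii algebra_simps)
  have pole: "s powr \<alpha> \<noteq> ipow (- \<alpha>)" if "s \<in> wide_sector 1 - {- \<i>}" for s :: complex
  proof
    assume eq: "s powr \<alpha> = ipow (- \<alpha>)"
    have "s \<noteq> 0" using that by (auto simp: wide_sector_def)
    from powr_eq_ipow(1)[OF \<alpha> _ _ this eq] \<alpha> have "s = cis (- (pi / 2))" by simp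
    then have "s = - \<i>" by (simp add: cis.ctr complex_eq_iff)
    with that show False by simp
  qed
  define S :: "complex set" where "S = - \<real>\<^sub>\<le>\<^sub>0"
  have S: "open S" "- \<i> \<in> S" unfolding S_def using minus_i_notin_nonpos_Reals by auto
  have der: "((\<lambda>s. s powr \<beta>) has_field_derivative \<beta> * s powr (\<beta> - 1)) (at s)" if "s \<in> S" for s \<beta> :: complex
    using that has_field_derivative_powr[of s \<beta>] by (auto simp: S_def)
  \<comment> \<open>\<open>g\<close> is the difference quotient of \<open>s^\<alpha>\<close> at
    \<open>- i\<close> with its removable singularity filled. With
    \<open>h = s^(\<alpha>-1) / g\<close> the transform is \<open>h s / (s + i)\<close>, so after
    subtracting the polar part a difference quotient of \<open>h\<close> remains, whose limit is the
    derivative of \<open>h\<close> at \<open>- i\<close>.\<close>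
  define g where "g s = (if s = - \<i> then deriv (\<lambda>s. s powr \<alpha>) (- \<i>) else (s powr \<alpha> - (- \<i>) powr \<alpha>) / (s - (- \<i>)))" for s :: complex
  have "(\<lambda>s. s powr complex_of_real \<alpha>) holomorphic_on S"
    unfolding holomorphic_on_def field_differentiable_def using der has_field_derivative_at_within by blast
  from pole_lemma_open[OF this S(1), of "- \<i>"]
  have "g holomorphic_on S" unfolding g_def[abs_def] by simp
  then have gd: "g field_differentiable at (- \<i>)"
    using S holomorphic_on_imp_differentiable_at by blast
  have g0: "g (- \<i>) = \<alpha> * (- \<i>) powr (complex_of_real \<alpha> - 1)"
    using DERIV_imp_deriv[OF der[OF S(2), of "of_real \<alpha>"]] by (simp add: g_def)
  have gn: "g (- \<i>) \<noteq> 0" unfolding g0 using \<alpha> by simp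
  define h where "h s = s powr (complex_of_real \<alpha> - 1) / g s" for s
  have h0: "h (- \<i>) = of_real (1 / \<alpha>)" using \<alpha> by (simp add: h_def g0)
  have "h field_differentiable at (- \<i>)"
    unfolding h_def[abs_def] using gd gn der[OF S(2)]
    by (intro field_differentiable_divide) (auto simp: field_differentiable_def)
  then obtain D where "(h has_field_derivative D) (at (- \<i>))" unfolding field_differentiable_def by blast
  then have "((\<lambda>s. (h s - h (- \<i>)) / (s - (- \<i>))) \<longlongrightarrow> D) (at (- \<i>))"
    by (simp add: has_field_derivative_iff)
  moreover have "eventually (\<lambda>s. (h s - h (- \<i>)) / (s - (- \<i>)) =
      s powr (complex_of_real \<alpha> - 1) / (s powr \<alpha> - ipow (- \<alpha>)) - of_real (1 / \<alpha>) / (s + \<i>)) (at (- \<i>))"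
  proof -
    have "(h s - h (- \<i>)) / (s - (- \<i>)) = s powr (complex_of_real \<alpha> - 1) / (s powr \<alpha> - ipow (- \<alpha>)) - of_real (1 / \<alpha>) / (s + \<i>)"
      if "s \<noteq> - \<i>" for s
    proof -
      have "s + \<i> \<noteq> 0" using that by (simp add: eq_neg_iff_add_eq_0)
      then have "h s / (s - (- \<i>)) = s powr (complex_of_real \<alpha> - 1) / (s powr \<alpha> - ipow (- \<alpha>))"
        using that by (simp add: h_def g_def i)
      then show ?thesis unfolding h0 diff_divide_distrib by simp
    qed
    then show ?thesis by (auto simp: eventually_at_filter)
  qed
  ultimately have "((\<lambda>s. s powr (complex_of_real \<alpha> - 1) / (s powr \<alpha> - ipow (- \<alpha>)) - of_real (1 / \<alpha>) / (s + \<i>)) \<longlongrightarrow> D) (at (- \<i>))"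
    by (rule Lim_transform_eventually)
  from mittag_leffler_decay[OF \<alpha> norm_ipow zero_less_one pole this]
  show ?thesis by (intro mittag_leffler_bound_of_decay[OF \<alpha> norm_ipow]) blast
qed

section \<open>The Littlewood-Paley kernel\<close>

lemma symb_scale:
  fixes F :: "'i \<Rightarrow> 'a::euclidean_space \<Rightarrow> 'b::real_normed_vector"
  shows "symb I n F \<Longrightarrow> symb I n (\<lambda>i x. F i (c *\<^sub>R x))"
proof (induction n arbitrary: F)
  have lb: "loc_bounded I (\<lambda>i x. F i (c *\<^sub>R x))" if F: "loc_bounded I F" for F :: "'i \<Rightarrow> 'a \<Rightarrow> 'b"
    unfolding loc_bounded_def
  proof
    fix R
    obtain C where C: "\<forall>i\<in>I. \<forall>x. norm x \<le> \<bar>c\<bar> * R \<longrightarrow> norm (F i x) \<le> C"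
      using F unfolding loc_bounded_def by meson
    have "norm (F i (c *\<^sub>R x)) \<le> C" if "i \<in> I" "norm x \<le> R" for i x
      using C that by (simp add: mult_left_mono)
    then show "\<exists>C. \<forall>i\<in>I. \<forall>x. norm x \<le> R \<longrightarrow> norm (F i (c *\<^sub>R x)) \<le> C" by blast
  qed
  {
    case 0
    have "continuous_on UNIV (\<lambda>x. F i (c *\<^sub>R x))" if "i \<in> I" for i
      by (rule continuous_on_compose2[OF symb_continuous[OF 0 that]]) (auto intro: continuous_intros)
    with 0 show ?case by (auto intro!: lb)
  next
    case (Suc n)
    show ?case
    proof (rule symb_SucI[where F' = "\<lambda>i x h. c *\<^sub>R frechet_derivative (F i) (at (c *\<^sub>R x)) h"])
      show "loc_bounded I (\<lambda>i x. F i (c *\<^sub>R x))" by (rule lb[OF symb_loc_bounded[OF Suc.prems]])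
      fix i x assume i: "i \<in> I"
      interpret bounded_linear "frechet_derivative (F i) (at (c *\<^sub>R x))"
        using symb_has_derivative[OF Suc.prems i] by (rule has_derivative_bounded_linear)
      have "((\<lambda>x. c *\<^sub>R x) has_derivative (\<lambda>h. c *\<^sub>R h)) (at x)" by (auto intro!: derivative_eq_intros)
      from has_derivative_compose[OF this symb_has_derivative[OF Suc.prems i]]
      show "((\<lambda>x. F i (c *\<^sub>R x)) has_derivative (\<lambda>h. c *\<^sub>R frechet_derivative (F i) (at (c *\<^sub>R x)) h)) (at x)"
        by (simp add: scale)
    next
      fix b :: 'a assume "b \<in> Basis"
      then show "symb I n (\<lambda>i x. c *\<^sub>R frechet_derivative (F i) (at (c *\<^sub>R x)) b)"
        using Suc.IH[of "partial b F"] Suc.prems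
        by (intro symb_bounded_linear[OF bounded_linear_scaleR_right]) simp
    qed
  }
qed

lemma symb_norm_sq: "symb I n (\<lambda>_ x::'a::euclidean_space. x \<bullet> x)"
proof -
  have "symb I n (\<lambda>_ x::'a. x \<bullet> b)" for b
    by (rule symb_inner[where B = "norm b"]) simp
  then have "symb I n (\<lambda>_ x::'a. \<Sum>b\<in>Basis. (x \<bullet> b)\<^sup>2)" by (intro symb_sum symb_power2)
  moreover have "(\<Sum>b\<in>Basis. (x \<bullet> b)\<^sup>2) = x \<bullet> x" for x :: 'a
    unfolding euclidean_inner[of x x] by (simp only: power2_eq_square)
  ultimately show ?thesis by simp
qed

lemma
  fixes \<psi> :: "'a::euclidean_space \<Rightarrow> real"
  assumes \<psi>: "radial_bump \<psi>"
  shows radial_bump_symb: "symb I n (\<lambda>_. \<psi>)"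
    and radial_bump_eq_1: "norm x \<le> 1 \<Longrightarrow> \<psi> x = 1"
    and radial_bump_eq_0: "norm x \<ge> 2 \<Longrightarrow> \<psi> x = 0"
proof -
  show s: "symb I n (\<lambda>_. \<psi>)" for I n using \<psi> by (intro smooth_symb) (simp add: radial_bump_def)
  have cont: "continuous_on UNIV \<psi>" using symb_continuous[OF s[of "UNIV :: unit set"]] by simp
  show "\<psi> x = 1" if "norm x \<le> 1"
  proof -
    have "closed {x. \<psi> x = 1}" by (rule closed_Collect_eq[OF cont continuous_on_const])
    moreover have "ball 0 1 \<subseteq> {x. \<psi> x = 1}" using \<psi> unfolding radial_bump_def by blast
    ultimately have "closure (ball 0 1) \<subseteq> {x. \<psi> x = 1}" by (rule closure_minimal[rotated])
    then show ?thesis using that by auto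
  qed
  show "\<psi> x = 0" if "norm x \<ge> 2"
  proof (rule ccontr)
    assume "\<psi> x \<noteq> 0"
    \<comment> \<open>The set where \<open>\<psi>\<close> is nonzero is open, so lying in the closed
      ball it lies in the open one; this settles the sphere \<open>norm x = 2\<close>.\<close>
    have "open {x. \<psi> x \<noteq> 0}" by (rule open_Collect_neq[OF cont continuous_on_const])
    moreover have "{x. \<psi> x \<noteq> 0} \<subseteq> cball 0 2"
    proof -
      have "closure {x. \<psi> x \<noteq> 0} \<subseteq> cball 0 2" using \<psi> unfolding radial_bump_def by (elim conjE)
      then show ?thesis by (rule order_trans[OF closure_subset])
    qed
    ultimately have "{x. \<psi> x \<noteq> 0} \<subseteq> interior (cball 0 2)" by (rule interior_maximal[rotated])
    then show False using \<open>\<psi> x \<noteq> 0\<close> that by auto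
  qed
qed

lemma zeta_eq_0:
  assumes "radial_bump \<psi>" "norm x \<le> 1 / 2 \<or> norm x \<ge> 2"
  shows "zeta \<psi> x = 0"
  using assms(2) radial_bump_eq_1[OF assms(1), of x] radial_bump_eq_1[OF assms(1), of "2 *\<^sub>R x"]
    radial_bump_eq_0[OF assms(1), of x] radial_bump_eq_0[OF assms(1), of "2 *\<^sub>R x"]
  by (auto simp: zeta_def)

lemma symb_zeta: "radial_bump \<psi> \<Longrightarrow> symb I n (\<lambda>_ x. zeta \<psi> (c *\<^sub>R x))"
proof -
  assume \<psi>: "radial_bump \<psi>"
  have "symb I n (\<lambda>_ x. zeta \<psi> x)"
    unfolding zeta_def by (intro symb_diff symb_scale radial_bump_symb[OF \<psi>])
  then show ?thesis by (rule symb_scale)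
qed

section \<open>Oscillatory integrals with a power phase on an annulus\<close>

text \<open>Both squared distances split into a radial and an angular part, the latter a multiple of
  \<open>p = r s - x y \<ge> 0\<close>. On \<open>1/4 \<le> z \<le> 4\<close> the power
  \<open>z^(b-2)\<close> is at least \<open>q\<close>. Hence the angular part is multiplied by at
  least \<open>q^2\<close>, and the mean value theorem for \<open>z^(b-1)\<close> expands the radial
  part by \<open>(b - 1)^2 q^2\<close>, which is where \<open>b = 1\<close> degenerates.\<close>

lemma power_map_expanding:
  fixes x y :: "'a::real_inner" and b :: real
  assumes x: "1 / 4 \<le> norm x" "norm x \<le> 4" and y: "1 / 4 \<le> norm y" "norm y \<le> 4"
  shows "min ((b - 1)\<^sup>2) 1 * 4 powr (- 2 * \<bar>b - 2\<bar>) * (norm (x - y))\<^sup>2 \<le>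
    (norm (norm x powr (b - 2) *\<^sub>R x - norm y powr (b - 2) *\<^sub>R y))\<^sup>2"
proof -
  define r where "r = norm x"
  define s where "s = norm y"
  define q where "q = 4 powr (- \<bar>b - 2\<bar>)"
  define p where "p = r * s - x \<bullet> y"
  have r: "1 / 4 \<le> r" "r \<le> 4" and s: "1 / 4 \<le> s" "s \<le> 4" using x y by (auto simp: r_def s_def)
  have p: "p \<ge> 0" using norm_cauchy_schwarz[of x y] by (simp add: p_def r_def s_def)
  have q: "q > 0" by (simp add: q_def)
  have lo: "q \<le> z powr (b - 2)" if "1 / 4 \<le> z" "z \<le> 4" for z
  proof (cases "b \<ge> 2")
    case True
    have "q = 4 powr (- (b - 2))" using True by (simp only: q_def abs_of_nonneg diff_ge_0_iff_ge)
    also have "\<dots> = 1 / 4 powr (b - 2)" by (rule powr_minus_divide)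
    also have "\<dots> = (1 / 4) powr (b - 2)" by (simp add: powr_divide)
    also have "\<dots> \<le> z powr (b - 2)" using that True by (intro powr_mono2) auto
    finally show ?thesis .
  next
    case False
    then have "q = 4 powr (b - 2)" by (simp add: q_def)
    also have "\<dots> \<le> z powr (b - 2)" using that False by (intro powr_mono2') auto
    finally show ?thesis .
  qed
  have mvt: "\<bar>b - 1\<bar> * q * \<bar>u - v\<bar> \<le> \<bar>u powr (b - 1) - v powr (b - 1)\<bar>"
    if "1 / 4 \<le> v" "v \<le> u" "u \<le> 4" for u v
  proof (cases "v = u")
    case False
    then have "v < u" using that by simp
    have "\<exists>z>v. z < u \<and> u powr (b - 1) - v powr (b - 1) = (u - v) * ((b - 1) * z powr (b - 1 - 1))"
      by (rule MVT2[OF \<open>v < u\<close>]) (use that in \<open>auto intro!: derivative_eq_intros\<close>)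
    then obtain z where z: "z > v" "z < u" "u powr (b - 1) - v powr (b - 1) = (u - v) * ((b - 1) * z powr (b - 2))"
      by auto
    have "q \<le> z powr (b - 2)" using z that by (intro lo) auto
    then have "\<bar>b - 1\<bar> * q * \<bar>u - v\<bar> \<le> \<bar>b - 1\<bar> * z powr (b - 2) * \<bar>u - v\<bar>"
      by (intro mult_right_mono mult_left_mono) auto
    then show ?thesis unfolding z(3) by (simp add: abs_mult mult_ac)
  qed simp
  have mvt': "\<bar>b - 1\<bar> * q * \<bar>r - s\<bar> \<le> \<bar>r powr (b - 1) - s powr (b - 1)\<bar>"
    using mvt[of s r] mvt[of r s] r s by (cases "s \<le> r") (auto simp: abs_minus_commute)
  have sq: "(b - 1)\<^sup>2 * q\<^sup>2 * (r - s)\<^sup>2 \<le> (r powr (b - 1) - s powr (b - 1))\<^sup>2"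
    using power_mono[OF mvt', of 2] q by (simp add: power_mult_distrib)
  have rs: "q\<^sup>2 \<le> r powr (b - 2) * s powr (b - 2)"
    using mult_mono[OF lo[OF r] lo[OF s]] q by (simp add: power2_eq_square)
  have e1: "(norm (x - y))\<^sup>2 = (r - s)\<^sup>2 + 2 * p"
    unfolding power2_norm_eq_inner p_def r_def s_def
    by (simp add: inner_diff_left inner_diff_right inner_commute power2_diff power2_norm_eq_inner)
  have e2: "(norm (norm x powr (b - 2) *\<^sub>R x - norm y powr (b - 2) *\<^sub>R y))\<^sup>2 =
      (r powr (b - 1) - s powr (b - 1))\<^sup>2 + 2 * (r powr (b - 2) * s powr (b - 2)) * p"
  proof -
    have pr: "z powr (b - 1) = z powr (b - 2) * z" if "z > 0" for z
      using that by (simp add: powr_diff powr_numeral power2_eq_square field_simps)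
    have "(norm (norm x powr (b - 2) *\<^sub>R x - norm y powr (b - 2) *\<^sub>R y))\<^sup>2 =
      (r powr (b - 2))\<^sup>2 * r\<^sup>2 + (s powr (b - 2))\<^sup>2 * s\<^sup>2 - 2 * (r powr (b - 2) * s powr (b - 2)) * (x \<bullet> y)"
      unfolding r_def s_def power2_norm_eq_inner
      by (simp add: inner_diff_left inner_diff_right inner_commute power2_eq_square algebra_simps)
    also have "\<dots> = (r powr (b - 1) - s powr (b - 1))\<^sup>2 + 2 * (r powr (b - 2) * s powr (b - 2)) * p"
      using r s by (simp add: pr p_def power2_eq_square algebra_simps)
    finally show ?thesis .
  qed
  let ?m = "min ((b - 1)\<^sup>2) 1"
  have qq: "4 powr (- 2 * \<bar>b - 2\<bar>) = q\<^sup>2"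
    by (simp add: q_def power2_eq_square powr_add[symmetric])
  have "?m * q\<^sup>2 * (r - s)\<^sup>2 \<le> (b - 1)\<^sup>2 * q\<^sup>2 * (r - s)\<^sup>2"
    by (intro mult_right_mono) auto
  moreover have "?m * q\<^sup>2 * (2 * p) \<le> 2 * (r powr (b - 2) * s powr (b - 2)) * p"
  proof -
    have "?m * q\<^sup>2 \<le> 1 * q\<^sup>2" by (intro mult_right_mono) auto
    then have "?m * q\<^sup>2 * (2 * p) \<le> (r powr (b - 2) * s powr (b - 2)) * (2 * p)"
      using rs p by (intro mult_right_mono) auto
    then show ?thesis by (simp add: mult_ac)
  qed
  ultimately show ?thesis unfolding e1 e2 qq using sq by (simp add: distrib_left)
qed

lemma zeta_oscillatory_bound:
  fixes \<psi> :: "'a::euclidean_space \<Rightarrow> real"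
  assumes \<psi>: "radial_bump \<psi>" and b: "b > 0" "b \<noteq> 1"
  shows "\<exists>C\<ge>0. \<forall>s>0. \<forall>y. (norm (LINT \<eta>|lborel. exp (\<i> * of_real (y \<bullet> \<eta> - s * norm \<eta> powr b)) * of_real (zeta \<psi> \<eta>)))\<^sup>2 * s ^ DIM('a) \<le> C"
proof -
  \<comment> \<open>Equal to 1 on the annulus \<open>K\<close> carrying \<open>zeta \<psi>\<close>
    and supported in \<open>1/4 \<le> |x| \<le> 4\<close>, the range of the expansion
    estimate.\<close>
  define \<theta> where "\<theta> x = \<psi> ((1 / 2) *\<^sub>R x) - \<psi> (4 *\<^sub>R x)" for x
  \<comment> \<open>The power \<open>|x|^b\<close> need not be smooth at 0. Adding
    \<open>(\<psi> (8 x))^2\<close> to \<open>|x|^2\<close> changes it only for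
    \<open>|x| < 1/4\<close>, off the supports of \<open>\<theta>\<close> and
    \<open>zeta \<psi>\<close>, and keeps \<open>g \<ge> (1/8)^2\<close>, so every power of
    \<open>g\<close> is smooth.\<close>
  define g where "g x = x \<bullet> x + (\<psi> (8 *\<^sub>R x))\<^sup>2" for x
  define \<phi> where "\<phi> x = g x powr (b / 2)" for x
  define K where "K = {x::'a. 1 / 2 \<le> norm x \<and> norm x \<le> 2}"
  note symb_\<psi> = radial_bump_symb[OF \<psi>] and \<psi>1 = radial_bump_eq_1[OF \<psi>] and \<psi>0 = radial_bump_eq_0[OF \<psi>]
  have ge: "1 / 64 \<le> g x" for x
  proof (cases "norm x \<le> 1 / 8")
    case True
    then have "\<psi> (8 *\<^sub>R x) = 1" by (intro \<psi>1) simp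
    then show ?thesis by (simp add: g_def add_increasing)
  next
    case False
    then have "(1 / 8)\<^sup>2 \<le> (norm x)\<^sup>2" by (intro power_mono) auto
    then have "(1 / 8)\<^sup>2 \<le> x \<bullet> x" by (simp only: power2_norm_eq_inner)
    then have "1 / 64 \<le> x \<bullet> x" by (simp add: power2_eq_square)
    then show ?thesis by (simp add: g_def add_increasing2)
  qed
  have sg: "symb (UNIV :: unit set) n (\<lambda>_. g)" for n
    unfolding g_def by (intro symb_add symb_norm_sq symb_power2 symb_scale symb_\<psi>)
  have s\<phi>: "symb (UNIV :: unit set) n (\<lambda>_. \<phi>)" for n
    unfolding \<phi>_def by (rule symb_powr[OF _ ge sg]) simp
  have \<phi>eq: "\<phi> x = norm x powr b" if "norm x \<ge> 1 / 4" for x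
  proof -
    have "\<psi> (8 *\<^sub>R x) = 0" using that by (intro \<psi>0) simp
    then have "\<phi> x = ((norm x)\<^sup>2) powr (b / 2)" by (simp add: \<phi>_def g_def power2_norm_eq_inner)
    also have "(norm x)\<^sup>2 = norm x powr 2" using that by (subst powr_numeral) auto
    finally have "\<phi> x = norm x powr (2 * (b / 2))" by (simp only: powr_powr)
    then show ?thesis by simp
  qed
  have \<theta>: "1 / 4 < norm x \<and> norm x < 4" if "\<theta> x \<noteq> 0" for x
  proof (rule ccontr)
    assume "\<not> (1 / 4 < norm x \<and> norm x < 4)"
    then consider "norm x \<le> 1 / 4" | "norm x \<ge> 4" by linarith
    then have "\<theta> x = 0"
    proof cases
      case 1
      then show ?thesis using \<psi>1[of "(1 / 2) *\<^sub>R x"] \<psi>1[of "4 *\<^sub>R x"] by (simp add: \<theta>_def)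
    next
      case 2
      then show ?thesis using \<psi>0[of "(1 / 2) *\<^sub>R x"] \<psi>0[of "4 *\<^sub>R x"] by (simp add: \<theta>_def)
    qed
    with that show False by simp
  qed
  have der: "frechet_derivative \<phi> (at x) k = b * (norm x powr (b - 2) *\<^sub>R x \<bullet> k)" if x: "norm x > 1 / 4" for x k
  proof -
    have xx: "x \<bullet> x > 0" using x by (auto simp: inner_gt_zero_iff)
    have "((\<lambda>x. (x \<bullet> x) powr (b / 2)) has_derivative (\<lambda>k. b * (x \<bullet> k) * ((x \<bullet> x) powr (b / 2) / (x \<bullet> x)))) (at x)"
      using xx by (auto intro!: derivative_eq_intros simp: inner_commute field_simps)
    moreover have "open {x::'a. norm x > 1 / 4}" by (intro open_Collect_less continuous_intros)
    ultimately have "(\<phi> has_derivative (\<lambda>k. b * (x \<bullet> k) * ((x \<bullet> x) powr (b / 2) / (x \<bullet> x)))) (at x)"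
    proof (rule has_derivative_transform_within_open)
      show "x \<in> {x. norm x > 1 / 4}" using x by simp
      fix y :: 'a assume y: "y \<in> {x. norm x > 1 / 4}"
      then have "\<psi> (8 *\<^sub>R y) = 0" by (intro \<psi>0) simp
      then show "(y \<bullet> y) powr (b / 2) = \<phi> y" by (simp add: \<phi>_def g_def)
    qed
    from frechet_derivative_at[OF this]
    have "frechet_derivative \<phi> (at x) k = b * (x \<bullet> k) * ((x \<bullet> x) powr (b / 2) / (x \<bullet> x))" by metis
    also have "(x \<bullet> x) powr (b / 2) / (x \<bullet> x) = norm x powr (b - 2)"
    proof -
      have e: "x \<bullet> x = norm x powr 2" using x by (subst powr_numeral) (auto simp: power2_norm_eq_inner)
      have "(x \<bullet> x) powr (b / 2) / (x \<bullet> x) = norm x powr (2 * (b / 2)) / norm x powr 2"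
        unfolding e powr_powr ..
      also have "\<dots> = norm x powr (b - 2)" by (simp only: powr_diff) simp
      finally show ?thesis .
    qed
    finally show ?thesis by simp
  qed
  \<comment> \<open>The factor \<open>b^2\<close> comes from the gradient
    \<open>b |x|^(b-2) x\<close> of the phase, the rest from the expansion estimate.\<close>
  define c where "c = b\<^sup>2 * (min ((b - 1)\<^sup>2) 1 * 4 powr (- 2 * \<bar>b - 2\<bar>))"
  have c: "c > 0" using b by (simp add: c_def)
  have "\<exists>C\<ge>0. \<forall>s>0. \<forall>y. (norm (LINT \<eta>|lborel. exp (\<i> * of_real (y \<bullet> \<eta> - s * \<phi> \<eta>)) * of_real (zeta \<psi> \<eta>)))\<^sup>2 * s ^ DIM('a) \<le> C"
  proof (rule oscillatory_integral_bound[where K = K and R = 2 and \<theta> = \<theta>, OF s\<phi> _ _ _ _ _ _ c])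
    show "symb (UNIV :: unit set) n (\<lambda>_. zeta \<psi>)" for n using symb_zeta[OF \<psi>, of UNIV n 1] by simp
    show "symb (UNIV :: unit set) n (\<lambda>_. \<theta>)" for n
      unfolding \<theta>_def by (intro symb_diff symb_scale symb_\<psi>)
    show "closed K" unfolding K_def by (intro closed_Collect_conj closed_Collect_le continuous_intros)
    show "K \<subseteq> cball 0 2" by (auto simp: K_def)
    show "zeta \<psi> x = 0" if "x \<notin> K" for x using that by (intro zeta_eq_0[OF \<psi>]) (auto simp: K_def)
    show "\<theta> x = 1" if "x \<in> K" for x
      using that \<psi>1[of "(1 / 2) *\<^sub>R x"] \<psi>0[of "4 *\<^sub>R x"] by (simp add: \<theta>_def K_def)
    fix x y assume "\<theta> x \<noteq> 0" "\<theta> y \<noteq> 0"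
    then have xy: "1 / 4 < norm x" "norm x < 4" "1 / 4 < norm y" "norm y < 4" using \<theta> by auto
    let ?z = "norm x powr (b - 2) *\<^sub>R x - norm y powr (b - 2) *\<^sub>R y"
    have "(\<Sum>k\<in>Basis. (frechet_derivative \<phi> (at x) k - frechet_derivative \<phi> (at y) k)\<^sup>2) = b\<^sup>2 * (\<Sum>k\<in>Basis. (?z \<bullet> k)\<^sup>2)"
      unfolding der[OF xy(1)] der[OF xy(3)] sum_distrib_left
      by (intro sum.cong) (auto simp: inner_diff_left power_mult_distrib[symmetric] right_diff_distrib)
    also have "(\<Sum>k\<in>Basis. (?z \<bullet> k)\<^sup>2) = (norm ?z)\<^sup>2"
      unfolding power2_norm_eq_inner euclidean_inner[of ?z ?z] by (simp only: power2_eq_square)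
    finally show "c * (norm (x - y))\<^sup>2 \<le> (\<Sum>k\<in>Basis. (frechet_derivative \<phi> (at x) k - frechet_derivative \<phi> (at y) k)\<^sup>2)"
      using mult_left_mono[OF power_map_expanding[of x y b], of "b\<^sup>2"] xy by (simp add: c_def mult.assoc)
  qed
  moreover have "exp (\<i> * of_real (y \<bullet> \<eta> - s * \<phi> \<eta>)) * complex_of_real (zeta \<psi> \<eta>) =
      exp (\<i> * of_real (y \<bullet> \<eta> - s * norm \<eta> powr b)) * of_real (zeta \<psi> \<eta>)" for y s \<eta>
    using \<phi>eq[of \<eta>] zeta_eq_0[OF \<psi>, of \<eta>] by (cases "norm \<eta> \<le> 1 / 2") auto
  ultimately show ?thesis by (simp only:)
qed

section \<open>Identification of the localised kernel\<close>

lemma integrable_schwartz: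
  fixes \<phi> :: "'a::euclidean_space \<Rightarrow> complex"
  assumes "\<phi> \<in> schwartz"
  shows "integrable lborel \<phi>"
proof -
  have sm: "smooth \<phi>" using assms by (simp add: schwartz_def)
  have bd: "bounded (range (\<lambda>x. norm x ^ k *\<^sub>R partials [] \<phi> x))" for k
    using assms unfolding schwartz_def mem_Collect_eq
    by (elim conjE allE[of _ "[]"] allE[of _ k]) simp
  have "continuous_on UNIV \<phi>"
    using symb_continuous[OF smooth_symb[OF sm, of "UNIV :: unit set" 0]] by simp
  then have [measurable]: "\<phi> \<in> borel_measurable borel" by (rule borel_measurable_continuous_onI)
  obtain C1 where C1: "\<And>x. norm (\<phi> x) \<le> C1"
    using bd[of 0] by (auto simp: bounded_iff)
  obtain C2 where C2: "\<And>x. norm (norm x ^ (2 * DIM('a)) *\<^sub>R \<phi> x) \<le> C2"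
    using bd[of "2 * DIM('a)"] by (auto simp: bounded_iff)
  define C where "C = max C1 C2"
  have C0: "C \<ge> 0" using order_trans[OF norm_ge_zero C1[of 0]] by (simp add: C_def le_max_iff_disj)
  show ?thesis
  proof (rule Bochner_Integration.integrable_bound)
    show "integrable lborel (\<lambda>x::'a. 2 ^ DIM('a) * C * cauchy_weight x :: real)"
      using has_bochner_integral_cauchy_weight by (auto simp: has_bochner_integral_iff)
    have "norm (\<phi> x) \<le> 2 ^ DIM('a) * C * cauchy_weight x" for x
      using C1[of x] C2[of x] C0 by (intro decay_le_cauchy_weight) (auto simp: C_def le_max_iff_disj)
    then show "AE x in lborel. norm (\<phi> x) \<le> norm (2 ^ DIM('a) * C * cauchy_weight x)"
      using C0 by (auto simp: abs_mult abs_of_nonneg[OF cauchy_weight_nonneg])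
  qed simp
qed

text \<open>Transposing all operations leaves the integral of \<open>m\<close> against
  \<open>inv_fourier (fourier (h * inv_fourier \<phi>))\<close>. Pointwise inversion removes the
  outer pair, and Fubini moves \<open>\<phi>\<close> outside. Continuity is assumed of
  \<open>m\<close> rather than smoothness, since its later instance involves
  \<open>|\<xi>|^\<beta>\<close>; smoothness and compact support are provided by the cutoff
  \<open>h\<close>.\<close>

lemma LP_inv_fourier_dist:
  fixes \<psi> :: "'a::euclidean_space \<Rightarrow> real" and m :: "'a \<Rightarrow> complex"
  assumes \<psi>: "radial_bump \<psi>" and N: "N > 0" and m: "continuous_on UNIV m"
  defines "k \<equiv> inv_fourier (\<lambda>\<xi>. of_real (zeta \<psi> (\<xi> /\<^sub>R N)) * m \<xi>)"
  shows "represents k (LP \<psi> N (inv_fourier_dist (dist_of_fun m)))"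
proof -
  define h where "h \<xi> = complex_of_real (zeta \<psi> (\<xi> /\<^sub>R N))" for \<xi> :: 'a
  define g where "g \<xi> = h \<xi> * m \<xi>" for \<xi>
  have k: "k = inv_fourier g" by (simp add: k_def g_def[abs_def] h_def)
  have sh: "symb (UNIV :: unit set) n (\<lambda>_. h)" for n
    unfolding h_def by (intro symb_of_real symb_zeta[OF \<psi>])
  have h0: "h \<xi> = 0" if "norm \<xi> > 2 * N" for \<xi>
  proof -
    have "norm (\<xi> /\<^sub>R N) \<ge> 2" using that N by (simp add: divide_simps)
    then show ?thesis unfolding h_def using zeta_eq_0[OF \<psi>, of "\<xi> /\<^sub>R N"] by simp
  qed
  have conth: "continuous_on UNIV h" using symb_continuous[OF sh] by simp
  have inth: "integrable lborel h" using conth h0 by (rule integrable_compact_support)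
  have intFh: "integrable lborel (fourier h)" using sh h0 by (rule integrable_fourier)
  obtain B where "\<forall>x. norm x \<le> 2 * N \<longrightarrow> norm (h x) \<le> B"
    using symb_loc_bounded[OF sh] unfolding loc_bounded_def by blast
  then have B: "norm (h x) \<le> max B 0" for x
    using h0[of x] by (cases "norm x \<le> 2 * N") (auto simp: le_max_iff_disj)
  have intg: "integrable lborel g"
    by (rule integrable_compact_support[where R = "2 * N"])
       (auto simp: g_def h0 intro!: continuous_intros conth m)
  have [measurable]: "g \<in> borel_measurable borel" using intg by auto
  have mk [measurable]: "k \<in> borel_measurable borel"
    unfolding k by (rule borel_measurable_inv_fourier) simp
  define A where "A = (LINT \<xi>|lborel. norm (g \<xi>)) / (2 * pi) ^ DIM('a)"
  have kb: "norm (k x) \<le> A" for x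
  proof -
    have "norm (LINT \<xi>|lborel. g \<xi> * exp (\<i> * of_real (x \<bullet> \<xi>))) \<le> (LINT \<xi>|lborel. norm (g \<xi> * exp (\<i> * of_real (x \<bullet> \<xi>))))"
      by (rule integral_norm_bound)
    then show ?thesis unfolding k inv_fourier_def A_def
      by (simp add: norm_divide norm_mult norm_power divide_right_mono)
  qed
  show ?thesis unfolding represents_def
  proof (intro conjI ballI)
    show "k \<in> borel_measurable lborel" by simp
    fix \<phi> :: "'a \<Rightarrow> complex" assume "\<phi> \<in> schwartz"
    then have \<phi>: "integrable lborel \<phi>" by (rule integrable_schwartz)
    then have [measurable]: "\<phi> \<in> borel_measurable borel" by auto
    show "integrable lborel (\<lambda>x. k x * \<phi> x)"
    proof (rule Bochner_Integration.integrable_bound)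
      show "integrable lborel (\<lambda>x. A * norm (\<phi> x))"
        using \<phi> by simp
      show "AE x in lborel. norm (k x * \<phi> x) \<le> norm (A * norm (\<phi> x))"
        using kb by (auto simp: norm_mult abs_mult intro!: AE_I2 mult_right_mono order_trans[OF _ abs_ge_self])
    qed measurable
    define c where "c = complex_of_real ((2 * pi) ^ DIM('a))"
    let ?e = "\<lambda>\<xi> x. g \<xi> * (\<phi> x * exp (\<i> * of_real (\<xi> \<bullet> x)))"
    have inner: "(LINT x|lborel. ?e \<xi> x) = m \<xi> * (h \<xi> * inv_fourier \<phi> \<xi>) * c" for \<xi>
      by (simp add: inv_fourier_def c_def g_def)
    have "LP \<psi> N (inv_fourier_dist (dist_of_fun m)) \<phi> = dist_of_fun m (inv_fourier (fourier (\<lambda>x. h x * inv_fourier \<phi> x)))"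
      by (simp add: LP_def inv_fourier_dist_def mult_dist_def fourier_dist_def h_def)
    also have "\<dots> = (LINT \<xi>|lborel. m \<xi> * (h \<xi> * inv_fourier \<phi> \<xi>))"
      unfolding dist_of_fun_def inv_fourier_fourier_mult[OF inth conth B intFh \<phi>] ..
    also have "\<dots> = (LINT \<xi>|lborel. (LINT x|lborel. ?e \<xi> x)) / c"
      unfolding inner by (simp add: c_def)
    also have "(LINT \<xi>|lborel. (LINT x|lborel. ?e \<xi> x)) = (LINT x|lborel. (LINT \<xi>|lborel. ?e \<xi> x))"
    proof (rule lborel_pair.Fubini_integral[symmetric])
      show "integrable (lborel \<Otimes>\<^sub>M lborel) (\<lambda>(\<xi>, x). ?e \<xi> x)"
        by (rule integrable_lborel_pair_bound[OF _ intg \<phi>]) (auto simp: norm_mult)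
    qed
    also have "\<dots> = (LINT x|lborel. c * (k x * \<phi> x))"
    proof (rule Bochner_Integration.integral_cong[OF refl])
      fix x
      have "(LINT \<xi>|lborel. ?e \<xi> x) = (LINT \<xi>|lborel. \<phi> x * (g \<xi> * exp (\<i> * of_real (x \<bullet> \<xi>))))"
        by (simp add: inner_commute mult_ac)
      also have "\<dots> = \<phi> x * (c * k x)" by (simp add: k inv_fourier_def c_def)
      finally show "(LINT \<xi>|lborel. ?e \<xi> x) = c * (k x * \<phi> x)" by simp
    qed
    also have "\<dots> / c = dist_of_fun k \<phi>" by (simp add: dist_of_fun_def c_def)
    finally show "LP \<psi> N (inv_fourier_dist (dist_of_fun m)) \<phi> = dist_of_fun k \<phi>" .
  qed
qed

section \<open>Pointwise kernel bounds and the final estimate\<close>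

lemma Linf_norm_convolution_le:
  fixes k f :: "'a::euclidean_space \<Rightarrow> complex"
  assumes [measurable]: "k \<in> borel_measurable borel" and f: "integrable lborel f"
    and k: "\<And>x. norm (k x) \<le> M"
  shows "Linf_norm (convolution k f) \<le> ennreal (M * L1_norm f)"
proof -
  have [measurable]: "f \<in> borel_measurable borel" using f by auto
  have M: "M \<ge> 0" using order_trans[OF norm_ge_zero k] .
  have [measurable]: "convolution k f \<in> borel_measurable borel"
    unfolding convolution_def by measurable
  have "norm (convolution k f x) \<le> M * L1_norm f" for x
  proof -
    have "norm (convolution k f x) \<le> (LINT y|lborel. norm (k (x - y) * f y))"
      unfolding convolution_def by (rule integral_norm_bound)
    also have "\<dots> \<le> (LINT y|lborel. M * norm (f y))"
      using f k M by (intro integral_mono') (auto simp: norm_mult mult_right_mono)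
    finally show ?thesis by (simp add: L1_norm_def)
  qed
  then have "AE x in lborel. ennreal (norm (convolution k f x)) \<le> ennreal (M * L1_norm f)"
    by (intro AE_I2 ennreal_leI)
  then show ?thesis unfolding Linf_norm_def by (intro esssup_I) auto
qed

lemma inv_fourier_dilate:
  fixes g :: "'a::euclidean_space \<Rightarrow> complex"
  assumes [measurable]: "g \<in> borel_measurable borel" and N: "N > 0"
  shows "inv_fourier g x = of_real (N ^ DIM('a)) * inv_fourier (\<lambda>\<eta>. g (N *\<^sub>R \<eta>)) (N *\<^sub>R x)"
proof -
  have "(LINT \<xi>|lborel. g \<xi> * exp (\<i> * of_real (x \<bullet> \<xi>))) =
     \<bar>N\<bar> ^ DIM('a) *\<^sub>R (LINT \<eta>|lborel. g (0 + N *\<^sub>R \<eta>) * exp (\<i> * of_real (x \<bullet> (0 + N *\<^sub>R \<eta>))))"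
    by (rule integral_lborel_affine) (use N in auto)
  then show ?thesis using N by (simp add: inv_fourier_def scaleR_conv_of_real)
qed

text \<open>The leading part \<open>a exp (- i \<rho>\<^sup>1\<^sup>/\<^sup>\<alpha>)\<close> of the symbol is kept inside the oscillatory integral; the
  remainder is integrated absolutely.\<close>

lemma kernel_bound:
  fixes \<psi> :: "'a::euclidean_space \<Rightarrow> real"
  assumes \<psi>: "radial_bump \<psi>" and \<alpha>: "0 < \<alpha>" and \<beta>: "0 < \<beta>"
    and C: "C \<ge> 0" "\<And>\<rho>. \<rho> \<ge> 0 \<Longrightarrow>
      norm (mittag_leffler \<alpha> (\<omega> * of_real \<rho>) - a * exp (- \<i> * of_real (\<rho> powr (1 / \<alpha>)))) \<le> C / (1 + \<rho>)"
    and s: "s > 0"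
  shows "norm (LINT \<eta>|lborel. of_real (zeta \<psi> \<eta>) * mittag_leffler \<alpha> (\<omega> * of_real (s * norm \<eta> powr \<beta>)) * exp (\<i> * of_real (y \<bullet> \<eta>)))
    \<le> 2 powr \<beta> * C * (LINT \<eta>|lborel. \<bar>zeta \<psi> \<eta>\<bar>) / (1 + s) +
      norm a * norm (LINT \<eta>|lborel. exp (\<i> * of_real (y \<bullet> \<eta> - s powr (1 / \<alpha>) * norm \<eta> powr (\<beta> / \<alpha>))) * of_real (zeta \<psi> \<eta>))"
proof -
  define Z where "Z \<eta> = complex_of_real (zeta \<psi> \<eta>)" for \<eta>
  define E where "E \<eta> = mittag_leffler \<alpha> (\<omega> * of_real (s * norm \<eta> powr \<beta>))" for \<eta> :: 'a
  define P where "P \<eta> = exp (- \<i> * complex_of_real ((s * norm \<eta> powr \<beta>) powr (1 / \<alpha>)))" for \<eta> :: 'a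
  define e where "e \<eta> = exp (\<i> * complex_of_real (y \<bullet> \<eta>))" for \<eta>
  have contz: "continuous_on UNIV (zeta \<psi>)"
    using symb_continuous[OF symb_zeta[OF \<psi>, of "UNIV :: unit set" 0 1]] by simp
  have contp: "continuous_on UNIV (\<lambda>\<eta>::'a. norm \<eta> powr b)" if "b > 0" for b :: real
    using that by (intro continuous_on_powr' continuous_intros) auto
  have pe: "(s * norm \<eta> powr \<beta>) powr (1 / \<alpha>) = s powr (1 / \<alpha>) * norm \<eta> powr (\<beta> / \<alpha>)" for \<eta> :: 'a
    using s by (simp add: powr_mult powr_powr)
  have PeZ: "P \<eta> * e \<eta> * Z \<eta> = exp (\<i> * of_real (y \<bullet> \<eta> - s powr (1 / \<alpha>) * norm \<eta> powr (\<beta> / \<alpha>))) * of_real (zeta \<psi> \<eta>)" for \<eta>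
    unfolding P_def e_def Z_def pe mult_exp_exp by (simp add: algebra_simps)
  have contE: "continuous_on UNIV E"
    unfolding E_def using contp[OF \<beta>]
    by (intro continuous_on_compose2[OF continuous_on_mittag_leffler[OF \<alpha>]] continuous_on_mult continuous_on_const continuous_on_of_real) auto
  have contP: "continuous_on UNIV P"
    unfolding P_def pe using contp[of "\<beta> / \<alpha>"] \<alpha> \<beta>
    by (intro continuous_on_exp continuous_on_mult continuous_on_const continuous_on_of_real) auto
  have conte: "continuous_on UNIV e" unfolding e_def by (intro continuous_intros)
  have contZ: "continuous_on UNIV Z" unfolding Z_def by (intro continuous_intros contz)
  have Z0: "Z \<eta> = 0" if "norm \<eta> > 2" for \<eta> using zeta_eq_0[OF \<psi>, of \<eta>] that by (simp add: Z_def)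
  have int1: "integrable lborel (\<lambda>\<eta>. Z \<eta> * (E \<eta> - a * P \<eta>) * e \<eta>)"
    by (rule integrable_compact_support[where R = 2])
       (auto simp: Z0 intro!: continuous_on_mult continuous_on_diff continuous_on_const contE contP conte contZ)
  have int2: "integrable lborel (\<lambda>\<eta>. a * (P \<eta> * e \<eta> * Z \<eta>))"
    by (rule integrable_compact_support[where R = 2])
       (auto simp: Z0 intro!: continuous_on_mult continuous_on_diff continuous_on_const contE contP conte contZ)
  have intz: "integrable lborel (\<lambda>\<eta>. \<bar>zeta \<psi> \<eta>\<bar>)"
    by (rule integrable_compact_support[where R = 2])
       (auto simp: zeta_eq_0[OF \<psi>] intro!: continuous_intros contz)
  have "(LINT \<eta>|lborel. Z \<eta> * E \<eta> * e \<eta>) = (LINT \<eta>|lborel. Z \<eta> * (E \<eta> - a * P \<eta>) * e \<eta> + a * (P \<eta> * e \<eta> * Z \<eta>))"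
    by (intro Bochner_Integration.integral_cong) (auto simp: algebra_simps)
  also have "\<dots> = (LINT \<eta>|lborel. Z \<eta> * (E \<eta> - a * P \<eta>) * e \<eta>) + a * (LINT \<eta>|lborel. P \<eta> * e \<eta> * Z \<eta>)"
    using int1 int2 by (subst Bochner_Integration.integral_add) auto
  also have "norm \<dots> \<le> norm (LINT \<eta>|lborel. Z \<eta> * (E \<eta> - a * P \<eta>) * e \<eta>) + norm a * norm (LINT \<eta>|lborel. P \<eta> * e \<eta> * Z \<eta>)"
    by (rule order_trans[OF norm_triangle_ineq]) (simp add: norm_mult)
  also have "norm (LINT \<eta>|lborel. Z \<eta> * (E \<eta> - a * P \<eta>) * e \<eta>) \<le> 2 powr \<beta> * C * (LINT \<eta>|lborel. \<bar>zeta \<psi> \<eta>\<bar>) / (1 + s)"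
  proof -
    have "norm (LINT \<eta>|lborel. Z \<eta> * (E \<eta> - a * P \<eta>) * e \<eta>) \<le> (LINT \<eta>|lborel. norm (Z \<eta> * (E \<eta> - a * P \<eta>) * e \<eta>))"
      by (rule integral_norm_bound)
    also have "\<dots> \<le> (LINT \<eta>|lborel. 2 powr \<beta> * C / (1 + s) * \<bar>zeta \<psi> \<eta>\<bar>)"
    proof (rule integral_mono')
      show "integrable lborel (\<lambda>\<eta>. 2 powr \<beta> * C / (1 + s) * \<bar>zeta \<psi> \<eta>\<bar>)" using intz by simp
      fix \<eta> :: 'a
      show "norm (Z \<eta> * (E \<eta> - a * P \<eta>) * e \<eta>) \<le> 2 powr \<beta> * C / (1 + s) * \<bar>zeta \<psi> \<eta>\<bar>"
      proof (cases "norm \<eta> \<le> 1 / 2")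
        case True
        then show ?thesis using zeta_eq_0[OF \<psi>, of \<eta>] by (simp add: Z_def)
      next
        case False
        \<comment> \<open>On the support of \<open>zeta \<psi>\<close> one has
          \<open>|\<eta>| > 1/2\<close>, which allows \<open>1 + s |\<eta>|^\<beta>\<close> to be
          replaced by \<open>1 + s\<close> at the cost of the factor
          \<open>2^\<beta>\<close>.\<close>
        have "(1 / 2) powr \<beta> \<le> norm \<eta> powr \<beta>" using False \<beta> by (intro powr_mono2) auto
        then have "2 powr \<beta> * (1 / 2) powr \<beta> \<le> 2 powr \<beta> * norm \<eta> powr \<beta>" by (intro mult_left_mono) auto
        then have p: "1 \<le> 2 powr \<beta> * norm \<eta> powr \<beta>" by (simp add: powr_mult[symmetric])
        have "2 powr 0 \<le> (2::real) powr \<beta>" using \<beta> by (intro powr_mono) auto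
        moreover have "s * 1 \<le> s * (2 powr \<beta> * norm \<eta> powr \<beta>)"
          using p s by (intro mult_left_mono) auto
        ultimately have "1 + s \<le> 2 powr \<beta> + s * (2 powr \<beta> * norm \<eta> powr \<beta>)"
          by simp
        also have "\<dots> = 2 powr \<beta> * (1 + s * norm \<eta> powr \<beta>)" by (simp add: algebra_simps)
        finally have le: "1 + s \<le> 2 powr \<beta> * (1 + s * norm \<eta> powr \<beta>)" .
        have pos: "1 + s * norm \<eta> powr \<beta> > 0" using s by (simp add: add_pos_nonneg)
        have "norm (E \<eta> - a * P \<eta>) \<le> C / (1 + s * norm \<eta> powr \<beta>)"
          unfolding E_def P_def using s by (intro C(2)) simp
        also have "\<dots> \<le> 2 powr \<beta> * C / (1 + s)"
          using mult_left_mono[OF le C(1)] pos s by (simp add: divide_simps mult_ac)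
        finally have "norm (E \<eta> - a * P \<eta>) * \<bar>zeta \<psi> \<eta>\<bar> \<le> 2 powr \<beta> * C / (1 + s) * \<bar>zeta \<psi> \<eta>\<bar>"
          by (intro mult_right_mono) auto
        then show ?thesis by (simp add: norm_mult Z_def e_def mult_ac)
      qed
    qed (use C(1) s in auto)
    finally show ?thesis by simp
  qed
  finally show ?thesis unfolding PeZ unfolding Z_def E_def e_def by simp
qed

text \<open>Adding the trivial bound by the integral of \<open>|zeta \<psi>|\<close> to the square
  root of the quadratic estimate covers small and large \<open>s\<close> at once.\<close>

lemma zeta_oscillatory_decay:
  fixes \<psi> :: "'a::euclidean_space \<Rightarrow> real"
  assumes \<psi>: "radial_bump \<psi>" and b: "b > 0" "b \<noteq> 1"
  shows "\<exists>C\<ge>0. \<forall>s>0. \<forall>y. norm (LINT \<eta>|lborel. exp (\<i> * of_real (y \<bullet> \<eta> - s * norm \<eta> powr b)) * of_real (zeta \<psi> \<eta>))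
      \<le> C / (1 + s powr (real DIM('a) / 2))"
proof -
  define J where "J s y = (LINT \<eta>|lborel. exp (\<i> * of_real (y \<bullet> \<eta> - s * norm \<eta> powr b)) * of_real (zeta \<psi> \<eta>))" for s and y :: 'a
  obtain C where C: "C \<ge> 0" "\<And>s y. s > 0 \<Longrightarrow> (norm (J s y))\<^sup>2 * s ^ DIM('a) \<le> C"
    using zeta_oscillatory_bound[OF assms] unfolding J_def by blast
  define I where "I = (LINT \<eta>|lborel. \<bar>zeta \<psi> \<eta>\<bar>)"
  have I: "norm (J s y) \<le> I" for s y
    using integral_norm_bound[of lborel "\<lambda>\<eta>. exp (\<i> * of_real (y \<bullet> \<eta> - s * norm \<eta> powr b)) * of_real (zeta \<psi> \<eta>)"]
    by (simp only: J_def I_def norm_mult norm_exp_i_real norm_of_real mult_1)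
  have I0: "I \<ge> 0" by (simp add: I_def)
  have "norm (J s y) \<le> (I + sqrt C) / (1 + s powr (real DIM('a) / 2))" if s: "s > 0" for s y
  proof -
    define p where "p = s powr (real DIM('a) / 2)"
    have p: "p > 0" using s by (simp add: p_def)
    have "p\<^sup>2 = s ^ DIM('a)"
      using s by (simp add: p_def powr_realpow[symmetric] powr_powr powr_numeral[symmetric])
    then have "(norm (J s y) * p)\<^sup>2 \<le> C" using C(2)[OF s, of y] by (simp add: power_mult_distrib)
    then have "norm (J s y) * p \<le> sqrt C" by (rule real_le_rsqrt)
    then have "norm (J s y) * (1 + p) \<le> I + sqrt C" using I[of s y] by (simp add: distrib_left)
    then show ?thesis using p by (simp add: p_def[symmetric] pos_le_divide_eq add_pos_pos)
  qed
  then show ?thesis unfolding J_def using I0 C(1) by (intro exI[of _ "I + sqrt C"]) auto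
qed

text \<open>The fundamental solution is only a functional, so convolution is formed with a function
  representing its localisation. Such a function is determined almost everywhere, hence the
  integrals defining the convolution do not depend on the choice. One kernel serves both estimates,
  and the constants precede \<open>N\<close>, \<open>t\<close> and \<open>f\<close>.\<close>

theorem proposition5p2:
  fixes \<psi> :: "'a::euclidean_space \<Rightarrow> real" and \<alpha> \<beta> \<gamma> :: real
  assumes "radial_bump \<psi>"
    and "0 < \<alpha>" "\<alpha> < 1" "0 < \<beta>" "\<alpha> \<le> \<gamma>" "\<gamma> \<le> 1"
  shows "\<exists>k :: real \<Rightarrow> real \<Rightarrow> 'a \<Rightarrow> complex.
    (\<forall>N\<in>dyadic. \<forall>t>0. represents (k N t) (LP \<psi> N (fundamental_solution \<alpha> \<beta> \<gamma> t))) \<and>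
    (\<alpha> = \<gamma> \<and> \<alpha> \<noteq> \<beta> \<longrightarrow>
      (\<exists>C>0. \<forall>N\<in>dyadic. \<forall>t>0. \<forall>f. integrable lborel f \<longrightarrow>
        Linf_norm (convolution (k N t) f) \<le>
          ennreal (C * (N ^ DIM('a) *
            (1 / (1 + t powr \<alpha> * N powr \<beta>) +
             1 / (1 + t powr (real DIM('a) / 2) * N powr (real DIM('a) * \<beta> / (2 * \<alpha>)))) *
            L1_norm f)))) \<and>
    (\<alpha> < \<gamma> \<longrightarrow>
      (\<exists>C>0. \<forall>N\<in>dyadic. \<forall>t>0. \<forall>f. integrable lborel f \<longrightarrow>
        Linf_norm (convolution (k N t) f) \<le>
          ennreal (C * (N ^ DIM('a) / (1 + t powr \<alpha> * N powr \<beta>) * L1_norm f))))"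
proof -
  note \<psi> = assms(1) and \<alpha> = assms(2,3) and \<beta> = assms(4)
  define \<omega> where "\<omega> = ipow (- \<gamma>)"
  define m where "m t \<xi> = mittag_leffler \<alpha> (\<omega> * of_real (t powr \<alpha> * norm \<xi> powr \<beta>))" for t and \<xi> :: 'a
  define k where "k N t = inv_fourier (\<lambda>\<xi>. of_real (zeta \<psi> (\<xi> /\<^sub>R N)) * m t \<xi>)" for N t
  define I where "I = (LINT \<eta>|lborel. \<bar>zeta \<psi> \<eta>\<bar>)"
  define P where "P = (2 * pi) ^ DIM('a)"
  have P: "P > 0" by (simp add: P_def)
  have I0: "I \<ge> 0" by (simp add: I_def)
  have dyadic: "N > 0" if "N \<in> dyadic" for N using that by (auto simp: dyadic_def)
  have contm: "continuous_on UNIV (m t)" for t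
  proof -
    have "continuous_on UNIV (\<lambda>\<xi>::'a. norm \<xi> powr \<beta>)"
      using \<beta> by (intro continuous_on_powr' continuous_intros) auto
    then have "continuous_on UNIV (\<lambda>\<xi>::'a. \<omega> * complex_of_real (t powr \<alpha> * norm \<xi> powr \<beta>))"
      by (intro continuous_on_mult continuous_on_const continuous_on_of_real)
    from continuous_on_compose2[OF continuous_on_mittag_leffler[OF \<alpha>(1)] this]
    show ?thesis unfolding m_def by simp
  qed
  have rep: "represents (k N t) (LP \<psi> N (fundamental_solution \<alpha> \<beta> \<gamma> t))" if "N \<in> dyadic" for N t
    using LP_inv_fourier_dist[OF \<psi> dyadic[OF that] contm[of t]]
    unfolding k_def fundamental_solution_def m_def \<omega>_def .
  have meas [measurable]: "k N t \<in> borel_measurable borel" if "N \<in> dyadic" for N t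
    using rep[OF that, of t] by (simp add: represents_def)
  \<comment> \<open>The dilation \<open>\<xi> = N \<eta>\<close> produces the Jacobian
    \<open>N ^ DIM('a)\<close> and merges time and frequency into the single parameter
    \<open>t powr \<alpha> * N powr \<beta>\<close>; \<open>P\<close> is the normalisation of the
    inverse transform.\<close>
  have kbound: "norm (k N t x) \<le> N ^ DIM('a) / P *
      (2 powr \<beta> * C * I / (1 + t powr \<alpha> * N powr \<beta>) +
       norm a * norm (LINT \<eta>|lborel. exp (\<i> * of_real ((N *\<^sub>R x) \<bullet> \<eta> - (t powr \<alpha> * N powr \<beta>) powr (1 / \<alpha>) * norm \<eta> powr (\<beta> / \<alpha>))) * of_real (zeta \<psi> \<eta>)))"
    if N: "N \<in> dyadic" and t: "t > 0" and C: "C \<ge> 0" "\<And>\<rho>. \<rho> \<ge> 0 \<Longrightarrow>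
      norm (mittag_leffler \<alpha> (\<omega> * of_real \<rho>) - a * exp (- \<i> * of_real (\<rho> powr (1 / \<alpha>)))) \<le> C / (1 + \<rho>)"
    for N t x C a
  proof -
    have N0: "N > 0" using dyadic[OF N] .
    define g where "g \<xi> = of_real (zeta \<psi> (\<xi> /\<^sub>R N)) * m t \<xi>" for \<xi>
    have "continuous_on UNIV (\<lambda>\<xi>. zeta \<psi> (\<xi> /\<^sub>R N))"
      using symb_continuous[OF symb_zeta[OF \<psi>, of "UNIV :: unit set" 0 "inverse N"]] by simp
    then have "continuous_on UNIV g" unfolding g_def by (intro continuous_intros contm)
    then have mg: "g \<in> borel_measurable borel" by (rule borel_measurable_continuous_onI)
    have gN: "g (N *\<^sub>R \<eta>) = of_real (zeta \<psi> \<eta>) * mittag_leffler \<alpha> (\<omega> * of_real ((t powr \<alpha> * N powr \<beta>) * norm \<eta> powr \<beta>))" for \<eta>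
      using N0 by (simp add: g_def m_def powr_mult mult.assoc)
    have "k N t x = of_real (N ^ DIM('a)) * inv_fourier (\<lambda>\<eta>. g (N *\<^sub>R \<eta>)) (N *\<^sub>R x)"
      unfolding k_def using inv_fourier_dilate[OF mg N0, of x] by (simp add: g_def[abs_def])
    also have "norm \<dots> = N ^ DIM('a) / P * norm (LINT \<eta>|lborel. g (N *\<^sub>R \<eta>) * exp (\<i> * of_real ((N *\<^sub>R x) \<bullet> \<eta>)))"
      unfolding inv_fourier_def P_def norm_mult norm_divide norm_of_real using N0 by simp
    finally have eq: "norm (k N t x) = N ^ DIM('a) / P * norm (LINT \<eta>|lborel. g (N *\<^sub>R \<eta>) * exp (\<i> * of_real ((N *\<^sub>R x) \<bullet> \<eta>)))" .
    have "t powr \<alpha> * N powr \<beta> > 0" using t N0 by simp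
    from kernel_bound[OF \<psi> \<alpha>(1) \<beta> C this, of "N *\<^sub>R x"]
    show ?thesis unfolding eq gN I_def using N0 P by (intro mult_left_mono) auto
  qed
  have gt: "\<exists>C>0. \<forall>N\<in>dyadic. \<forall>t>0. \<forall>f. integrable lborel f \<longrightarrow>
        Linf_norm (convolution (k N t) f) \<le>
          ennreal (C * (N ^ DIM('a) / (1 + t powr \<alpha> * N powr \<beta>) * L1_norm f))" if \<gamma>: "\<alpha> < \<gamma>"
  proof -
    obtain C where C: "C \<ge> 0" "\<And>\<rho>. \<rho> \<ge> 0 \<Longrightarrow> norm (mittag_leffler \<alpha> (\<omega> * of_real \<rho>)) \<le> C / (1 + \<rho>)"
      using mittag_leffler_ray_bound[OF \<alpha> \<gamma> assms(6)] unfolding \<omega>_def by blast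
    define D where "D = 2 powr \<beta> * C * I / P"
    have D: "D \<ge> 0" using C(1) I0 P by (simp add: D_def)
    \<comment> \<open>\<open>D\<close> is only known to be nonnegative; \<open>D + 1\<close> is a
      positive constant.\<close>
    have "Linf_norm (convolution (k N t) f) \<le> ennreal ((D + 1) * (N ^ DIM('a) / (1 + t powr \<alpha> * N powr \<beta>) * L1_norm f))"
      if N: "N \<in> dyadic" and t: "t > 0" and f: "integrable lborel f" for N t f
    proof -
      define s where "s = t powr \<alpha> * N powr \<beta>"
      have s: "s > 0" using t dyadic[OF N] by (simp add: s_def)
      have "norm (k N t x) \<le> (D + 1) * (N ^ DIM('a) / (1 + s))" for x
      proof -
        \<comment> \<open>With \<open>a = 0\<close> the oscillatory term is absent.\<close>
        have "norm (k N t x) \<le> N ^ DIM('a) / P * (2 powr \<beta> * C * I / (1 + s))"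
          using kbound[OF N t C(1), of 0 x] C(2) by (simp add: s_def)
        also have "\<dots> = D * (N ^ DIM('a) / (1 + s))" by (simp add: D_def)
        also have "\<dots> \<le> (D + 1) * (N ^ DIM('a) / (1 + s))"
          using dyadic[OF N] s by (intro mult_right_mono) auto
        finally show ?thesis .
      qed
      from Linf_norm_convolution_le[OF meas[OF N] f this] show ?thesis by (simp only: s_def mult.assoc)
    qed
    then show ?thesis using D by (intro exI[of _ "D + 1"]) auto
  qed
  have eq: "\<exists>C>0. \<forall>N\<in>dyadic. \<forall>t>0. \<forall>f. integrable lborel f \<longrightarrow>
        Linf_norm (convolution (k N t) f) \<le>
          ennreal (C * (N ^ DIM('a) *
            (1 / (1 + t powr \<alpha> * N powr \<beta>) +
             1 / (1 + t powr (real DIM('a) / 2) * N powr (real DIM('a) * \<beta> / (2 * \<alpha>)))) *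
            L1_norm f))" if \<gamma>: "\<alpha> = \<gamma>" and ne: "\<alpha> \<noteq> \<beta>"
  proof -
    obtain C where C: "C \<ge> 0" "\<And>\<rho>. \<rho> \<ge> 0 \<Longrightarrow> norm (mittag_leffler \<alpha> (\<omega> * of_real \<rho>)
      - of_real (1 / \<alpha>) * exp (- \<i> * of_real (\<rho> powr (1 / \<alpha>)))) \<le> C / (1 + \<rho>)"
      using mittag_leffler_critical_ray[OF \<alpha>] unfolding \<omega>_def \<gamma>[symmetric] by blast
    have b: "\<beta> / \<alpha> > 0" "\<beta> / \<alpha> \<noteq> 1" using \<alpha> \<beta> ne by auto
    obtain C' where C': "C' \<ge> 0" "\<And>s y. s > 0 \<Longrightarrow>
      norm (LINT \<eta>|lborel. exp (\<i> * of_real (y \<bullet> \<eta> - s * norm \<eta> powr (\<beta> / \<alpha>))) * of_real (zeta \<psi> \<eta>))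
      \<le> C' / (1 + s powr (real DIM('a) / 2))"
      using zeta_oscillatory_decay[OF \<psi> b] by blast
    define D where "D = (2 powr \<beta> * C * I + C' / \<alpha>) / P"
    have D: "D \<ge> 0" using C(1) C'(1) I0 P \<alpha> by (simp add: D_def)
    have "Linf_norm (convolution (k N t) f) \<le> ennreal ((D + 1) * (N ^ DIM('a) *
            (1 / (1 + t powr \<alpha> * N powr \<beta>) +
             1 / (1 + t powr (real DIM('a) / 2) * N powr (real DIM('a) * \<beta> / (2 * \<alpha>)))) * L1_norm f))"
      if N: "N \<in> dyadic" and t: "t > 0" and f: "integrable lborel f" for N t f
    proof -
      define s where "s = t powr \<alpha> * N powr \<beta>"
      define q where "q = t powr (real DIM('a) / 2) * N powr (real DIM('a) * \<beta> / (2 * \<alpha>))"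
      have N0: "N > 0" using dyadic[OF N] .
      have s: "s > 0" using t N0 by (simp add: s_def)
      have q: "q > 0" using t N0 by (simp add: q_def)
      \<comment> \<open>The frequency of the oscillation is
        \<open>s^(1/\<alpha>) = t N^(\<beta>/\<alpha>)\<close>; its power \<open>d / 2\<close> is
        exactly the quantity in the second denominator.\<close>
      have sq: "(s powr (1 / \<alpha>)) powr (real DIM('a) / 2) = q"
        unfolding s_def q_def using t N0 \<alpha> by (simp add: powr_mult powr_powr mult.commute)
      have "norm (k N t x) \<le> (D + 1) * (N ^ DIM('a) * (1 / (1 + s) + 1 / (1 + q)))" for x
      proof -
        have "s powr (1 / \<alpha>) > 0" using s by simp
        note osc = C'(2)[OF this, of "N *\<^sub>R x", unfolded sq]
        note kbound[OF N t C, of x, folded s_def]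
        also have "N ^ DIM('a) / P * (2 powr \<beta> * C * I / (1 + s) + norm (complex_of_real (1 / \<alpha>)) *
            norm (LINT \<eta>|lborel. exp (\<i> * of_real ((N *\<^sub>R x) \<bullet> \<eta> - s powr (1 / \<alpha>) * norm \<eta> powr (\<beta> / \<alpha>))) * of_real (zeta \<psi> \<eta>)))
          \<le> N ^ DIM('a) / P * (2 powr \<beta> * C * I / (1 + s) + norm (complex_of_real (1 / \<alpha>)) * (C' / (1 + q)))"
          using P N0 by (intro mult_left_mono add_mono order_refl osc) auto
        also have "\<dots> = N ^ DIM('a) * ((2 powr \<beta> * C * I) / P * (1 / (1 + s)) + (C' / \<alpha>) / P * (1 / (1 + q)))"
        proof -
          have "norm (complex_of_real (1 / \<alpha>)) = 1 / \<alpha>" unfolding norm_of_real using \<alpha> by simp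
          then show ?thesis by (simp only: add_divide_distrib distrib_left times_divide_eq_left
                times_divide_eq_right divide_divide_eq_left mult_1 mult_1_right mult_ac)
        qed
        also have "\<dots> \<le> N ^ DIM('a) * (D * (1 / (1 + s)) + D * (1 / (1 + q)))"
          using N0 s q C(1) C'(1) I0 P \<alpha> unfolding D_def
          by (intro mult_left_mono add_mono mult_right_mono divide_right_mono) auto
        also have "\<dots> = D * (N ^ DIM('a) * (1 / (1 + s) + 1 / (1 + q)))" by (simp add: algebra_simps)
        also have "\<dots> \<le> (D + 1) * (N ^ DIM('a) * (1 / (1 + s) + 1 / (1 + q)))"
          using N0 s q by (intro mult_right_mono) auto
        finally show ?thesis .
      qed
      from Linf_norm_convolution_le[OF meas[OF N] f this] show ?thesis
        by (simp only: s_def q_def mult.assoc)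
    qed
    then show ?thesis using D by (intro exI[of _ "D + 1"]) auto
  qed
  show ?thesis
    by (rule exI[of _ k]) (use rep gt eq in blast)
qed

end
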